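(* Let $X_\Omega\subset\mathbb{C}^n$ be a star-shaped, concave toric domain with moment region $\Omega$. Then for any $C,\epsilon>0$ there is a smooth, star-shaped, concave moment region $\hat\Omega\supset\Omega$ that satisfies \[\mathrm{vol}(X_\Omega)\le\mathrm{vol}(X_{\hat\Omega})\le\mathrm{vol}(X_\Omega)+\epsilon,\qquad \mathrm{Ru}(X_{\hat\Omega})\ge C,\qquad c(X_\Omega)\le c(X_{\hat\Omega}).\]
   Context: On $\mathbb{C}^n$ with $z_j=x_j+iy_j$ let $\omega=\sum_j dx_j\wedge dy_j$, $Z=\frac12\sum_j(x_j\partial_{x_j}+y_j\partial_{y_j})$, $\lambda=\iota_Z\omega$. A star-shaped domain is a compact domain $X\subset\mathbb{C}^n$ with smooth boundary such that $0\in\mathrm{int}(X)$ and the radial vector field is transverse to $\partial X$. Then $\lambda|_{\partial X}$ is a contact form, with Reeb vector field $R$ given by $\lambda(R)=1$, $\iota_Rd\lambda|_{\partial X}=0$; $c(X)$ is the minimum period of a closed Reeb orbit on $\partial X$; $\mathrm{vol}$ is volume. Toric domains. Let $\mu(z)=(\pi|z_1|^2,\dots,\pi|z_n|^2)\in[0,\infty)^n$. The toric domain with moment region $\Omega\subset[0,\infty)^n$ is $X_\Omega=\mu^{-1}(\Omega)$. $\Omega$ is called smooth and star-shaped if $X_\Omega$ is a star-shaped domain (with smooth boundary), and concave if $[0,\infty)^n\setminus\Omega$ is convex; $X_\Omega$ is then called concave. Ruelle invariant. The canonical Hamiltonian $H_X:\mathbb{C}^n\setminus0\to(0,\infty)$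 of a star-shaped $X$ is the unique function with $ZH_X=H_X$ and $H_X^{-1}(1)=\partial X$. Let $\Phi_t$ be its Hamiltonian flow, i.e. the flow of $i\nabla H_X$. For $z\ne0$ view $d\Phi_t(z)\in\mathrm{Sp}(2n)$ via $T\mathbb{C}^n=\mathbb{C}^n$; let $d\Phi_t(z)=U_t(z)P_t(z)$ be its polar decomposition, $U_t(z)\in\mathrm{U}(n)$, $P_t(z)$ symmetric positive definite; let $t\mapsto\tilde u_t(z)$ be continuous with $\tilde u_0(z)=0$ and $\exp(2\pi i\tilde u_t(z))=\det_{\mathbb{C}}U_t(z)$. Then $\mathrm{ru}(X)=\lim_{T\to\infty}\tilde u_T/T$ (the limit exists almost everywhere and in $L^1$ on each $X_E=\{E\le H_X\le1\}$, $E>0$) and $\mathrm{Ru}(X)=\lim_{E\to0}\int_{X_E}\mathrm{ru}(X)\,\omega^n$.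
   Formalization: The formal statement assumes n ≥ 2; for n = 1 every such domain is a disk with Ru = 1, so the claim fails for C > 1. *)

theory Defs
  imports "HOL-Analysis.Analysis"
begin

section \<open>Smooth functions\<close>

(* On open subsets of a Euclidean space this is the class C^k: continuity of all
   iterated directional derivatives up to order k. *)
primrec Ck_on :: "nat \<Rightarrow> ('a::euclidean_space \<Rightarrow> 'b::real_normed_vector) \<Rightarrow> 'a set \<Rightarrow> bool" where
  "Ck_on 0 f S \<longleftrightarrow> continuous_on S f"
| "Ck_on (Suc k) f S \<longleftrightarrow>
     (\<forall>x\<in>S. f differentiable (at x)) \<and> (\<forall>v. Ck_on k (\<lambda>x. frechet_derivative f (at x) v) S)"

definition smooth_on :: "('a::euclidean_space \<Rightarrow> 'b::real_normed_vector) \<Rightarrow> 'a set \<Rightarrow> bool" where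
  "smooth_on f S \<longleftrightarrow> (\<forall>k. Ck_on k f S)"

definition smooth_boundary :: "'a::euclidean_space set \<Rightarrow> bool" where
  "smooth_boundary X \<longleftrightarrow>
     (\<forall>p\<in>frontier X. \<exists>U f. open U \<and> p \<in> U \<and> smooth_on f U \<and>
        X \<inter> U = {x\<in>U. f x \<le> (0::real)} \<and>
        (\<forall>x\<in>U. \<exists>v. frechet_derivative f (at x) v \<noteq> 0))"

(* Velocities at p of curves in S.  For a smooth hypersurface S, requiring the curves
   to be smooth rather than just differentiable at 0 gives the same set. *)
definition tangent_space :: "'a::real_normed_vector set \<Rightarrow> 'a \<Rightarrow> 'a set" where
  "tangent_space S p =
     {v. \<exists>\<gamma>::real \<Rightarrow> 'a. \<gamma> 0 = p \<and> (\<forall>\<^sub>F t in nhds 0. \<gamma> t \<in> S) \<and>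
          (\<gamma> has_vector_derivative v) (at 0)}"


section \<open>The standard symplectic structure\<close>

definition omega :: "complex ^ 'n \<Rightarrow> complex ^ 'n \<Rightarrow> real" where
  "omega u v = (\<Sum>j\<in>UNIV. Re (u $ j) * Im (v $ j) - Im (u $ j) * Re (v $ j))"

definition Zfield :: "complex ^ 'n \<Rightarrow> complex ^ 'n" where
  "Zfield z = (1/2) *\<^sub>R z"

definition liouville_form :: "complex ^ 'n \<Rightarrow> complex ^ 'n \<Rightarrow> real" where
  "liouville_form z v = omega (Zfield z) v"

(* d alpha (u, v) = u(alpha(v)) - v(alpha(u)) for constant vector fields u, v *)
definition exterior_derivative ::
    "('a::real_normed_vector \<Rightarrow> 'a \<Rightarrow> real) \<Rightarrow> 'a \<Rightarrow> 'a \<Rightarrow> 'a \<Rightarrow> real" where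
  "exterior_derivative \<alpha> p u v =
     frechet_derivative (\<lambda>x. \<alpha> x v) (at p) u - frechet_derivative (\<lambda>x. \<alpha> x u) (at p) v"


section \<open>Star-shaped domains and closed Reeb orbits\<close>

(* Transversality of the radial field z at p: the tangent space of the boundary is a
   hyperplane, so this means that p is not tangent.  Connectedness is part of "domain"; it
   excludes, e.g., a ball together with a concentric shell. *)
definition star_shaped_domain :: "(complex ^ 'n) set \<Rightarrow> bool" where
  "star_shaped_domain X \<longleftrightarrow>
     compact X \<and> connected X \<and> smooth_boundary X \<and> 0 \<in> interior X \<and>
     (\<forall>p\<in>frontier X. p \<notin> tangent_space (frontier X) p)"

definition reeb_field :: "(complex ^ 'n) set \<Rightarrow> complex ^ 'n \<Rightarrow> complex ^ 'n" where
  "reeb_field X p =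
     (THE R. R \<in> tangent_space (frontier X) p \<and> liouville_form p R = 1 \<and>
        (\<forall>v\<in>tangent_space (frontier X) p. exterior_derivative liouville_form p R v = 0))"

definition integral_curve ::
    "('a::real_normed_vector \<Rightarrow> 'a) \<Rightarrow> 'a set \<Rightarrow> (real \<Rightarrow> 'a) \<Rightarrow> bool" where
  "integral_curve V S \<gamma> \<longleftrightarrow>
     (\<forall>t. \<gamma> t \<in> S \<and> (\<gamma> has_vector_derivative V (\<gamma> t)) (at t))"

definition closed_reeb_orbit_period :: "(complex ^ 'n) set \<Rightarrow> real \<Rightarrow> bool" where
  "closed_reeb_orbit_period X T \<longleftrightarrow>
     T > 0 \<and> (\<exists>\<gamma>. integral_curve (reeb_field X) (frontier X) \<gamma> \<and> \<gamma> T = \<gamma> 0)"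

definition min_period :: "(complex ^ 'n) set \<Rightarrow> real" where
  "min_period X = (LEAST T. closed_reeb_orbit_period X T)"


section \<open>The Ruelle invariant\<close>

(* The value at the origin, where the Hamiltonian is not defined, is set to 0 to make
   the function unique. *)
definition canonical_hamiltonian :: "(complex ^ 'n) set \<Rightarrow> complex ^ 'n \<Rightarrow> real" where
  "canonical_hamiltonian X =
     (THE H. H 0 = 0 \<and> smooth_on H (- {0}) \<and>
        (\<forall>z. z \<noteq> 0 \<longrightarrow> H z > 0 \<and> frechet_derivative H (at z) (Zfield z) = H z) \<and>
        {z. z \<noteq> 0 \<and> H z = 1} = frontier X)"

definition gradient :: "('a::real_inner \<Rightarrow> real) \<Rightarrow> 'a \<Rightarrow> 'a" where
  "gradient f x = (THE D. GDERIV f x :> D)"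

definition hamiltonian_flow :: "(complex ^ 'n) set \<Rightarrow> real \<Rightarrow> complex ^ 'n \<Rightarrow> complex ^ 'n" where
  "hamiltonian_flow X t z =
     (THE \<gamma>. integral_curve (\<lambda>w. \<i> *s gradient (canonical_hamiltonian X) w) (- {0}) \<gamma> \<and>
             \<gamma> 0 = z) t"

definition unitary_matrix :: "complex ^ 'n ^ 'n \<Rightarrow> bool" where
  "unitary_matrix U \<longleftrightarrow> (\<chi> i j. cnj (U $ j $ i)) ** U = mat 1"

definition sym_pos_def :: "('a::real_inner \<Rightarrow> 'a) \<Rightarrow> bool" where
  "sym_pos_def P \<longleftrightarrow>
     linear P \<and> (\<forall>u v. P u \<bullet> v = u \<bullet> P v) \<and> (\<forall>v. v \<noteq> 0 \<longrightarrow> P v \<bullet> v > 0)"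

(* A and P are only real-linear endomorphisms of C^n = R^(2n); that the orthogonal factor
   is complex linear, i.e. a unitary matrix, relies on A being symplectic. *)
definition unitary_part :: "(complex ^ 'n \<Rightarrow> complex ^ 'n) \<Rightarrow> complex ^ 'n ^ 'n" where
  "unitary_part A =
     (THE U. unitary_matrix U \<and> (\<exists>P. sym_pos_def P \<and> A = (\<lambda>v. U *v P v)))"

definition rotation_lift :: "(complex ^ 'n) set \<Rightarrow> complex ^ 'n \<Rightarrow> real \<Rightarrow> real" where
  "rotation_lift X z =
     (THE u. continuous_on UNIV u \<and> u 0 = 0 \<and>
        (\<forall>t. exp (2 * complex_of_real pi * \<i> * complex_of_real (u t)) =
             det (unitary_part (frechet_derivative (hamiltonian_flow X t) (at z)))))"

definition ruelle_density :: "(complex ^ 'n) set \<Rightarrow> complex ^ 'n \<Rightarrow> real" where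
  "ruelle_density X z = Lim at_top (\<lambda>T. rotation_lift X z T / T)"

(* The factor n! comes from omega^n = n! dx_1 dy_1 ... dx_n dy_n. *)
definition Ruelle_invariant :: "(complex ^ 'n) set \<Rightarrow> real" where
  "Ruelle_invariant X =
     Lim (at_right 0)
       (\<lambda>E. fact CARD('n) *
          (LINT z : {z. z \<noteq> 0 \<and> E \<le> canonical_hamiltonian X z \<and> canonical_hamiltonian X z \<le> 1}
             | lebesgue. ruelle_density X z))"


section \<open>Toric domains\<close>

definition orthant :: "(real ^ 'n) set" where
  "orthant = {x. \<forall>i. 0 \<le> x $ i}"

definition moment_map :: "complex ^ 'n \<Rightarrow> real ^ 'n" where
  "moment_map z = (\<chi> j. pi * (cmod (z $ j))\<^sup>2)"

definition toric_domain :: "(real ^ 'n) set \<Rightarrow> (complex ^ 'n) set" where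
  "toric_domain \<Omega> = moment_map -` \<Omega>"

definition smooth_star_shaped_region :: "(real ^ 'n) set \<Rightarrow> bool" where
  "smooth_star_shaped_region \<Omega> \<longleftrightarrow> \<Omega> \<subseteq> orthant \<and> star_shaped_domain (toric_domain \<Omega>)"

definition concave_region :: "(real ^ 'n) set \<Rightarrow> bool" where
  "concave_region \<Omega> \<longleftrightarrow> convex (orthant - \<Omega>)"

end

theory Submission
  imports Defs
begin

text \<open>
  Choose finitely many positive linear forms \<open>c\<close> that cover \<open>\<Omega>\<close> by the half-spaces \<open>c < 1\<close> and
  exceed \<open>1\<close> on a slight dilation of the convex complement of \<open>\<Omega>\<close>, add one form
  \<open>(1/\<delta> + \<eta>, \<eta>, \<dots>, \<eta>)\<close> whose sublevel set is a long thin spike, and let \<open>\<Omega>'\<close> be the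
  sublevel set of \<open>g x = (\<Sum>c. (c \<bullet> x) powr (- p)) powr (- 1/p)\<close> for large \<open>p\<close>.  This smooths the
  minimum of the forms and keeps the complement convex.

  The Hamiltonian of \<open>X\<^sub>\<Omega>\<^sub>'\<close> is \<open>g \<circ> \<mu>\<close>, its flow rotates the coordinates with angular velocities
  \<open>2 \<pi> \<partial>\<^sub>j g\<close>, and in suitable unitary coordinates the linearized flow is this rotation times a
  product of shears, whose polar rotation angles stay bounded.  Hence the Ruelle density is
  \<open>\<Sum>\<^sub>j \<partial>\<^sub>j g \<ge> 0\<close>.  On the spike it is of order \<open>1/\<delta>\<close>; the spike has volume of order \<open>\<delta>\<close> times a
  power of its length, so a long spike makes the Ruelle invariant large and then a small \<open>\<delta>\<close> keeps
  the volume under control.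

  The minimal period of a concave toric domain is \<open>\<pi>\<close> times the squared distance from the origin to
  the boundary: on a Reeb orbit through \<open>p\<close> the coordinates rotate with positive velocities
  \<open>2 \<pi> a\<^sub>j\<close>, \<open>\<Sum> a\<^sub>j \<mu>\<^sub>j(p) = 1\<close>, and a period \<open>T\<close> makes every \<open>T a\<^sub>j\<close> with \<open>p\<^sub>j \<noteq> 0\<close> a positive integer.
  It is therefore monotone under inclusion.
\<close>

section \<open>Functions of class \<open>C\<^sup>k\<close>\<close>

text \<open>Thinness costs nothing: on the spike the density is at least of order
  1/\<open>\<delta>\<close> while the area in the thin coordinate is of order
  \<open>\<delta>\<close>, so the contribution to the Ruelle invariant depends only on the extent in
  the remaining coordinates. This takes a second coordinate; for n = 1 every domain is a disc, with
  Ruelle invariant 1. Since the density is nonnegative, the rest of the domain cannot cancel the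
  gain. The power sum settles two demands at once: \<open>g\<close> lies below every form, so
  \<open>\<Omega>\<close> stays inside for every \<open>p\<close>, and the complement is the set
  \<open>q x < 1\<close> of a convex \<open>q\<close>. Strictly positive coefficients (hence the
  \<open>\<eta>\<close> in the spike form) keep all forms positive on the closed orthant minus the
  origin; so \<open>g\<close> is smooth up to the coordinate hyperplanes, and the sublevel sets are
  bounded. Transversality alone does not say on which side a ray leaves the given domain; that sign,
  like the positivity of the angular velocities, comes from the convexity of the complement. Reeb
  field, Hamiltonian, flow, polar factor and lift are all defined by \<open>THE\<close>, so each
  formula for them comes with a uniqueness argument.\<close>

lemma Ck_on_Suc_imp: "Ck_on (Suc k) f S \<Longrightarrow> Ck_on k f S"
proof (induction k arbitrary: f)
  case 0
  then show ?case
    by (auto intro!: continuous_at_imp_continuous_on differentiable_imp_continuous_within)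
next
  case (Suc k)
  then show ?case by (metis Ck_on.simps(2))
qed

lemma frechet_derivative_eqI: "(f has_derivative f') (at x) \<Longrightarrow> frechet_derivative f (at x) = f'"
  by (metis frechet_derivative_at)

lemma Ck_on_SucD:
  assumes "Ck_on (Suc k) f S"
  shows "x \<in> S \<Longrightarrow> (f has_derivative frechet_derivative f (at x)) (at x)"
    and "Ck_on k (\<lambda>x. frechet_derivative f (at x) v) S"
  using assms by (auto simp: frechet_derivative_works)

text \<open>Openness matters: \<open>frechet_derivative\<close> at a point looks at a full
  neighborhood, so agreement on \<open>S\<close> passes to the derivatives only for open
  \<open>S\<close>.\<close>

lemma Ck_on_cong:
  assumes "open S" "\<And>x. x \<in> S \<Longrightarrow> f x = g x" "Ck_on k f S"
  shows "Ck_on k g S"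
  using assms(2,3)
proof (induction k arbitrary: f g)
  case 0
  then show ?case using continuous_on_cong[of S S f g] by simp
next
  case (Suc k)
  have d: "(g has_derivative frechet_derivative f (at x)) (at x)" if "x \<in> S" for x
  proof -
    have "(f has_derivative frechet_derivative f (at x)) (at x)"
      by (rule Ck_on_SucD(1)[OF Suc.prems(2) that])
    then show ?thesis
      by (rule has_derivative_transform_within_open[OF _ \<open>open S\<close> that]) (rule Suc.prems(1))
  qed
  have eq: "frechet_derivative f (at x) = frechet_derivative g (at x)" if "x \<in> S" for x
    using frechet_derivative_eqI[OF d[OF that]] by simp
  show ?case
  proof (unfold Ck_on.simps, intro conjI ballI allI)
    show "g differentiable at x" if "x \<in> S" for x
      using d[OF that] by (auto simp: differentiable_def)
    show "Ck_on k (\<lambda>x. frechet_derivative g (at x) v) S" for v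
      by (rule Suc.IH[of "\<lambda>x. frechet_derivative f (at x) v"]) (use eq Ck_on_SucD(2)[OF Suc.prems(2)] in auto)
  qed
qed

text \<open>Allows any explicitly known derivative in place of \<open>frechet_derivative\<close>;
  the inductions for the closure properties below go through this rule.\<close>

lemma Ck_on_SucI:
  assumes "open S" "\<And>x. x \<in> S \<Longrightarrow> (f has_derivative f' x) (at x)"
    "\<And>v. Ck_on k (\<lambda>x. f' x v) S"
  shows "Ck_on (Suc k) f S"
proof (unfold Ck_on.simps, intro conjI ballI allI)
  show "f differentiable at x" if "x \<in> S" for x
    using assms(2)[OF that] by (auto simp: differentiable_def)
  show "Ck_on k (\<lambda>x. frechet_derivative f (at x) v) S" for v
    by (rule Ck_on_cong[OF assms(1) _ assms(3)[of v]])
      (use frechet_derivative_eqI[OF assms(2)] in auto)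
qed

lemma Ck_on_const: "open S \<Longrightarrow> Ck_on k (\<lambda>x. c) S"
proof (induction k arbitrary: c)
  case (Suc k)
  show ?case
    by (rule Ck_on_SucI[where f' = "\<lambda>x v. 0"]) (use Suc in \<open>auto intro!: derivative_eq_intros\<close>)
qed auto

lemma Ck_on_bounded_linear:
  assumes "open S" "bounded_linear f"
  shows "Ck_on k f S"
proof (cases k)
  case 0
  then show ?thesis using assms by (simp add: linear_continuous_on)
next
  case (Suc m)
  show ?thesis unfolding Suc
    by (rule Ck_on_SucI[where f' = "\<lambda>x. f"])
      (use assms bounded_linear_imp_has_derivative Ck_on_const in auto)
qed

lemma Ck_on_add:
  assumes "open S" "Ck_on k f S" "Ck_on k g S"
  shows "Ck_on k (\<lambda>x. f x + g x) S"
  using assms(2,3)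
proof (induction k arbitrary: f g)
  case 0
  then show ?case by (auto intro: continuous_on_add)
next
  case (Suc k)
  show ?case
    by (rule Ck_on_SucI[OF assms(1) has_derivative_add[OF
          Ck_on_SucD(1)[OF Suc.prems(1)] Ck_on_SucD(1)[OF Suc.prems(2)]]])
      (auto intro: Suc.IH Ck_on_SucD(2)[OF Suc.prems(1)] Ck_on_SucD(2)[OF Suc.prems(2)])
qed

lemma Ck_on_mult:
  fixes f g :: "'a::euclidean_space \<Rightarrow> real"
  assumes "open S" "Ck_on k f S" "Ck_on k g S"
  shows "Ck_on k (\<lambda>x. f x * g x) S"
  using assms(2,3)
proof (induction k arbitrary: f g)
  case 0
  then show ?case by (auto intro: continuous_on_mult)
next
  case (Suc k)
  show ?case
  proof (rule Ck_on_SucI[OF assms(1) has_derivative_mult[OF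
          Ck_on_SucD(1)[OF Suc.prems(1)] Ck_on_SucD(1)[OF Suc.prems(2)]]])
    fix v
    show "Ck_on k (\<lambda>x. f x * frechet_derivative g (at x) v + frechet_derivative f (at x) v * g x) S"
      by (intro Ck_on_add[OF assms(1)] Suc.IH Ck_on_Suc_imp[OF Suc.prems(1)] Ck_on_Suc_imp[OF Suc.prems(2)]
          Ck_on_SucD(2)[OF Suc.prems(1)] Ck_on_SucD(2)[OF Suc.prems(2)])
  qed auto
qed

lemma Ck_on_sum:
  assumes "open S" "\<And>i. i \<in> I \<Longrightarrow> Ck_on k (f i) S"
  shows "Ck_on k (\<lambda>x. \<Sum>i\<in>I. f i x) S"
  using assms(2)
proof (induction I rule: infinite_finite_induct)
  case (insert i I)
  then show ?case using Ck_on_add[OF assms(1), of k "f i"] by simp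
qed (simp_all add: Ck_on_const assms(1))

text \<open>The exponent is generalized in the induction because differentiation lowers it by
  one.\<close>

lemma Ck_on_powr:
  fixes f :: "'a::euclidean_space \<Rightarrow> real"
  assumes "open S" "Ck_on k f S" "\<And>x. x \<in> S \<Longrightarrow> f x > 0"
  shows "Ck_on k (\<lambda>x. f x powr a) S"
  using assms(2)
proof (induction k arbitrary: a)
  case 0
  have "\<forall>x\<in>S. f x \<noteq> 0" using assms(3) by force
  then show ?case using 0 by (simp add: continuous_on_powr)
next
  case (Suc k)
  show ?case
  proof (rule Ck_on_SucI[OF assms(1), where
        f' = "\<lambda>x v. (a * f x powr (a - 1)) * frechet_derivative f (at x) v"])
    fix x assume x: "x \<in> S"
    have "((\<lambda>y. y powr a) has_real_derivative a * f x powr (a - 1)) (at (f x))"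
      by (rule has_real_derivative_powr[OF assms(3)[OF x]])
    then have "((\<lambda>y. y powr a) has_derivative (\<lambda>h. (a * f x powr (a - 1)) * h)) (at (f x))"
      by (simp add: has_field_derivative_def)
    from has_derivative_compose[OF Ck_on_SucD(1)[OF Suc.prems x] this]
    show "((\<lambda>x. f x powr a) has_derivative (\<lambda>v. (a * f x powr (a - 1)) * frechet_derivative f (at x) v)) (at x)" .
  next
    fix v
    show "Ck_on k (\<lambda>x. (a * f x powr (a - 1)) * frechet_derivative f (at x) v) S"
      by (intro Ck_on_mult Ck_on_const assms(1) Suc.IH Ck_on_Suc_imp[OF Suc.prems] Ck_on_SucD(2)[OF Suc.prems])
  qed
qed

section \<open>Tangent spaces of level sets\<close>

text \<open>The curve is \<open>p + t v + s(t) w\<close> with \<open>w\<close> normal.  The intermediate value theorem gives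
  zeros of \<open>f\<close> with \<open>|s| \<le> \<epsilon>|t|\<close> for every \<open>\<epsilon>\<close>; an almost minimal choice of \<open>|s(t)|\<close>
  works for all \<open>\<epsilon>\<close> at once.\<close>
lemma curve_in_level_set:
  fixes f :: "'a::euclidean_space \<Rightarrow> real"
  assumes U: "open U" "p \<in> U" and cont: "continuous_on U f"
    and der: "(f has_derivative (\<lambda>h. n \<bullet> h)) (at p)" and fp: "f p = 0"
    and n: "n \<noteq> 0" and nv: "n \<bullet> v = 0"
  obtains \<gamma> where "\<gamma> 0 = p" "\<forall>\<^sub>F t in nhds 0. \<gamma> t \<in> U \<and> f (\<gamma> t) = 0"
    "(\<gamma> has_vector_derivative v) (at 0)"
proof -
  \<comment> \<open>Normalized so that, to first order at \<open>p\<close>, the value of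
    \<open>f\<close> at \<open>p + t v + s w\<close> is \<open>s\<close>.\<close>
  define w where "w = (1 / (n \<bullet> n)) *\<^sub>R n"
  have nw: "n \<bullet> w = 1" using n by (simp add: w_def)
  define Z where "Z t s \<longleftrightarrow> p + t *\<^sub>R v + s *\<^sub>R w \<in> U \<and> f (p + t *\<^sub>R v + s *\<^sub>R w) = 0" for t s
  have zeros: "\<exists>\<delta>>0. \<forall>t. \<bar>t\<bar> < \<delta> \<longrightarrow> (\<exists>s. \<bar>s\<bar> \<le> \<epsilon> * \<bar>t\<bar> \<and> Z t s)" if "\<epsilon> > 0" for \<epsilon>
  proof -
    \<comment> \<open>For \<open>s\<close> of size at most \<open>\<epsilon> |t|\<close> the
      displacement from \<open>p\<close> is at most \<open>B |t|\<close>. Differentiability is used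
      with tolerance \<open>\<epsilon> / B\<close>, so \<open>f\<close> differs from
      \<open>s\<close> by at most \<open>\<epsilon> |t|\<close> and changes sign on the
      interval.\<close>
    define B where "B = norm v + \<epsilon> * norm w + 1"
    have B: "B > 0" using that by (simp add: B_def add_nonneg_pos)
    obtain r where r: "r > 0" "ball p r \<subseteq> U" using U open_contains_ball by metis
    obtain d where d: "d > 0" and der': "\<And>y. norm (y - p) < d \<Longrightarrow>
        norm (f y - f p - n \<bullet> (y - p)) \<le> (\<epsilon> / B) * norm (y - p)"
      using der[unfolded has_derivative_at_alt] \<open>\<epsilon> > 0\<close> B by (meson divide_pos_pos)
    define \<delta> where "\<delta> = min r d / B"
    have "\<delta> > 0" using r d B by (simp add: \<delta>_def)
    moreover have "\<exists>s. \<bar>s\<bar> \<le> \<epsilon> * \<bar>t\<bar> \<and> Z t s" if t: "\<bar>t\<bar> < \<delta>" for t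
    proof -
      let ?q = "\<lambda>s. p + t *\<^sub>R v + s *\<^sub>R w"
      let ?e = "\<epsilon> * \<bar>t\<bar>"
      have small: "norm (?q s - p) \<le> \<bar>t\<bar> * B \<and> norm (?q s - p) < min r d" if "\<bar>s\<bar> \<le> ?e" for s
      proof -
        have "norm (?q s - p) \<le> \<bar>t\<bar> * norm v + \<bar>s\<bar> * norm w"
          by (simp add: add.assoc norm_triangle_le)
        also have "\<dots> \<le> \<bar>t\<bar> * norm v + ?e * norm w"
          using that by (simp add: mult_right_mono)
        also have "\<dots> \<le> \<bar>t\<bar> * B" by (simp add: B_def algebra_simps)
        finally have 1: "norm (?q s - p) \<le> \<bar>t\<bar> * B" .
        have "\<bar>t\<bar> * B < min r d" using t B by (simp add: \<delta>_def field_simps)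
        then show ?thesis using 1 by linarith
      qed
      have inU: "?q s \<in> U" if "\<bar>s\<bar> \<le> ?e" for s
      proof -
        have "dist p (?q s) < r" using small[OF that] by (metis dist_commute dist_norm min_less_iff_conj)
        then show ?thesis using r(2) by auto
      qed
      have val: "\<bar>f (?q s) - s\<bar> \<le> ?e" if "\<bar>s\<bar> \<le> ?e" for s
      proof -
        have "n \<bullet> (?q s - p) = s" using nv nw by (simp add: inner_add_right)
        moreover have "norm (f (?q s) - f p - n \<bullet> (?q s - p)) \<le> (\<epsilon> / B) * norm (?q s - p)"
          by (rule der') (use small[OF that] in simp)
        ultimately have "\<bar>f (?q s) - s\<bar> \<le> (\<epsilon> / B) * norm (?q s - p)" using fp by simp
        also have "\<dots> \<le> (\<epsilon> / B) * (\<bar>t\<bar> * B)"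
          using small[OF that] B \<open>\<epsilon> > 0\<close> by (intro mult_left_mono) auto
        also have "\<dots> = ?e" using B by simp
        finally show ?thesis .
      qed
      have e: "?e \<ge> 0" using \<open>\<epsilon> > 0\<close> by simp
      have "f (?q (- ?e)) \<le> 0" "0 \<le> f (?q ?e)"
        using val[of "?e"] val[of "- ?e"] e by (auto simp: abs_le_iff)
      moreover have "continuous_on {-?e..?e} (\<lambda>s. f (?q s))"
        by (rule continuous_on_compose2[OF cont]) (auto intro!: continuous_intros inU)
      ultimately obtain s where "- ?e \<le> s" "s \<le> ?e" "f (?q s) = 0"
        using IVT'[of "\<lambda>s. f (?q s)" "- ?e" 0 ?e] e by auto
      then show ?thesis using inU[of s] by (intro exI[of _ s]) (auto simp: Z_def)
    qed
    ultimately show ?thesis by blast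
  qed
  \<comment> \<open>The infimum of the possible sizes need not be attained; the slack
    \<open>t\<^sup>2\<close> is harmless because it is o(t).\<close>
  have "\<exists>s. t \<noteq> 0 \<longrightarrow> (\<exists>s'. Z t s') \<longrightarrow> Z t s \<and> (\<forall>s'. Z t s' \<longrightarrow> \<bar>s\<bar> \<le> \<bar>s'\<bar> + t\<^sup>2)" for t
  proof (cases "t \<noteq> 0 \<and> (\<exists>s'. Z t s')")
    case True
    let ?A = "abs ` {s. Z t s}"
    have "?A \<noteq> {}" using True by auto
    moreover have "Inf ?A < Inf ?A + t\<^sup>2" using True by simp
    ultimately obtain a where "a \<in> ?A" "a < Inf ?A + t\<^sup>2" using cInf_lessD by meson
    moreover have "Inf ?A \<le> \<bar>s'\<bar>" if "Z t s'" for s'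
      by (rule cInf_lower) (use that in \<open>auto intro: bdd_belowI[of _ 0]\<close>)
    ultimately show ?thesis by fastforce
  qed auto
  then obtain s0 where s0: "\<And>t s'. t \<noteq> 0 \<Longrightarrow> Z t s' \<Longrightarrow> Z t (s0 t) \<and> \<bar>s0 t\<bar> \<le> \<bar>s'\<bar> + t\<^sup>2"
    by metis
  define s where "s t = (if t = 0 then 0 else s0 t)" for t
  define \<gamma> where "\<gamma> t = p + t *\<^sub>R v + s t *\<^sub>R w" for t
  have Z0: "Z 0 0" using U fp by (simp add: Z_def)
  have "\<forall>\<^sub>F t in nhds 0. Z t (s t)"
  proof -
    obtain \<delta> where "\<delta> > 0" "\<And>t. \<bar>t\<bar> < \<delta> \<Longrightarrow> \<exists>s. \<bar>s\<bar> \<le> 1 * \<bar>t\<bar> \<and> Z t s"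
      using zeros[of 1] by auto
    then show ?thesis
      unfolding eventually_nhds_metric using s0 Z0
      by (intro exI[of _ \<delta>]) (auto simp: s_def dist_real_def)
  qed
  then have "\<forall>\<^sub>F t in nhds 0. \<gamma> t \<in> U \<and> f (\<gamma> t) = 0" by (simp add: Z_def \<gamma>_def)
  moreover have "(s has_real_derivative 0) (at 0)"
    unfolding DERIV_def
  proof (rule tendstoI)
    fix e :: real assume "e > 0"
    then obtain \<delta> where \<delta>: "\<delta> > 0" "\<And>t. \<bar>t\<bar> < \<delta> \<Longrightarrow> \<exists>s. \<bar>s\<bar> \<le> (e/2) * \<bar>t\<bar> \<and> Z t s"
      using zeros[of "e/2"] by auto
    have "dist ((s (0 + h) - s 0) / h) 0 < e" if "h \<noteq> 0" "\<bar>h\<bar> < min \<delta> (e/2)" for h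
    proof -
      have "\<bar>h\<bar> < \<delta>" using that by simp
      from \<delta>(2)[OF this] obtain s' where "\<bar>s'\<bar> \<le> (e/2) * \<bar>h\<bar>" "Z h s'" by blast
      then have "\<bar>s h\<bar> \<le> (e/2) * \<bar>h\<bar> + h\<^sup>2" using s0[of h s'] that by (simp add: s_def)
      also have "h\<^sup>2 = \<bar>h\<bar> * \<bar>h\<bar>" by (simp add: power2_eq_square)
      also have "\<bar>h\<bar> * \<bar>h\<bar> < (e/2) * \<bar>h\<bar>" using that by (intro mult_strict_right_mono) auto
      finally have "\<bar>s h\<bar> < e * \<bar>h\<bar>" by simp
      then show ?thesis using that by (simp add: s_def dist_real_def abs_divide divide_less_eq)
    qed
    then show "\<forall>\<^sub>F h in at 0. dist ((s (0 + h) - s 0) / h) 0 < e"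
      unfolding eventually_at using \<delta>(1) \<open>e > 0\<close>
      by (intro exI[of _ "min \<delta> (e/2)"]) (auto simp: dist_real_def)
  qed
  then have "(\<gamma> has_vector_derivative v) (at 0)"
    unfolding \<gamma>_def by (auto intro!: derivative_eq_intros)
  moreover have "\<gamma> 0 = p" by (simp add: \<gamma>_def s_def)
  ultimately show ?thesis using that by blast
qed

text \<open>On \<open>U\<close> the frontier is exactly the zero set of \<open>f\<close>: an
  interior point of \<open>X\<close> with \<open>f = 0\<close> would be a local maximum, against the
  nonvanishing derivative. The chain rule then puts tangent vectors into the hyperplane, and
  \<open>curve_in_level_set\<close> realizes all of it.\<close>

lemma smooth_boundary_normal:
  fixes X :: "'a::euclidean_space set"
  assumes "closed X" "smooth_boundary X" "p \<in> frontier X"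
  obtains U f n where "open U" "p \<in> U" "continuous_on U f" "n \<noteq> 0"
    "(f has_derivative (\<lambda>h. n \<bullet> h)) (at p)" "X \<inter> U = {x\<in>U. f x \<le> 0}" "f p = (0::real)"
    "tangent_space (frontier X) p = {v. n \<bullet> v = 0}"
proof -
  obtain U and f :: "'a \<Rightarrow> real" where *: "open U \<and> p \<in> U \<and> smooth_on f U \<and>
      X \<inter> U = {x\<in>U. f x \<le> 0} \<and> (\<forall>x\<in>U. \<exists>v. frechet_derivative f (at x) v \<noteq> 0)"
    using assms(2)[unfolded smooth_boundary_def, rule_format, OF assms(3)] by (elim exE) (rule that)
  then have U: "open U" "p \<in> U" and sm: "smooth_on f U" and X: "X \<inter> U = {x\<in>U. f x \<le> 0}"
    by blast+
  have nz: "\<exists>v. frechet_derivative f (at x) v \<noteq> 0" if "x \<in> U" for x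
    using * that by blast
  have XU: "x \<in> X \<longleftrightarrow> f x \<le> 0" if "x \<in> U" for x
  proof -
    have "x \<in> X \<inter> U \<longleftrightarrow> x \<in> {x\<in>U. f x \<le> 0}" by (simp only: X)
    then show ?thesis using that by simp
  qed
  have "Ck_on 0 f U" "Ck_on 1 f U" using sm by (auto simp: smooth_on_def)
  then have cont: "continuous_on U f"
    and der: "\<And>x. x \<in> U \<Longrightarrow> (f has_derivative frechet_derivative f (at x)) (at x)"
    by (auto simp: frechet_derivative_works)
  have fr: "x \<in> frontier X \<longleftrightarrow> f x = 0" if "x \<in> U" for x
  proof
    assume x: "x \<in> frontier X"
    then have "x \<in> X" using assms(1) frontier_subset_closed by blast
    then have le: "f x \<le> 0" using XU[OF that] by simp
    have "\<not> f x < 0"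
    proof
      assume neg: "f x < 0"
      have "open (U \<inter> f -` {..<0})"
        by (rule continuous_open_preimage[OF cont U(1)]) simp
      moreover have "U \<inter> f -` {..<0} \<subseteq> X" using XU by auto
      ultimately have "x \<in> interior X" using neg that by (intro interiorI) auto
      then show False using x by (simp add: frontier_def)
    qed
    then show "f x = 0" using le by simp
  next
    assume x: "f x = 0"
    then have "x \<in> X" using XU[OF that] by simp
    moreover have "x \<notin> interior X"
    proof
      assume "x \<in> interior X"
      then have "x \<in> interior X \<inter> U" "open (interior X \<inter> U)" using that U by auto
      moreover have "\<forall>y\<in>interior X \<inter> U. f y \<le> f x"
        using XU x interior_subset by (metis Int_iff subsetD)
      ultimately have "frechet_derivative f (at x) = (\<lambda>v. 0)"
        by (intro differential_zero_maxmin[OF _ _ der[OF that]] disjI1)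
      then show False using nz[OF that] by auto
    qed
    ultimately show "x \<in> frontier X" using closure_subset by (auto simp: frontier_def)
  qed
  have fp: "f p = 0" using fr U assms(3) by blast
  have "linear (frechet_derivative f (at p))" by (rule has_derivative_linear[OF der[OF U(2)]])
  \<comment> \<open>The adjoint applied to 1 is the gradient: it represents the real functional as
    an inner product.\<close>
  then have adj: "frechet_derivative f (at p) = (\<lambda>h. adjoint (frechet_derivative f (at p)) 1 \<bullet> h)"
    using adjoint_works[of "frechet_derivative f (at p)" _ 1] by (intro ext) (simp add: inner_commute[of "adjoint _ _"])
  define n where "n = adjoint (frechet_derivative f (at p)) 1"
  have dn: "(f has_derivative (\<lambda>h. n \<bullet> h)) (at p)" unfolding n_def by (subst adj[symmetric]) (rule der[OF U(2)])
  have n0: "n \<noteq> 0"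
  proof
    assume "n = 0"
    then have "frechet_derivative f (at p) = (\<lambda>h. 0)" by (subst adj) (simp add: n_def fun_eq_iff)
    then show False using nz[OF U(2)] by simp
  qed
  have "tangent_space (frontier X) p = {v. n \<bullet> v = 0}"
  proof (intro set_eqI iffI)
    fix v assume "v \<in> tangent_space (frontier X) p"
    then obtain \<gamma> :: "real \<Rightarrow> 'a" where \<gamma>: "\<gamma> 0 = p" "\<forall>\<^sub>F t in nhds 0. \<gamma> t \<in> frontier X"
      "(\<gamma> has_vector_derivative v) (at 0)"
      by (auto simp: tangent_space_def)
    have c: "isCont \<gamma> 0" using \<gamma>(3) has_vector_derivative_continuous by blast
    have "\<forall>\<^sub>F t in nhds 0. \<gamma> t \<in> U"
      using c[unfolded continuous_at_open] U \<gamma>(1) unfolding eventually_nhds by metis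
    with \<gamma>(2) have ev: "\<forall>\<^sub>F t in nhds 0. f (\<gamma> t) = 0"
      by eventually_elim (simp add: fr)
    then obtain S where S: "open S" "0 \<in> S" "\<And>t. t \<in> S \<Longrightarrow> f (\<gamma> t) = 0"
      unfolding eventually_nhds by blast
    have "((\<lambda>t. f (\<gamma> t)) has_derivative (\<lambda>h. n \<bullet> (h *\<^sub>R v))) (at 0)"
      using has_derivative_compose[of \<gamma> "\<lambda>h. h *\<^sub>R v" 0 UNIV f "\<lambda>h. n \<bullet> h"] \<gamma>(1,3) dn
      by (simp add: has_vector_derivative_def)
    moreover have "((\<lambda>t. f (\<gamma> t)) has_derivative (\<lambda>h. 0)) (at 0)"
      by (rule has_derivative_transform_within_open[of "\<lambda>_. 0", OF _ S(1,2)]) (simp_all add: S(3))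
    ultimately have "(\<lambda>h. n \<bullet> (h *\<^sub>R v)) = (\<lambda>h::real. 0)" by (rule has_derivative_unique)
    from fun_cong[OF this, of 1] have "n \<bullet> v = 0" by simp
    then show "v \<in> {v. n \<bullet> v = 0}" by simp
  next
    fix v assume "v \<in> {v. n \<bullet> v = 0}"
    then obtain \<gamma> where \<gamma>: "\<gamma> 0 = p" "\<forall>\<^sub>F t in nhds 0. \<gamma> t \<in> U \<and> f (\<gamma> t) = 0"
      "(\<gamma> has_vector_derivative v) (at 0)"
      using curve_in_level_set[OF U cont dn fp n0] by auto
    from \<gamma>(2) have "\<forall>\<^sub>F t in nhds 0. \<gamma> t \<in> frontier X"
      by eventually_elim (simp add: fr)
    then show "v \<in> tangent_space (frontier X) p" using \<gamma> by (auto simp: tangent_space_def)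
  qed
  then show ?thesis by (rule that[OF U cont n0 dn X fp])
qed

section \<open>Reeb orbits of concave toric domains\<close>

lemma omega_eq_inner: "omega u v = (\<i> *s u) \<bullet> v"
  by (simp add: omega_def inner_vec_def inner_complex_def algebra_simps)

lemma inner_imaginary_smult: "(\<i> *s u) \<bullet> (\<i> *s v) = u \<bullet> v"
  by (simp add: inner_vec_def inner_complex_def algebra_simps)

lemma liouville_form_eq_inner: "liouville_form z v = (1/2) * ((\<i> *s z) \<bullet> v)"
  by (simp add: liouville_form_def omega_eq_inner Zfield_def inner_vec_def inner_complex_def
      sum_distrib_left algebra_simps)

lemma exterior_derivative_liouville:
  fixes p :: "complex ^ 'n"
  shows "exterior_derivative liouville_form p u v = (\<i> *s u) \<bullet> v"
proof -
  have "\<i> *s (c *\<^sub>R x) = c *\<^sub>R (\<i> *s x)" for c and x :: "complex ^ 'n"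
    by (simp add: vec_eq_iff)
  then have lin: "linear (\<lambda>x. liouville_form x w)" for w :: "complex ^ 'n"
    by (intro linearI) (simp_all add: liouville_form_eq_inner vector_add_ldistrib inner_add_left algebra_simps)
  have "frechet_derivative (\<lambda>x. liouville_form x w) (at p) u = liouville_form u w" for u w :: "complex ^ 'n"
    by (simp add: frechet_derivative_eqI[OF linear_imp_has_derivative[OF lin]])
  then have "exterior_derivative liouville_form p u v = liouville_form u v - liouville_form v u"
    by (simp add: exterior_derivative_def)
  also have "\<dots> = (1/2) * (omega u v - omega v u)" by (simp add: liouville_form_eq_inner omega_eq_inner algebra_simps)
  also have "omega v u = - omega u v"
    by (simp add: omega_def flip: sum_negf) (simp add: algebra_simps)
  finally show ?thesis by (simp add: omega_eq_inner)
qed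

text \<open>With J the multiplication by i, the Liouville form at p is v -> (Jp . v)/2, so Jn is
  normalized exactly when n . p = 2. The kernel condition says that JR is orthogonal to the
  hyperplane, hence parallel to n.\<close>

lemma reeb_field_eqI:
  assumes T: "tangent_space (frontier X) p = {v. n \<bullet> v = 0}" and np: "n \<bullet> p = 2"
  shows "reeb_field X p = \<i> *s n"
  unfolding reeb_field_def T exterior_derivative_liouville liouville_form_eq_inner
proof (rule the_equality)
  have ii: "\<i> *s (\<i> *s u) = - u" for u :: "complex ^ 'a" by (simp add: vec_eq_iff flip: mult.assoc)
  have a: "u \<bullet> (\<i> *s v) = - ((\<i> *s u) \<bullet> v)" for u v :: "complex ^ 'a"
    by (simp add: inner_vec_def inner_complex_def algebra_simps flip: sum_negf)
  have "n \<bullet> (\<i> *s n) = 0" using a[of n n] by (simp add: inner_commute)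
  moreover have "(\<i> *s p) \<bullet> (\<i> *s n) = 2" using np by (simp add: inner_imaginary_smult inner_commute)
  moreover have "(\<i> *s (\<i> *s n)) \<bullet> v = 0" if "n \<bullet> v = 0" for v using that ii by simp
  ultimately show "\<i> *s n \<in> {v. n \<bullet> v = 0} \<and> 1 / 2 * ((\<i> *s p) \<bullet> (\<i> *s n)) = 1 \<and>
    (\<forall>v\<in>{v. n \<bullet> v = 0}. (\<i> *s (\<i> *s n)) \<bullet> v = 0)" by simp
next
  have ii: "\<i> *s (\<i> *s u) = - u" for u :: "complex ^ 'a" by (simp add: vec_eq_iff flip: mult.assoc)
  fix R assume R: "R \<in> {v. n \<bullet> v = 0} \<and> 1 / 2 * ((\<i> *s p) \<bullet> R) = 1 \<and>
    (\<forall>v\<in>{v. n \<bullet> v = 0}. (\<i> *s R) \<bullet> v = 0)"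
  have n0: "n \<bullet> n \<noteq> 0" using np by auto
  define k where "k = ((\<i> *s R) \<bullet> n) / (n \<bullet> n)"
  \<comment> \<open>The part of JR orthogonal to \<open>n\<close>; testing the kernel condition on
    it shows that it vanishes.\<close>
  define v where "v = \<i> *s R - k *\<^sub>R n"
  have nv: "n \<bullet> v = 0" using n0 by (simp add: v_def k_def inner_diff_right inner_commute)
  then have "(\<i> *s R) \<bullet> v = 0" using R by simp
  then have "v \<bullet> v = 0" using nv by (simp add: v_def inner_diff_left)
  then have iR: "\<i> *s R = k *\<^sub>R n" by (simp add: v_def)
  have "(\<i> *s p) \<bullet> R = - (p \<bullet> (\<i> *s R))"
    by (simp add: inner_vec_def inner_complex_def algebra_simps flip: sum_negf)
  then have "k = - 1" using R np iR by (simp add: inner_commute)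
  then have "\<i> *s R = - n" using iR by simp
  then have "\<i> *s (\<i> *s R) = \<i> *s (- n)" by simp
  also have "\<dots> = - (\<i> *s n)" by (simp only: vec_eq_iff) simp
  finally have "\<i> *s (\<i> *s R) = - (\<i> *s n)" .
  then show "R = \<i> *s n" using ii[of R] by simp
qed

section \<open>Symmetry of toric domains under coordinatewise rotations\<close>

definition torus_action :: "complex ^ 'n \<Rightarrow> complex ^ 'n \<Rightarrow> complex ^ 'n" where
  "torus_action \<theta> z = (\<chi> j. \<theta> $ j * z $ j)"

lemma torus_action_nth [simp]: "torus_action \<theta> z $ j = \<theta> $ j * z $ j"
  by (simp add: torus_action_def)

lemma linear_torus_action: "linear (torus_action \<theta>)"
  by (rule linearI) (simp_all add: vec_eq_iff algebra_simps)

lemma torus_action_inner: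
  "(\<And>j. cmod (\<theta> $ j) = 1) \<Longrightarrow> torus_action \<theta> u \<bullet> v = u \<bullet> torus_action (\<chi> j. cnj (\<theta> $ j)) v"
  by (simp add: inner_vec_def inner_complex_def algebra_simps)

lemma torus_action_cnj:
  assumes "\<And>j. cmod (\<theta> $ j) = 1"
  shows "torus_action \<theta> (torus_action (\<chi> j. cnj (\<theta> $ j)) z) = z"
    "torus_action (\<chi> j. cnj (\<theta> $ j)) (torus_action \<theta> z) = z"
proof -
  have "\<theta> $ j * cnj (\<theta> $ j) = 1" "cnj (\<theta> $ j) * \<theta> $ j = 1" for j
    using assms[of j] by (simp_all add: complex_norm_square[symmetric] mult.commute)
  then show "torus_action \<theta> (torus_action (\<chi> j. cnj (\<theta> $ j)) z) = z"
    "torus_action (\<chi> j. cnj (\<theta> $ j)) (torus_action \<theta> z) = z"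
    by (simp_all add: vec_eq_iff flip: mult.assoc)
qed

lemma torus_action_dist:
  assumes "\<And>j. cmod (\<theta> $ j) = 1"
  shows "dist (torus_action \<theta> u) (torus_action \<theta> v) = dist u v"
proof -
  have "dist (\<theta> $ j * u $ j) (\<theta> $ j * v $ j) = dist (u $ j) (v $ j)" for j
    using assms[of j] by (simp add: dist_norm norm_mult flip: right_diff_distrib)
  then show ?thesis by (simp add: dist_vec_def)
qed

lemma moment_map_torus_action:
  "(\<And>j. cmod (\<theta> $ j) = 1) \<Longrightarrow> moment_map (torus_action \<theta> z) = moment_map z"
  by (simp add: moment_map_def norm_mult)

lemma torus_action_toric_domain:
  "(\<And>j. cmod (\<theta> $ j) = 1) \<Longrightarrow> torus_action \<theta> z \<in> toric_domain \<Omega> \<longleftrightarrow> z \<in> toric_domain \<Omega>"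
  by (simp add: toric_domain_def moment_map_torus_action)

text \<open>The action is an isometry preserving the domain, so the description of the frontier by
  balls is carried over.\<close>

lemma torus_action_frontier:
  assumes "\<And>j. cmod (\<theta> $ j) = 1" "p \<in> frontier (toric_domain \<Omega>)"
  shows "torus_action \<theta> p \<in> frontier (toric_domain \<Omega>)"
  using assms(2) unfolding frontier_straddle
  by (metis torus_action_dist[OF assms(1)] torus_action_toric_domain[OF assms(1)])

lemma torus_action_tangent:
  assumes "\<And>j. cmod (\<theta> $ j) = 1" "v \<in> tangent_space (frontier (toric_domain \<Omega>)) p"
  shows "torus_action \<theta> v \<in> tangent_space (frontier (toric_domain \<Omega>)) (torus_action \<theta> p)"
proof -
  obtain \<gamma> where \<gamma>: "\<gamma> 0 = p" "\<forall>\<^sub>F t in nhds 0. \<gamma> t \<in> frontier (toric_domain \<Omega>)"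
      "(\<gamma> has_vector_derivative v) (at (0::real))"
    using assms(2) by (auto simp: tangent_space_def)
  have "((\<lambda>t. torus_action \<theta> (\<gamma> t)) has_vector_derivative torus_action \<theta> v) (at 0)"
    using linear_torus_action linear_conv_bounded_linear \<gamma>(3)
      bounded_linear.has_vector_derivative by blast
  moreover have "\<forall>\<^sub>F t in nhds 0. torus_action \<theta> (\<gamma> t) \<in> frontier (toric_domain \<Omega>)"
    using \<gamma>(2) by eventually_elim (rule torus_action_frontier[OF assms(1)])
  ultimately show ?thesis using \<gamma>(1) by (auto simp: tangent_space_def)
qed

text \<open>Both inclusions come from \<open>torus_action_tangent\<close>, the first one applied to
  the inverse element, which is the conjugate of \<open>\<theta>\<close>.\<close>

lemma torus_action_normal:
  assumes \<theta>: "\<And>j. cmod (\<theta> $ j) = 1"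
    and T: "tangent_space (frontier (toric_domain \<Omega>)) p = {v. n \<bullet> v = 0}"
  shows "tangent_space (frontier (toric_domain \<Omega>)) (torus_action \<theta> p) = {v. torus_action \<theta> n \<bullet> v = 0}"
proof (intro set_eqI iffI)
  let ?c = "\<chi> j. cnj (\<theta> $ j)"
  have c: "cmod (?c $ j) = 1" for j using \<theta> by simp
  fix v
  {
    assume "v \<in> tangent_space (frontier (toric_domain \<Omega>)) (torus_action \<theta> p)"
    from torus_action_tangent[OF c this] show "v \<in> {v. torus_action \<theta> n \<bullet> v = 0}"
      using T by (simp add: torus_action_cnj[OF \<theta>] torus_action_inner[OF \<theta>])
  next
    assume "v \<in> {v. torus_action \<theta> n \<bullet> v = 0}"
    then have "torus_action ?c v \<in> tangent_space (frontier (toric_domain \<Omega>)) p"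
      using T by (simp add: torus_action_inner[OF \<theta>])
    from torus_action_tangent[OF \<theta> this]
    show "v \<in> tangent_space (frontier (toric_domain \<Omega>)) (torus_action \<theta> p)"
      by (simp add: torus_action_cnj[OF \<theta>])
  }
qed

lemma has_derivative_vec_lambda:
  fixes f :: "'a::real_normed_vector \<Rightarrow> 'n::finite \<Rightarrow> 'b::euclidean_space"
  assumes "\<And>j. ((\<lambda>x. f x j) has_derivative f' j) (at a within S)"
  shows "((\<lambda>x. \<chi> j. f x j) has_derivative (\<lambda>h. \<chi> j. f' j h)) (at a within S)"
proof (subst has_derivative_componentwise_within, rule ballI)
  fix i :: "'b ^ 'n" assume "i \<in> Basis"
  then obtain j u where i: "i = axis j u" by (auto simp: Basis_vec_def)
  show "((\<lambda>x. (\<chi> j. f x j) \<bullet> i) has_derivative (\<lambda>h. (\<chi> j. f' j h) \<bullet> i)) (at a within S)"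
    unfolding i inner_axis vec_lambda_beta by (rule has_derivative_inner_left[OF assms])
qed

text \<open>For unit phases \<open>\<phi>\<close>, a continuous section of the moment map over the
  orthant. Suitable phases make it pass through any prescribed point, which transfers closures and
  curves from the moment space to the domain.\<close>

definition moment_lift :: "complex ^ 'n \<Rightarrow> real ^ 'n \<Rightarrow> complex ^ 'n" where
  "moment_lift \<phi> x = (\<chi> j. of_real (sqrt (x $ j / pi)) * \<phi> $ j)"

lemma moment_map_moment_lift:
  assumes "\<And>j. cmod (\<phi> $ j) = 1" "x \<in> orthant"
  shows "moment_map (moment_lift \<phi> x) = x"
  using assms by (simp add: moment_map_def moment_lift_def vec_eq_iff norm_mult orthant_def)

lemma continuous_on_moment_lift: "continuous_on S (moment_lift \<phi>)"
  unfolding moment_lift_def by (intro continuous_intros) simp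

lemma continuous_on_moment_map: "continuous_on S moment_map"
  unfolding moment_map_def by (intro continuous_intros)

lemma moment_map_in_orthant: "moment_map z \<in> orthant"
  by (simp add: moment_map_def orthant_def)

lemma moment_lift_moment_map:
  obtains \<phi> where "\<And>j. cmod (\<phi> $ j) = 1" "moment_lift \<phi> (moment_map z) = z"
proof
  let ?\<phi> = "\<chi> j. if z $ j = 0 then 1 else sgn (z $ j)"
  show "cmod (?\<phi> $ j) = 1" for j by (simp add: norm_sgn)
  have "of_real (cmod w) * sgn w = w" for w
    by (simp add: sgn_eq)
  then show "moment_lift ?\<phi> (moment_map z) = z"
    by (simp add: moment_lift_def moment_map_def vec_eq_iff)
qed

text \<open>The moment map and the section through \<open>z\<close> are both continuous and exchange
  the two complements, so each carries closure points to closure points.\<close>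

lemma moment_map_in_closure_compl_iff:
  "moment_map z \<in> closure (orthant - \<Omega>) \<longleftrightarrow> z \<in> closure (- toric_domain \<Omega>)"
proof
  assume z: "z \<in> closure (- toric_domain \<Omega>)"
  have "moment_map ` (- toric_domain \<Omega>) \<subseteq> orthant - \<Omega>"
    using moment_map_in_orthant by (auto simp: toric_domain_def)
  then show "moment_map z \<in> closure (orthant - \<Omega>)"
    using image_closure_subset[OF continuous_on_moment_map[of "closure (- toric_domain \<Omega>)"] closed_closure[of "orthant - \<Omega>"]]
      closure_subset z by blast
next
  obtain \<phi> where \<phi>: "\<And>j. cmod (\<phi> $ j) = 1" "moment_lift \<phi> (moment_map z) = z"
    using moment_lift_moment_map by blast
  assume "moment_map z \<in> closure (orthant - \<Omega>)"
  moreover have "moment_lift \<phi> ` (orthant - \<Omega>) \<subseteq> - toric_domain \<Omega>"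
    using moment_map_moment_lift[OF \<phi>(1)] by (auto simp: toric_domain_def)
  then have "moment_lift \<phi> ` (orthant - \<Omega>) \<subseteq> closure (- toric_domain \<Omega>)"
    using closure_subset by blast
  then have "moment_lift \<phi> ` closure (orthant - \<Omega>) \<subseteq> closure (- toric_domain \<Omega>)"
    by (intro image_closure_subset continuous_on_moment_lift) auto
  ultimately have "moment_lift \<phi> (moment_map z) \<in> closure (- toric_domain \<Omega>)" by blast
  then show "z \<in> closure (- toric_domain \<Omega>)" using \<phi>(2) by simp
qed

lemma interior_toric_domain_iff:
  "z \<in> interior (toric_domain \<Omega>) \<longleftrightarrow> moment_map z \<notin> closure (orthant - \<Omega>)"
  by (simp add: moment_map_in_closure_compl_iff interior_closure)

lemma norm_eq_moment_map: "pi * (norm z)\<^sup>2 = (\<Sum>j\<in>UNIV. moment_map z $ j)"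
  by (simp add: norm_vec_def L2_set_def sum_nonneg moment_map_def sum_distrib_left)

text \<open>Supplies points of the convex complement, arbitrarily far out on every axis, towards
  which segments can be drawn.\<close>

lemma axis_notin_region:
  assumes "bounded (toric_domain \<Omega>)"
  obtains M0 where "M0 > 0" "\<And>M j. M \<ge> M0 \<Longrightarrow> axis j M \<in> orthant - \<Omega>"
proof -
  obtain R where R: "R > 0" "\<And>z. z \<in> toric_domain \<Omega> \<Longrightarrow> norm z \<le> R"
    using assms bounded_pos by metis
  show ?thesis
  proof
    show "pi * R\<^sup>2 + 1 > 0" by (simp add: add_nonneg_pos)
    fix M :: real and j :: 'a assume M: "M \<ge> pi * R\<^sup>2 + 1"
    have M0: "M \<ge> 0" using M by (meson add_nonneg_nonneg order.trans pi_ge_zero mult_nonneg_nonneg zero_le_power2 zero_le_one)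
    then have o: "axis j M \<in> orthant" by (auto simp: orthant_def axis_def)
    let ?z = "moment_lift (\<chi> j. 1) (axis j M)"
    have mz: "moment_map ?z = axis j M" by (rule moment_map_moment_lift) (use o in auto)
    have "axis j M \<notin> \<Omega>"
    proof
      assume "axis j M \<in> \<Omega>"
      then have "?z \<in> toric_domain \<Omega>" by (simp add: toric_domain_def mz)
      then have "(norm ?z)\<^sup>2 \<le> R\<^sup>2" using R by (simp add: power_mono)
      moreover have "pi * (norm ?z)\<^sup>2 = M" unfolding norm_eq_moment_map mz by (simp add: axis_def)
      ultimately have "M \<le> pi * R\<^sup>2" by (metis mult_left_mono pi_ge_zero)
      then show False using M by simp
    qed
    then show "axis j M \<in> orthant - \<Omega>" using o by blast
  qed
qed

text \<open>Torus symmetry makes each component of the normal a real multiple of that of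
  \<open>p\<close>; convexity of the complement gives the signs. The local defining function is part
  of the conclusion because its positive factor \<open>\<kappa>\<close> later decides in which
  direction rays cross the frontier.\<close>

lemma reeb_field_concave_toric:
  fixes \<Omega> :: "(real ^ 'n) set"
  assumes X: "star_shaped_domain (toric_domain \<Omega>)" and K: "convex (orthant - \<Omega>)"
    and p: "p \<in> frontier (toric_domain \<Omega>)"
  obtains n b U f \<kappa> where
    "n \<bullet> p = 2" "tangent_space (frontier (toric_domain \<Omega>)) p = {v. n \<bullet> v = 0}"
    "reeb_field (toric_domain \<Omega>) p = \<i> *s n"
    "\<And>j. b j > (0::real)" "\<And>j. n $ j = b j *\<^sub>R p $ j"
    "open U" "p \<in> U" "f p = (0::real)" "\<kappa> > 0" "(f has_derivative (\<lambda>h. \<kappa> * (n \<bullet> h))) (at p)"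
    "toric_domain \<Omega> \<inter> U = {x\<in>U. f x \<le> 0}"
proof -
  let ?X = "toric_domain \<Omega>"
  have cpt: "compact ?X" and sb: "smooth_boundary ?X" and trans: "p \<notin> tangent_space (frontier ?X) p"
    using X p by (auto simp: star_shaped_domain_def)
  obtain U f m where U: "open U" "p \<in> U" "continuous_on U f" and m0: "m \<noteq> 0"
    and der: "(f has_derivative (\<lambda>h. m \<bullet> h)) (at p)" and XU: "?X \<inter> U = {x\<in>U. f x \<le> 0}"
    and fp: "f p = (0::real)" and Tm: "tangent_space (frontier ?X) p = {v. m \<bullet> v = 0}"
    by (rule smooth_boundary_normal[OF compact_imp_closed[OF cpt] sb p])
  have mp: "m \<bullet> p \<noteq> 0" using trans Tm by auto
  define n where "n = (2 / (m \<bullet> p)) *\<^sub>R m"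
  define \<kappa> where "\<kappa> = (m \<bullet> p) / 2"
  have np: "n \<bullet> p = 2" using mp by (simp add: n_def)
  have mn: "m = \<kappa> *\<^sub>R n" using mp by (simp add: n_def \<kappa>_def)
  have \<kappa>0: "\<kappa> \<noteq> 0" using mp by (simp add: \<kappa>_def)
  have T: "tangent_space (frontier ?X) p = {v. n \<bullet> v = 0}" using Tm \<kappa>0 by (simp add: mn)
  have reeb: "reeb_field ?X p = \<i> *s n" by (rule reeb_field_eqI[OF T np])
  have derk: "(f has_derivative (\<lambda>h. \<kappa> * (n \<bullet> h))) (at p)" using der by (simp add: mn)
  \<comment> \<open>The reflection in coordinate j fixes \<open>p\<close>, so it maps the normal to
    a normal with the same normalization; uniqueness of the Reeb field turns this into n_j =
    -n_j.\<close>
  have n0: "n $ j = 0" if "p $ j = 0" for j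
  proof -
    define \<theta> :: "complex ^ 'n" where "\<theta> = (\<chi> k. if k = j then - 1 else 1)"
    have \<theta>: "cmod (\<theta> $ k) = 1" for k by (simp add: \<theta>_def)
    have "torus_action \<theta> p = p" using that by (simp add: vec_eq_iff \<theta>_def)
    with torus_action_normal[OF \<theta> T] have T': "tangent_space (frontier ?X) p = {v. torus_action \<theta> n \<bullet> v = 0}" by simp
    have "torus_action (\<chi> k. cnj (\<theta> $ k)) p = p" using that by (simp add: vec_eq_iff \<theta>_def)
    then have "torus_action \<theta> n \<bullet> p = 2" using np by (simp add: torus_action_inner[OF \<theta>])
    from reeb_field_eqI[OF T' this] reeb have "\<i> *s n = \<i> *s torus_action \<theta> n" by simp
    then have "(\<i> *s n) $ j = (\<i> *s torus_action \<theta> n) $ j" by simp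
    then show ?thesis by (simp add: \<theta>_def)
  qed
  \<comment> \<open>Rotating coordinate j stays in the frontier, so i p_j is tangent in that
    coordinate; orthogonality to it leaves only real multiples of p_j.\<close>
  have nj: "\<exists>c::real. n $ j = c *\<^sub>R p $ j" if "p $ j \<noteq> 0" for j
  proof -
    define \<gamma> where "\<gamma> t = p + axis j ((exp (\<i> * of_real t) - 1) * p $ j)" for t :: real
    have \<gamma>a: "\<gamma> t = torus_action (\<chi> k. if k = j then exp (\<i> * of_real t) else 1) p" for t
      by (simp add: \<gamma>_def vec_eq_iff axis_def algebra_simps)
    have "\<gamma> t \<in> frontier ?X" for t unfolding \<gamma>a
      by (rule torus_action_frontier[OF _ p]) simp
    moreover have "(\<gamma> has_vector_derivative axis j (\<i> * p $ j)) (at 0)"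
    proof -
      have "((\<lambda>t. (exp (\<i> * of_real t) - 1) * p $ j) has_vector_derivative \<i> * p $ j) (at 0)"
        by (rule has_vector_derivative_real_field[of "\<lambda>z. (exp (\<i> * z) - 1) * p $ j"])
          (auto intro!: derivative_eq_intros)
      moreover have "bounded_linear (axis j :: complex \<Rightarrow> complex ^ 'n)"
        unfolding linear_conv_bounded_linear[symmetric]
        by (rule linearI) (simp_all add: axis_def vec_eq_iff)
      ultimately have "((\<lambda>t. axis j ((exp (\<i> * of_real t) - 1) * p $ j)) has_vector_derivative axis j (\<i> * p $ j)) (at 0)"
        using bounded_linear.has_vector_derivative by blast
      from has_vector_derivative_add[OF has_vector_derivative_const[of p] this]
      show ?thesis unfolding \<gamma>_def[abs_def] by simp
    qed
    moreover have "\<gamma> 0 = p" by (simp add: \<gamma>_def vec_eq_iff axis_def)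
    ultimately have "axis j (\<i> * p $ j) \<in> tangent_space (frontier ?X) p"
      unfolding tangent_space_def by (intro CollectI exI[of _ \<gamma>]) simp
    then have "n \<bullet> axis j (\<i> * p $ j) = 0" using T by simp
    then have im: "Im (n $ j) * Re (p $ j) = Re (n $ j) * Im (p $ j)"
      by (simp add: inner_axis inner_complex_def)
    let ?s = "(Re (p $ j))\<^sup>2 + (Im (p $ j))\<^sup>2"
    have s: "?s \<noteq> 0" using that by (simp add: complex_eq_iff sum_power2_eq_zero_iff)
    have "n $ j = ((Re (n $ j) * Re (p $ j) + Im (n $ j) * Im (p $ j)) / ?s) *\<^sub>R p $ j"
      unfolding complex_eq_iff
    proof (intro conjI)
      have "Re (n $ j) * ?s = (Re (n $ j) * Re (p $ j) + Im (n $ j) * Im (p $ j)) * Re (p $ j)"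
        using im by (simp add: power2_eq_square algebra_simps)
      then show "Re (n $ j) = Re (((Re (n $ j) * Re (p $ j) + Im (n $ j) * Im (p $ j)) / ?s) *\<^sub>R p $ j)"
        using s by (simp add: eq_divide_eq)
      have "Im (n $ j) * ?s = (Re (n $ j) * Re (p $ j) + Im (n $ j) * Im (p $ j)) * Im (p $ j)"
        using im by (simp add: power2_eq_square algebra_simps)
      then show "Im (n $ j) = Im (((Re (n $ j) * Re (p $ j) + Im (n $ j) * Im (p $ j)) / ?s) *\<^sub>R p $ j)"
        using s by (simp add: eq_divide_eq)
    qed
    then show ?thesis by blast
  qed
  then obtain b0 :: "'n \<Rightarrow> real" where b0: "\<And>j. p $ j \<noteq> 0 \<Longrightarrow> n $ j = b0 j *\<^sub>R p $ j" by metis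
  \<comment> \<open>Where p_j = 0 the component n_j vanishes too, so any positive value may be put
    there; this makes positivity hold for all j.\<close>
  define b where "b j = (if p $ j = 0 then 1 else b0 j)" for j
  have bn: "n $ j = b j *\<^sub>R p $ j" for j using b0 n0 by (simp add: b_def)
  have sum_b: "(\<Sum>j\<in>UNIV. b j * (cmod (p $ j))\<^sup>2) = 2"
    using np by (simp add: inner_vec_def bn power2_norm_eq_inner)
  obtain M0 where M0: "M0 > 0" "\<And>M j. M \<ge> M0 \<Longrightarrow> axis j M \<in> orthant - \<Omega>"
    using axis_notin_region compact_imp_bounded[OF cpt] by metis
  text \<open>By convexity of the complement, the segment from \<open>\<mu>(p)\<close> to \<open>M e\<^sub>j\<close> lifts to a curve
    starting at \<open>p\<close> along which the defining function is nonnegative.\<close>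
  have key: "\<kappa> * (b j * M / (2 * pi) - 1) \<ge> 0" if j: "p $ j \<noteq> 0" and M: "M \<ge> M0" for j M
  proof -
    \<comment> \<open>Along the segment the i-th moment coordinate is \<open>1 + t * a i\<close>
      times its initial value; \<open>c\<close> lifts the segment through the square root and
      \<open>c'\<close> is its velocity at 0.\<close>
    define a where "a i = (if i = j then M / moment_map p $ j else 0) - 1" for i
    define c where "c t = (\<chi> i. of_real (sqrt (1 + t * a i)) * p $ i)" for t :: real
    define c' where "c' = (\<chi> i. of_real (a i / 2) * p $ i)"
    have pj: "moment_map p $ j > 0" using j by (simp add: moment_map_def)
    have dc: "(c has_vector_derivative c') (at 0)"
    proof -
      have "((\<lambda>t. of_real (sqrt (1 + t * a i)) * p $ i) has_derivative (\<lambda>h. h *\<^sub>R (of_real (a i / 2) * p $ i))) (at 0)" for i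
      proof -
        have "((\<lambda>t. sqrt (1 + t * a i)) has_real_derivative a i / 2) (at 0)"
          by (auto intro!: derivative_eq_intros simp: field_simps)
        then have "((\<lambda>t. sqrt (1 + t * a i)) has_vector_derivative a i / 2) (at 0)"
          by (simp only: has_real_derivative_iff_has_vector_derivative)
        then have "((\<lambda>t. of_real (sqrt (1 + t * a i)) * p $ i) has_vector_derivative of_real (a i / 2) * p $ i) (at 0)"
          by (intro has_vector_derivative_mult_left has_vector_derivative_of_real)
            (simp only: has_real_derivative_iff_has_vector_derivative)
        then show ?thesis by (simp add: has_vector_derivative_def)
      qed
      then have "(c has_derivative (\<lambda>h. \<chi> i. h *\<^sub>R (of_real (a i / 2) * p $ i))) (at 0)"
        unfolding c_def by (rule has_derivative_vec_lambda)
      moreover have "(\<lambda>h. \<chi> i. h *\<^sub>R (of_real (a i / 2) * p $ i)) = (\<lambda>h. h *\<^sub>R c')"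
        by (auto simp: c'_def vec_eq_iff)
      ultimately show ?thesis by (simp add: has_vector_derivative_def)
    qed
    have c0: "c 0 = p" by (simp add: c_def vec_eq_iff)
    have out: "c t \<in> closure (- ?X)" if t: "0 \<le> t" "t \<le> 1" for t
    proof -
      have ge: "1 + t * a i \<ge> 0" for i
      proof -
        have "a i \<ge> - 1" using pj M M0(1) by (simp add: a_def)
        then have "t * a i \<ge> t * (- 1)" using t by (intro mult_left_mono)
        then show ?thesis using t by simp
      qed
      have "moment_map (c t) = (1 - t) *\<^sub>R moment_map p + t *\<^sub>R axis j M"
        unfolding vec_eq_iff
      proof
        fix i
        have "moment_map (c t) $ i = (1 + t * a i) * moment_map p $ i"
          using ge[of i] by (simp add: moment_map_def c_def norm_mult power_mult_distrib)
        then show "moment_map (c t) $ i = ((1 - t) *\<^sub>R moment_map p + t *\<^sub>R axis j M) $ i"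
          using pj by (simp add: a_def axis_def algebra_simps)
      qed
      moreover have "moment_map p \<in> closure (orthant - \<Omega>)"
        using p by (simp add: moment_map_in_closure_compl_iff frontier_closures)
      moreover have "axis j M \<in> closure (orthant - \<Omega>)"
        using M0(2)[OF M] closure_subset by blast
      ultimately have "moment_map (c t) \<in> closure (orthant - \<Omega>)"
        using convex_closure[OF K] t by (simp add: convex_alt)
      then show ?thesis by (simp add: moment_map_in_closure_compl_iff)
    qed
    have nonneg: "f (c t) \<ge> 0" if t: "0 \<le> t" "t \<le> 1" "c t \<in> U" for t
    proof (rule ccontr)
      assume "\<not> f (c t) \<ge> 0"
      then have "c t \<in> U \<inter> f -` {..<0}" using t by simp
      moreover have "open (U \<inter> f -` {..<0})"
        by (rule continuous_open_preimage[OF U(3,1)]) simp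
      ultimately obtain y where "y \<in> - ?X" "y \<in> U \<inter> f -` {..<0}"
        using out[OF t(1,2)] closure_iff_nhds_not_empty by (metis disjoint_iff order_refl)
      then have "y \<in> U" "f y \<le> 0" "y \<notin> ?X \<inter> U" by auto
      then show False unfolding XU by simp
    qed
    have "isCont c 0" using dc has_vector_derivative_continuous by blast
    then have "\<forall>\<^sub>F t in nhds 0. c t \<in> U"
      using U(1,2) c0 unfolding continuous_at_open eventually_nhds by metis
    then obtain e where e: "e > 0" "\<And>t. \<bar>t\<bar> < e \<Longrightarrow> c t \<in> U"
      unfolding eventually_nhds_metric by (auto simp: dist_real_def)
    have "((\<lambda>t. f (c t)) has_derivative (\<lambda>h. \<kappa> * (n \<bullet> (h *\<^sub>R c')))) (at 0)"
      using has_derivative_compose[of c "\<lambda>h. h *\<^sub>R c'" 0 UNIV f "\<lambda>h. \<kappa> * (n \<bullet> h)"] dc c0 derk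
      by (simp add: has_vector_derivative_def)
    moreover have "(\<lambda>h. \<kappa> * (n \<bullet> (h *\<^sub>R c'))) = (*) (\<kappa> * (n \<bullet> c'))"
      by (simp add: fun_eq_iff)
    ultimately have dfc: "((\<lambda>t. f (c t)) has_real_derivative \<kappa> * (n \<bullet> c')) (at 0)"
      by (simp only: has_field_derivative_def)
    have "\<kappa> * (n \<bullet> c') \<ge> 0"
    proof (rule ccontr)
      assume "\<not> \<kappa> * (n \<bullet> c') \<ge> 0"
      then have "\<kappa> * (n \<bullet> c') < 0" by simp
      from has_real_derivative_neg_dec_right[OF dfc this]
      obtain d where d: "d > 0" "\<And>h. h > 0 \<Longrightarrow> h < d \<Longrightarrow> f (c h) < f (c 0)" by auto
      define h where "h = min (min (d/2) (e/2)) 1"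
      have "h > 0" "h < d" "\<bar>h\<bar> < e" "h \<le> 1" using d e by (auto simp: h_def)
      then show False using d(2)[of h] nonneg[of h] e(2)[of h] c0 fp by simp
    qed
    moreover have "n \<bullet> c' = b j * M / (2 * pi) - 1"
    proof -
      have "n $ i \<bullet> c' $ i = (a i / 2) * (b i * (cmod (p $ i))\<^sup>2)" for i
      proof -
        have "c' $ i = (a i / 2) *\<^sub>R p $ i" by (simp add: c'_def scaleR_conv_of_real)
        then show ?thesis by (simp add: bn power2_norm_eq_inner)
      qed
      then have "n \<bullet> c' = (\<Sum>i\<in>UNIV. (a i / 2) * (b i * (cmod (p $ i))\<^sup>2))"
        by (simp only: inner_vec_def)
      also have "\<dots> = (\<Sum>i\<in>UNIV. (if i = j then M / moment_map p $ j * (b j * (cmod (p $ j))\<^sup>2) / 2 else 0)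
          - b i * (cmod (p $ i))\<^sup>2 / 2)"
        by (intro sum.cong) (auto simp: a_def field_simps)
      also have "\<dots> = M / moment_map p $ j * (b j * (cmod (p $ j))\<^sup>2) / 2 - 1"
        using sum_b by (simp add: sum_subtractf flip: sum_divide_distrib)
      also have "\<dots> = b j * M / (2 * pi) - 1" using j by (simp add: moment_map_def mult_ac)
      finally show ?thesis .
    qed
    ultimately show ?thesis by simp
  qed
  \<comment> \<open>If \<open>\<kappa>\<close> were negative, large \<open>M\<close> in
    \<open>key\<close> would force every b_j with p_j nonzero to be at most 0, against
    \<open>sum_b\<close>.\<close>
  have \<kappa>pos: "\<kappa> > 0"
  proof (rule ccontr)
    assume "\<not> \<kappa> > 0"
    then have neg: "\<kappa> < 0" using \<kappa>0 by simp
    have "b j * (cmod (p $ j))\<^sup>2 \<le> 0" for j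
    proof (cases "p $ j = 0")
      case False
      have "b j \<le> 0"
      proof (rule ccontr)
        assume "\<not> b j \<le> 0"
        then have bj: "b j > 0" by simp
        define M where "M = max M0 (4 * pi / b j)"
        have "M \<ge> 4 * pi / b j" by (simp add: M_def)
        then have "b j * M / (2 * pi) - 1 \<ge> 1" using bj by (simp add: field_simps)
        then have "\<kappa> * (b j * M / (2 * pi) - 1) < 0" using neg mult_neg_pos[of \<kappa> "b j * M / (2 * pi) - 1"] by linarith
        then show False using key[OF False, of M] by (simp add: M_def)
      qed
      then show ?thesis by (simp add: mult_nonpos_nonneg)
    qed simp
    then have "(\<Sum>j\<in>UNIV. b j * (cmod (p $ j))\<^sup>2) \<le> 0" by (intro sum_nonpos) auto
    then show False using sum_b by simp
  qed
  \<comment> \<open>With \<open>\<kappa>\<close> positive, \<open>key\<close> at \<open>M0\<close>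
    says that b_j \<open>M0\<close> is at least \<open>2 * pi\<close>.\<close>
  have bpos: "b j > 0" for j
  proof (cases "p $ j = 0")
    case False
    then have "b j * M0 / (2 * pi) - 1 \<ge> 0" using key[OF False, of M0] \<kappa>pos by (simp add: zero_le_mult_iff)
    then have "b j * M0 > 0" by (simp add: field_simps) (use pi_gt_zero in linarith)
    then show ?thesis using M0(1) by (simp add: zero_less_mult_iff)
  qed (simp add: b_def)
  show ?thesis by (rule that[OF np T reeb bpos bn U(1,2) fp \<kappa>pos derk XU])
qed

section \<open>Closed Reeb orbits and the minimal period\<close>

lemma torus_orbitI:
  fixes w w' :: "complex ^ 'n"
  assumes "\<And>j. cmod (w' $ j) = cmod (w $ j)"
  obtains \<theta> where "\<And>j. cmod (\<theta> $ j) = 1" "w' = torus_action \<theta> w"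
proof
  let ?\<theta> = "\<chi> j. if w $ j = 0 then 1 else w' $ j / w $ j"
  show "cmod (?\<theta> $ j) = 1" for j using assms[of j] by (simp add: norm_divide)
  have "w' $ j = 0" if "w $ j = 0" for j using assms[of j] that by simp
  then show "w' = torus_action ?\<theta> w" by (simp add: vec_eq_iff)
qed

text \<open>The moduli are conserved, so the angular velocities are constant along the curve.\<close>
lemma torus_invariant_ode:
  fixes \<gamma> :: "real \<Rightarrow> complex ^ 'n"
  assumes der: "\<And>t. (\<gamma> has_vector_derivative V t) (at t)"
    and V: "\<And>t j. V t $ j = \<i> * of_real (b t j) * \<gamma> t $ j"
    and inv: "\<And>s t. (\<And>j. cmod (\<gamma> s $ j) = cmod (\<gamma> t $ j)) \<Longrightarrow> b s = b t"
  shows "\<gamma> t $ j = exp (\<i> * of_real (b 0 j * t)) * \<gamma> 0 $ j"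
proof -
  have dj: "((\<lambda>t. \<gamma> t $ j) has_vector_derivative V t $ j) (at t)" for t j
    by (rule bounded_linear.has_vector_derivative[OF bounded_linear_vec_nth der])
  have "cmod (\<gamma> t $ j) = cmod (\<gamma> 0 $ j)" for t j
  proof -
    have "((\<lambda>t. \<gamma> t $ j \<bullet> \<gamma> t $ j) has_real_derivative 0) (at t)" for t
    proof -
      have "((\<lambda>t. \<gamma> t $ j \<bullet> \<gamma> t $ j) has_derivative
          (\<lambda>h. \<gamma> t $ j \<bullet> (h *\<^sub>R V t $ j) + (h *\<^sub>R V t $ j) \<bullet> \<gamma> t $ j)) (at t)"
        by (rule has_derivative_inner[OF dj[unfolded has_vector_derivative_def] dj[unfolded has_vector_derivative_def]])
      moreover have "(\<lambda>h. \<gamma> t $ j \<bullet> (h *\<^sub>R V t $ j) + (h *\<^sub>R V t $ j) \<bullet> \<gamma> t $ j) = (*) 0"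
        by (simp add: V inner_complex_def algebra_simps fun_eq_iff)
      ultimately show ?thesis by (simp only: has_field_derivative_def)
    qed
    then have "\<gamma> t $ j \<bullet> \<gamma> t $ j = \<gamma> 0 $ j \<bullet> \<gamma> 0 $ j" by (intro DERIV_isconst_all) blast
    then show ?thesis by (simp add: norm_eq_sqrt_inner)
  qed
  then have bt: "b t = b 0" for t by (intro inv) blast
  let ?h = "\<lambda>t. exp (- (\<i> * of_real (b 0 j) * of_real t)) * \<gamma> t $ j"
  have "(?h has_vector_derivative 0) (at t within UNIV)" for t
  proof -
    have "((\<lambda>t. exp (- (\<i> * of_real (b 0 j) * of_real t))) has_vector_derivative
        - (\<i> * of_real (b 0 j)) * exp (- (\<i> * of_real (b 0 j) * of_real t))) (at t)"
      by (rule has_vector_derivative_real_field[of "\<lambda>z. exp (- (\<i> * of_real (b 0 j) * z))"])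
        (auto intro!: derivative_eq_intros)
    from has_vector_derivative_mult[OF this dj[of j t]]
    show ?thesis by (simp add: V bt[of t] mult_ac)
  qed
  then obtain c where c: "\<And>t. ?h t = c"
    using has_vector_derivative_zero_constant[of UNIV ?h] by auto
  have "exp (\<i> * of_real (b 0 j * t)) * exp (- (\<i> * of_real (b 0 j) * of_real t)) = 1"
    by (simp add: mult.assoc flip: exp_add)
  then have "\<gamma> t $ j = exp (\<i> * of_real (b 0 j * t)) * ?h t" by (simp add: mult.assoc[symmetric])
  also have "?h t = \<gamma> 0 $ j" using c[of t] c[of 0] by simp
  finally show ?thesis .
qed

lemma has_vector_derivative_rotation:
  "((\<lambda>t. \<chi> j. exp (\<i> * of_real (b j * t)) * z $ j) has_vector_derivative
     (\<chi> j. \<i> * of_real (b j) * (exp (\<i> * of_real (b j * t)) * z $ j))) (at t)"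
proof -
  have "((\<lambda>t. exp (\<i> * of_real (b j * t)) * z $ j) has_derivative
      (\<lambda>h. h *\<^sub>R (\<i> * of_real (b j) * (exp (\<i> * of_real (b j * t)) * z $ j)))) (at t)" for j
  proof -
    have "((\<lambda>t. exp (\<i> * (of_real (b j) * of_real t)) * z $ j) has_vector_derivative
        \<i> * of_real (b j) * (exp (\<i> * (of_real (b j) * of_real t)) * z $ j)) (at t)"
      by (rule has_vector_derivative_real_field[of "\<lambda>w. exp (\<i> * (of_real (b j) * w)) * z $ j"])
        (auto intro!: derivative_eq_intros simp: mult_ac)
    then show ?thesis by (simp add: has_vector_derivative_def)
  qed
  then have "((\<lambda>t. \<chi> j. exp (\<i> * of_real (b j * t)) * z $ j) has_derivative
     (\<lambda>h. \<chi> j. h *\<^sub>R (\<i> * of_real (b j) * (exp (\<i> * of_real (b j * t)) * z $ j)))) (at t)"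
    by (rule has_derivative_vec_lambda)
  moreover have "(\<lambda>h. \<chi> j. h *\<^sub>R (\<i> * of_real (b j) * (exp (\<i> * of_real (b j * t)) * z $ j))) =
      (\<lambda>h. h *\<^sub>R (\<chi> j. \<i> * of_real (b j) * (exp (\<i> * of_real (b j * t)) * z $ j)))"
    by (simp add: fun_eq_iff vec_eq_iff)
  ultimately show ?thesis by (simp add: has_vector_derivative_def)
qed

text \<open>Equivariance makes the angular velocities functions of the moduli alone, as
  \<open>torus_invariant_ode\<close> requires.\<close>

lemma reeb_field_torus_action:
  assumes X: "star_shaped_domain (toric_domain \<Omega>)" and K: "convex (orthant - \<Omega>)"
    and p: "p \<in> frontier (toric_domain \<Omega>)" and \<theta>: "\<And>j. cmod (\<theta> $ j) = 1"
  shows "reeb_field (toric_domain \<Omega>) (torus_action \<theta> p) = torus_action \<theta> (reeb_field (toric_domain \<Omega>) p)"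
proof (rule reeb_field_concave_toric[OF X K p])
  fix n
  assume np: "n \<bullet> p = 2" and T: "tangent_space (frontier (toric_domain \<Omega>)) p = {v. n \<bullet> v = 0}"
    and r: "reeb_field (toric_domain \<Omega>) p = \<i> *s n"
  have "torus_action \<theta> n \<bullet> torus_action \<theta> p = 2"
    using np by (simp add: torus_action_inner[OF \<theta>] torus_action_cnj[OF \<theta>])
  from reeb_field_eqI[OF torus_action_normal[OF \<theta> T] this] r
  show ?thesis by (simp add: vec_eq_iff)
qed

text \<open>Each nonvanishing coordinate turns a positive integer number of times, so T b_j is at
  least 2 pi. Weighting with |p_j|^2 and summing against n . p = 2 gives the bound.\<close>

lemma closed_reeb_orbit_period_ge:
  assumes X: "star_shaped_domain (toric_domain \<Omega>)" and K: "convex (orthant - \<Omega>)"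
    and T: "closed_reeb_orbit_period (toric_domain \<Omega>) T"
  obtains p where "p \<in> frontier (toric_domain \<Omega>)" "pi * (norm p)\<^sup>2 \<le> T"
proof -
  let ?X = "toric_domain \<Omega>"
  obtain \<gamma> where \<gamma>: "\<And>t. \<gamma> t \<in> frontier ?X"
    "\<And>t. (\<gamma> has_vector_derivative reeb_field ?X (\<gamma> t)) (at t)" "\<gamma> T = \<gamma> 0" and T0: "T > 0"
    using T by (auto simp: closed_reeb_orbit_period_def integral_curve_def)
  \<comment> \<open>Read off from the Reeb field, with value 0 at vanishing coordinates, so that
    points with equal moduli get equal values; the existentially obtained coefficients
    \<open>b'\<close> are not canonical there.\<close>
  define b where "b t j = (if \<gamma> t $ j = 0 then 0 else Re (reeb_field ?X (\<gamma> t) $ j / (\<i> * \<gamma> t $ j)))" for t j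
  have V: "reeb_field ?X (\<gamma> t) $ j = \<i> * of_real (b t j) * \<gamma> t $ j" for t j
  proof (rule reeb_field_concave_toric[OF X K \<gamma>(1)[of t]])
    fix n and b' :: "'a \<Rightarrow> real"
    assume "reeb_field ?X (\<gamma> t) = \<i> *s n" "\<And>j. n $ j = b' j *\<^sub>R \<gamma> t $ j"
    then have "reeb_field ?X (\<gamma> t) $ j = \<i> * of_real (b' j) * \<gamma> t $ j"
      by (simp add: scaleR_conv_of_real)
    then show ?thesis by (simp add: b_def)
  qed
  have inv: "b s = b t" if eq: "\<And>j. cmod (\<gamma> s $ j) = cmod (\<gamma> t $ j)" for s t
  proof
    fix j
    obtain \<theta> where \<theta>: "\<And>j. cmod (\<theta> $ j) = 1" "\<gamma> s = torus_action \<theta> (\<gamma> t)"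
      using torus_orbitI[of "\<gamma> s" "\<gamma> t"] eq by metis
    have "\<theta> $ j \<noteq> 0" using \<theta>(1)[of j] by auto
    then show "b s j = b t j"
      unfolding b_def \<theta>(2) reeb_field_torus_action[OF X K \<gamma>(1) \<theta>(1)] by simp
  qed
  have sol: "\<gamma> t $ j = exp (\<i> * of_real (b 0 j * t)) * \<gamma> 0 $ j" for t j
    by (rule torus_invariant_ode[OF \<gamma>(2) V inv])
  show ?thesis
  proof (rule reeb_field_concave_toric[OF X K \<gamma>(1)[of 0]])
    fix n and b' :: "'a \<Rightarrow> real"
    assume np: "n \<bullet> \<gamma> 0 = 2" and r: "reeb_field ?X (\<gamma> 0) = \<i> *s n" and b'pos: "\<And>j. b' j > 0"
      and n: "\<And>j. n $ j = b' j *\<^sub>R \<gamma> 0 $ j"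
    have le: "2 * pi * (cmod (\<gamma> 0 $ j))\<^sup>2 \<le> b' j * T * (cmod (\<gamma> 0 $ j))\<^sup>2" for j
    proof (cases "\<gamma> 0 $ j = 0")
      case False
      then have b: "b 0 j = b' j" unfolding b_def r by (simp add: n scaleR_conv_of_real)
      have "exp (\<i> * of_real (b 0 j * T)) = 1" using sol[of T j] \<gamma>(3) False by simp
      then obtain k :: int where k: "b' j * T = of_int (2 * k) * pi"
        unfolding exp_eq_1 b by auto
      have "b' j * T > 0" using b'pos T0 by simp
      then have "k > 0" unfolding k by (simp add: zero_less_mult_iff)
      then have "k \<ge> 1" by simp
      then have "of_int (2 * k) * pi \<ge> 2 * pi" by simp
      then show ?thesis unfolding k by (intro mult_right_mono) auto
    qed simp
    have nn: "(norm (\<gamma> 0))\<^sup>2 = (\<Sum>j\<in>UNIV. (cmod (\<gamma> 0 $ j))\<^sup>2)"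
      by (simp add: norm_vec_def L2_set_def sum_nonneg)
    have "2 * pi * (norm (\<gamma> 0))\<^sup>2 \<le> (\<Sum>j\<in>UNIV. b' j * T * (cmod (\<gamma> 0 $ j))\<^sup>2)"
      unfolding nn sum_distrib_left by (intro sum_mono le)
    also have "\<dots> = T * (n \<bullet> \<gamma> 0)"
      by (simp add: inner_vec_def n power2_norm_eq_inner sum_distrib_left mult_ac)
    finally have "pi * (norm (\<gamma> 0))\<^sup>2 \<le> T" by (simp add: np)
    then show ?thesis using that \<gamma>(1) by blast
  qed
qed

text \<open>At a frontier point nearest to the origin the normal is radial, so all coordinates
  rotate with equal speed and the orbit is a round circle; its period attains the bound of
  \<open>closed_reeb_orbit_period_ge\<close>.\<close>

lemma min_period_concave_toric:
  fixes \<Omega> :: "(real ^ 'n) set"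
  assumes X: "star_shaped_domain (toric_domain \<Omega>)" and K: "convex (orthant - \<Omega>)"
  obtains p where "p \<in> frontier (toric_domain \<Omega>)"
    "\<And>q. q \<in> frontier (toric_domain \<Omega>) \<Longrightarrow> norm p \<le> norm q"
    "min_period (toric_domain \<Omega>) = pi * (norm p)\<^sup>2"
proof -
  let ?X = "toric_domain \<Omega>"
  have cpt: "compact ?X" and int0: "0 \<in> interior ?X" using X by (auto simp: star_shaped_domain_def)
  have "?X \<noteq> UNIV" using cpt not_compact_UNIV by metis
  moreover have "?X \<noteq> {}" using int0 interior_subset by blast
  ultimately have "frontier ?X \<noteq> {}" by (simp add: frontier_eq_empty)
  then obtain p where p: "p \<in> frontier ?X" and min: "\<And>q. q \<in> frontier ?X \<Longrightarrow> norm p \<le> norm q"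
    using continuous_attains_inf[OF compact_frontier[OF cpt], of norm] continuous_on_norm_id by metis
  have "p \<noteq> 0" using p int0 by (auto simp: frontier_def)
  have "closed_reeb_orbit_period ?X (pi * (norm p)\<^sup>2)"
  proof (rule reeb_field_concave_toric[OF X K p])
    fix n
    assume np: "n \<bullet> p = 2" and T: "tangent_space (frontier ?X) p = {v. n \<bullet> v = 0}"
      and r: "reeb_field ?X p = \<i> *s n"
    \<comment> \<open>The squared norm along any frontier curve through \<open>p\<close> has a
      minimum there.\<close>
    have orth: "p \<bullet> v = 0" if "n \<bullet> v = 0" for v
    proof -
      have "v \<in> tangent_space (frontier ?X) p" using that T by simp
      then obtain \<gamma> where \<gamma>: "\<gamma> 0 = p" "\<forall>\<^sub>F t in nhds 0. \<gamma> t \<in> frontier ?X"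
        "(\<gamma> has_vector_derivative v) (at (0::real))" by (auto simp: tangent_space_def)
      obtain d where d: "d > 0" "\<And>t. \<bar>t\<bar> < d \<Longrightarrow> \<gamma> t \<in> frontier ?X"
        using \<gamma>(2) unfolding eventually_nhds_metric by (auto simp: dist_real_def)
      have "((\<lambda>t. \<gamma> t \<bullet> \<gamma> t) has_derivative (\<lambda>h. \<gamma> 0 \<bullet> (h *\<^sub>R v) + (h *\<^sub>R v) \<bullet> \<gamma> 0)) (at 0)"
        by (rule has_derivative_inner[OF \<gamma>(3)[unfolded has_vector_derivative_def] \<gamma>(3)[unfolded has_vector_derivative_def]])
      moreover have "(\<lambda>h. \<gamma> 0 \<bullet> (h *\<^sub>R v) + (h *\<^sub>R v) \<bullet> \<gamma> 0) = (\<lambda>h. (2 * (p \<bullet> v)) * h)"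
        by (simp add: \<gamma>(1) inner_commute fun_eq_iff)
      ultimately have "((\<lambda>t. \<gamma> t \<bullet> \<gamma> t) has_real_derivative 2 * (p \<bullet> v)) (at 0)"
        by (simp add: has_field_derivative_def)
      moreover have "\<gamma> 0 \<bullet> \<gamma> 0 \<le> \<gamma> t \<bullet> \<gamma> t" if "\<bar>0 - t\<bar> < d" for t
        using min[OF d(2)[of t]] that \<gamma>(1) by (simp add: norm_le)
      ultimately have "2 * (p \<bullet> v) = 0" using d(1) DERIV_local_min by blast
      then show ?thesis by simp
    qed
    have n0: "n \<bullet> n \<noteq> 0" using np by auto
    define k where "k = (p \<bullet> n) / (n \<bullet> n)"
    have nv: "n \<bullet> (p - k *\<^sub>R n) = 0" using n0 by (simp add: k_def inner_diff_right inner_commute)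
    have "(p - k *\<^sub>R n) \<bullet> (p - k *\<^sub>R n) = p \<bullet> (p - k *\<^sub>R n) - k * (n \<bullet> (p - k *\<^sub>R n))"
      by (simp add: inner_diff_left)
    also have "\<dots> = 0" using nv orth[OF nv] by simp
    finally have pk: "p = k *\<^sub>R n" by simp
    \<comment> \<open>The common angular velocity, forced by n parallel to p and n . p = 2; one turn
      takes 2 pi / c.\<close>
    define c where "c = 2 / (norm p)\<^sup>2"
    have "k \<noteq> 0" using pk \<open>p \<noteq> 0\<close> by auto
    have "p \<bullet> p = 2 * k" using np pk by (metis inner_commute inner_scaleR_right mult.commute)
    then have "c = 1 / k" unfolding c_def power2_norm_eq_inner by simp
    then have "c *\<^sub>R p = (1 / k) *\<^sub>R (k *\<^sub>R n)" using pk by simp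
    then have nc: "n = c *\<^sub>R p" using \<open>k \<noteq> 0\<close> by simp
    have nci: "n $ j = of_real c * p $ j" for j
      unfolding nc vector_scaleR_component by (rule scaleR_conv_of_real)
    have c: "c > 0" using \<open>p \<noteq> 0\<close> by (simp add: c_def)
    define \<theta> where "\<theta> t = (\<chi> j::'n. exp (\<i> * of_real (c * t)))" for t
    have \<theta>: "cmod (\<theta> t $ j) = 1" for t j by (simp add: \<theta>_def)
    define \<gamma> where "\<gamma> t = torus_action (\<theta> t) p" for t
    have "integral_curve (reeb_field ?X) (frontier ?X) \<gamma>"
      unfolding integral_curve_def
    proof (intro allI conjI)
      fix t
      show "\<gamma> t \<in> frontier ?X" unfolding \<gamma>_def by (rule torus_action_frontier[OF \<theta> p])
      have "reeb_field ?X (\<gamma> t) = torus_action (\<theta> t) (\<i> *s n)"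
        unfolding \<gamma>_def reeb_field_torus_action[OF X K p \<theta>] r ..
      then have "reeb_field ?X (\<gamma> t) = (\<chi> j. \<i> * of_real c * (exp (\<i> * of_real (c * t)) * p $ j))"
        by (simp add: vec_eq_iff nci \<theta>_def)
      moreover have "\<gamma> = (\<lambda>t. \<chi> j. exp (\<i> * of_real (c * t)) * p $ j)"
        by (simp add: fun_eq_iff vec_eq_iff \<gamma>_def \<theta>_def)
      ultimately show "(\<gamma> has_vector_derivative reeb_field ?X (\<gamma> t)) (at t)"
        using has_vector_derivative_rotation[of "\<lambda>j. c" p t] by simp
    qed
    moreover have "\<gamma> (pi * (norm p)\<^sup>2) = \<gamma> 0"
    proof -
      have eq: "c * (pi * (norm p)\<^sup>2) = 2 * pi" using \<open>p \<noteq> 0\<close> by (simp add: c_def)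
      have "exp (\<i> * of_real (c * (pi * (norm p)\<^sup>2))) = 1"
        unfolding eq using exp_two_pi_i by (simp add: mult_ac)
      then show ?thesis by (simp add: \<gamma>_def \<theta>_def)
    qed
    moreover have "pi * (norm p)\<^sup>2 > 0" using \<open>p \<noteq> 0\<close> by simp
    ultimately show ?thesis unfolding closed_reeb_orbit_period_def by blast
  qed
  moreover have "pi * (norm p)\<^sup>2 \<le> T" if "closed_reeb_orbit_period ?X T" for T
  proof (rule closed_reeb_orbit_period_ge[OF X K that])
    fix q assume q: "q \<in> frontier ?X" "pi * (norm q)\<^sup>2 \<le> T"
    have "(norm p)\<^sup>2 \<le> (norm q)\<^sup>2" using min[OF q(1)] by (simp add: power_mono)
    then have "pi * (norm p)\<^sup>2 \<le> pi * (norm q)\<^sup>2" by simp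
    then show ?thesis using q(2) by linarith
  qed
  ultimately have "min_period ?X = pi * (norm p)\<^sup>2"
    unfolding min_period_def by (rule Least_equality)
  then show ?thesis using that p min by blast
qed

text \<open>By \<open>min_period_concave_toric\<close> it suffices to compare distances to the
  frontiers. The open ball up to the nearest frontier point of the smaller domain is connected,
  contains 0 and misses the frontier, so it lies in the smaller domain and hence in the interior of
  the larger one.\<close>

lemma min_period_mono:
  assumes X: "star_shaped_domain (toric_domain \<Omega>)" "convex (orthant - \<Omega>)"
    and X': "star_shaped_domain (toric_domain \<Omega>')" "convex (orthant - \<Omega>')"
    and sub: "\<Omega> \<subseteq> \<Omega>'"
  shows "min_period (toric_domain \<Omega>) \<le> min_period (toric_domain \<Omega>')"
proof (rule min_period_concave_toric[OF X], rule min_period_concave_toric[OF X'])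
  fix p p'
  assume p: "\<And>q. q \<in> frontier (toric_domain \<Omega>) \<Longrightarrow> norm p \<le> norm q"
    "min_period (toric_domain \<Omega>) = pi * (norm p)\<^sup>2"
    and p': "p' \<in> frontier (toric_domain \<Omega>')" "min_period (toric_domain \<Omega>') = pi * (norm p')\<^sup>2"
  have "norm p \<le> norm p'"
  proof (rule ccontr)
    assume less: "\<not> norm p \<le> norm p'"
    let ?B = "ball 0 (norm p)"
    have "norm p > 0" using less norm_ge_zero[of p'] by linarith
    then have "0 \<in> ?B" by simp
    moreover have "0 \<in> toric_domain \<Omega>"
      using X(1) interior_subset by (auto simp: star_shaped_domain_def)
    moreover have "?B \<inter> frontier (toric_domain \<Omega>) = {}" using p(1) by fastforce
    ultimately have "?B - toric_domain \<Omega> = {}"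
      using connected_Int_frontier[OF connected_ball, of 0 "norm p" "toric_domain \<Omega>"] by blast
    then have "?B \<subseteq> toric_domain \<Omega>" by blast
    also have "\<dots> \<subseteq> toric_domain \<Omega>'" using sub by (auto simp: toric_domain_def)
    finally have "?B \<subseteq> interior (toric_domain \<Omega>')" by (simp add: interior_maximal)
    moreover have "p' \<in> ?B" using less by simp
    ultimately show False using p'(1) by (auto simp: frontier_def)
  qed
  then show ?thesis using p(2) p'(2) by (simp add: power_mono)
qed

section \<open>Symmetric operators and the polar decomposition\<close>

text \<open>A maximizer of the Rayleigh quotient on the unit sphere of \<open>S\<close>. The final
  bound, that \<open>c\<close> is the largest eigenvalue on \<open>S\<close>, is kept for
  \<open>symmetric_zero_form_imp_zero\<close>.\<close>

lemma symmetric_eigenvector: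
  fixes f :: "'a::euclidean_space \<Rightarrow> 'a"
  assumes lin: "linear f" and sym: "\<And>u v. f u \<bullet> v = u \<bullet> f v"
    and S: "subspace S" "S \<noteq> {0}" and inv: "\<And>v. v \<in> S \<Longrightarrow> f v \<in> S"
  obtains v c where "v \<in> S" "norm v = 1" "f v = c *\<^sub>R v" "\<And>w. w \<in> S \<Longrightarrow> f w \<bullet> w \<le> c * (w \<bullet> w)"
proof -
  let ?K = "sphere 0 1 \<inter> S"
  have "0 \<in> S" using S by (simp add: subspace_0)
  then obtain w where w: "w \<in> S" "w \<noteq> 0" using S(2) by blast
  have "(1 / norm w) *\<^sub>R w \<in> ?K" using w S by (simp add: subspace_scale)
  then have ne: "?K \<noteq> {}" by blast
  have cpt: "compact ?K" by (intro compact_Int_closed compact_sphere closed_subspace S)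
  have "continuous_on ?K (\<lambda>w. f w \<bullet> w)"
    by (intro continuous_intros linear_continuous_on linear_conv_bounded_linear[THEN iffD1] lin)
  then obtain v where v: "v \<in> ?K" and max: "\<And>w. w \<in> ?K \<Longrightarrow> f w \<bullet> w \<le> f v \<bullet> v"
    using continuous_attains_sup[OF cpt ne] by blast
  define c where "c = f v \<bullet> v"
  have nv: "v \<bullet> v = 1" using v by (simp add: norm_eq_1)
  have le: "f w \<bullet> w \<le> c * (w \<bullet> w)" if "w \<in> S" for w
  proof (cases "w = 0")
    case False
    define u where "u = (1 / norm w) *\<^sub>R w"
    have "u \<in> ?K" using that False S by (simp add: u_def subspace_scale)
    then have "f u \<bullet> u \<le> c" using max c_def by blast
    moreover have "w = norm w *\<^sub>R u" using False by (simp add: u_def)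
    then have "f w = norm w *\<^sub>R f u" using lin linear_cmul by metis
    then have "f w \<bullet> w = (norm w)\<^sup>2 * (f u \<bullet> u)"
      using \<open>w = norm w *\<^sub>R u\<close> by (metis inner_scaleR_left inner_scaleR_right mult.assoc power2_eq_square)
    moreover have "(norm w)\<^sup>2 = w \<bullet> w" by (simp add: power2_norm_eq_inner)
    ultimately show ?thesis by (metis mult.commute mult_left_mono zero_le_power2)
  qed (simp add: linear_0 lin)
  \<comment> \<open>The form c |w|^2 - f w . w is nonnegative on \<open>S\<close> and vanishes at
    \<open>v\<close>, so \<open>v\<close> lies in its radical.\<close>
  have orth: "(c *\<^sub>R v - f v) \<bullet> w = 0" if "w \<in> S" for w
  proof -
    define b where "b = (c *\<^sub>R v - f v) \<bullet> w"
    define d where "d = c * (w \<bullet> w) - f w \<bullet> w"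
    have "d \<ge> 0" using le[OF that] by (simp add: d_def)
    have pos: "2 * t * b + t\<^sup>2 * d \<ge> 0" for t
    proof -
      have "v + t *\<^sub>R w \<in> S" using v that S by (simp add: subspace_add subspace_scale)
      from le[OF this] have "f (v + t *\<^sub>R w) \<bullet> (v + t *\<^sub>R w) \<le> c * ((v + t *\<^sub>R w) \<bullet> (v + t *\<^sub>R w))" .
      moreover have "f (v + t *\<^sub>R w) = f v + t *\<^sub>R f w"
        using lin by (simp add: linear_add linear_cmul)
      moreover have "f w \<bullet> v = f v \<bullet> w" using sym[of w v] by (simp add: inner_commute)
      ultimately show ?thesis using nv
        by (simp add: b_def d_def algebra_simps inner_commute c_def power2_eq_square)
    qed
    have "b = 0"
    proof (rule ccontr)
      assume "b \<noteq> 0"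
      \<comment> \<open>Nearly the minimizer of the quadratic in \<open>t\<close>; the
        \<open>+ 1\<close> covers the case d = 0, where the polynomial is linear.\<close>
      define t where "t = - b / (d + 1)"
      have t: "t * (d + 1) = - b" using \<open>d \<ge> 0\<close> by (simp add: t_def)
      have "2 * t * b + t\<^sup>2 * d = t * (2 * b + t * (d + 1)) - t\<^sup>2"
        by (simp add: algebra_simps power2_eq_square)
      also have "\<dots> = t * b - t\<^sup>2" unfolding t by simp
      also have "t * b = - (b\<^sup>2 / (d + 1))" by (simp add: t_def power2_eq_square)
      finally have "2 * t * b + t\<^sup>2 * d = - (b\<^sup>2 / (d + 1)) - t\<^sup>2" .
      moreover have "b\<^sup>2 / (d + 1) > 0" using \<open>b \<noteq> 0\<close> \<open>d \<ge> 0\<close> by simp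
      moreover have "t\<^sup>2 \<ge> 0" by simp
      ultimately show False using pos[of t] by linarith
    qed
    then show ?thesis by (simp add: b_def)
  qed
  have "c *\<^sub>R v - f v \<in> S" using v inv S by (simp add: subspace_diff subspace_scale)
  from orth[OF this] have "f v = c *\<^sub>R v" by simp
  with v le show ?thesis by (intro that[of v c]) auto
qed

text \<open>Induction on the dimension: split off one eigenvector; by symmetry its orthogonal
  complement in \<open>S\<close> is again invariant.\<close>

lemma symmetric_orthonormal_eigenbasis:
  fixes f :: "'a::euclidean_space \<Rightarrow> 'a"
  assumes lin: "linear f" and sym: "\<And>u v. f u \<bullet> v = u \<bullet> f v"
    and "subspace S" and "\<And>v. v \<in> S \<Longrightarrow> f v \<in> S"
  shows "\<exists>B. B \<subseteq> S \<and> finite B \<and> card B = dim S \<and> pairwise orthogonal B \<and>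
           (\<forall>v\<in>B. norm v = 1 \<and> (\<exists>c. f v = c *\<^sub>R v))"
  using assms(3,4)
proof (induction "dim S" arbitrary: S rule: less_induct)
  case less
  show ?case
  proof (cases "S = {0}")
    case True
    then show ?thesis by (intro exI[of _ "{}"]) auto
  next
    case False
    obtain v c where v: "v \<in> S" "norm v = 1" "f v = c *\<^sub>R v"
      using symmetric_eigenvector[OF lin sym less.prems(1) False less.prems(2)] by metis
    define T where "T = {x \<in> S. x \<bullet> v = 0}"
    have T: "subspace T" using less.prems(1)
      by (auto simp: T_def subspace_def inner_left_distrib)
    have vT: "v \<notin> T" using v by (auto simp: T_def norm_eq_1)
    have invT: "f x \<in> T" if "x \<in> T" for x
      using that less.prems(2) v sym[of x v] by (auto simp: T_def)
    have SS: "S = span (insert v T)"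
    proof
      show "span (insert v T) \<subseteq> S"
        by (rule span_minimal) (use v less.prems(1) in \<open>auto simp: T_def\<close>)
      show "S \<subseteq> span (insert v T)"
      proof
        fix x assume x: "x \<in> S"
        have "x - (x \<bullet> v) *\<^sub>R v \<in> T"
          using x v less.prems(1) by (auto simp: T_def subspace_diff subspace_scale inner_diff_left norm_eq_1)
        then have "x - (x \<bullet> v) *\<^sub>R v \<in> span (insert v T)" by (simp add: span_base)
        moreover have "(x \<bullet> v) *\<^sub>R v \<in> span (insert v T)" by (simp add: span_base span_scale)
        ultimately have "(x - (x \<bullet> v) *\<^sub>R v) + (x \<bullet> v) *\<^sub>R v \<in> span (insert v T)" by (rule span_add)
        then show "x \<in> span (insert v T)" by simp
      qed
    qed
    have "span T = T" using T by (simp add: span_eq_iff)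
    then have dim: "dim S = Suc (dim T)" using vT dim_insert[of v T] SS by (metis Suc_eq_plus1 dim_span)
    then obtain B where B: "B \<subseteq> T" "finite B" "card B = dim T" "pairwise orthogonal B"
      "\<forall>v\<in>B. norm v = 1 \<and> (\<exists>c. f v = c *\<^sub>R v)"
      using less.hyps[of T] T invT by auto
    have "v \<notin> B" using B vT by blast
    moreover have "pairwise orthogonal (insert v B)"
      using B by (auto simp: pairwise_insert orthogonal_def T_def inner_commute)
    ultimately show ?thesis using B v dim
      by (intro exI[of _ "insert v B"]) (auto simp: T_def)
  qed
qed

lemma symmetric_diagonalization:
  fixes f :: "real ^ 'n \<Rightarrow> real ^ 'n"
  assumes "linear f" and "\<And>u v. f u \<bullet> v = u \<bullet> f v"
  obtains Q \<Lambda> where "orthogonal_matrix Q" "\<And>k. f (column k Q) = \<Lambda> k *\<^sub>R column k Q"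
proof -
  obtain B where B: "finite B" "card B = dim (UNIV :: (real ^ 'n) set)" "pairwise orthogonal B"
    "\<And>v. v \<in> B \<Longrightarrow> norm v = 1" "\<And>v. v \<in> B \<Longrightarrow> \<exists>c. f v = c *\<^sub>R v"
    using symmetric_orthonormal_eigenbasis[OF assms, of UNIV] by auto
  then have "card B = CARD('n)" by simp
  then obtain h :: "'n \<Rightarrow> real ^ 'n" where h: "bij_betw h UNIV B"
    using B(1) by (metis finite finite_same_card_bij)
  define Q :: "real ^ 'n ^ 'n" where "Q = (\<chi> i j. h j $ i)"
  have col: "column k Q = h k" for k by (simp add: column_def Q_def vec_eq_iff)
  have hB: "h k \<in> B" for k using h by (auto simp: bij_betw_def)
  have "orthogonal_matrix Q"
    unfolding orthogonal_matrix_orthonormal_columns col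
  proof (intro conjI allI impI)
    show "norm (h i) = 1" for i using B(4) hB by blast
    show "orthogonal (h i) (h j)" if "i \<noteq> j" for i j
    proof -
      have "h i \<noteq> h j" using h that by (auto simp: bij_betw_def dest: injD)
      then show ?thesis using B(3) hB by (auto simp: pairwise_def)
    qed
  qed
  moreover obtain \<Lambda> where "\<And>k. f (h k) = \<Lambda> k *\<^sub>R h k"
    using B(5)[OF hB] by metis
  ultimately show ?thesis using that[of Q \<Lambda>] by (simp add: col)
qed

text \<open>The largest eigenvalues of \<open>f\<close> and of \<open>-f\<close> are both 0, so the
  quadratic form vanishes identically; evaluating it at \<open>v + f v\<close> leaves twice the
  squared norm of \<open>f v\<close>.\<close>

lemma symmetric_zero_form_imp_zero:
  fixes f :: "'a::euclidean_space \<Rightarrow> 'a"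
  assumes lin: "linear f" and sym: "\<And>u v. f u \<bullet> v = u \<bullet> f v"
    and eig: "\<And>v c. v \<noteq> 0 \<Longrightarrow> f v = c *\<^sub>R v \<Longrightarrow> c = 0"
  shows "f v = 0"
proof -
  have ne: "(UNIV :: 'a set) \<noteq> {0}"
    by (metis UNIV_I ex_in_conv nonempty_Basis nonzero_Basis singletonD)
  have le: "f w \<bullet> w \<le> 0" for w
  proof -
    obtain v c where "norm v = 1" "f v = c *\<^sub>R v" "\<And>w. w \<in> UNIV \<Longrightarrow> f w \<bullet> w \<le> c * (w \<bullet> w)"
      using symmetric_eigenvector[OF lin sym subspace_UNIV ne] by (metis UNIV_I)
    moreover from this have "c = 0" using eig by (metis norm_zero zero_neq_one)
    ultimately show ?thesis by simp
  qed
  have ge: "f w \<bullet> w \<ge> 0" for w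
  proof -
    let ?f = "\<lambda>x. - f x"
    have "linear ?f" using lin by (simp add: linear_compose_neg)
    moreover have "\<And>u v. ?f u \<bullet> v = u \<bullet> ?f v" using sym by simp
    ultimately obtain v c where "norm v = 1" "- f v = c *\<^sub>R v" "\<And>w. w \<in> UNIV \<Longrightarrow> - f w \<bullet> w \<le> c * (w \<bullet> w)"
      using symmetric_eigenvector[of ?f, OF _ _ subspace_UNIV ne] by (metis UNIV_I)
    moreover from this have "f v = (- c) *\<^sub>R v" by (metis minus_minus scaleR_minus_left)
    then have "- c = 0" using eig \<open>norm v = 1\<close> by (metis norm_zero zero_neq_one)
    ultimately have "- f w \<bullet> w \<le> 0" by (metis UNIV_I add.inverse_inverse mult_zero_left neg_0_equal_iff_equal)
    then show ?thesis by simp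
  qed
  have z: "f w \<bullet> w = 0" for w using le[of w] ge[of w] by linarith
  have "f (v + f v) = f v + f (f v)" using lin by (simp add: linear_add)
  then have "f v \<bullet> f v + f (f v) \<bullet> v = 0"
    using z[of "v + f v"] z[of v] z[of "f v"] by (simp add: inner_add_left inner_add_right)
  then show ?thesis using sym[of "f v" v] by simp
qed

text \<open>Uniqueness of the positive square root, the half of the polar decomposition that the
  \<open>THE\<close> in \<open>unitary_part\<close> asks for; existence is always shown by
  exhibiting the factors.\<close>

lemma sym_pos_def_square_unique:
  fixes P P' :: "'a::euclidean_space \<Rightarrow> 'a"
  assumes P: "sym_pos_def P" and P': "sym_pos_def P'"
    and eq: "\<And>v w. P v \<bullet> P w = P' v \<bullet> P' w"
  shows "P = P'"
proof -
  have l: "linear P" "linear P'" and s: "\<And>u v. P u \<bullet> v = u \<bullet> P v" "\<And>u v. P' u \<bullet> v = u \<bullet> P' v"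
    and pos: "\<And>v. v \<noteq> 0 \<Longrightarrow> P v \<bullet> v > 0" "\<And>v. v \<noteq> 0 \<Longrightarrow> P' v \<bullet> v > 0"
    using P P' by (auto simp: sym_pos_def_def)
  let ?D = "\<lambda>v. P v - P' v"
  have "?D v = 0" for v
  proof (rule symmetric_zero_form_imp_zero[of ?D])
    show "linear ?D" using l by (simp add: linear_compose_sub)
    show "?D u \<bullet> v = u \<bullet> ?D v" for u v using s by (simp add: inner_diff_left inner_diff_right)
    fix v c assume v: "v \<noteq> 0" "?D v = c *\<^sub>R v"
    text \<open>From $P^2 = P'^2$ one gets $P D + D P' = 0$ for $D = P - P'$.\<close>
    have "?D v \<bullet> P v + P' v \<bullet> ?D v = 0"
      using eq[of v v] by (simp add: inner_diff_left inner_diff_right inner_commute)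
    then have "c * (P v \<bullet> v + P' v \<bullet> v) = 0" unfolding v(2)
      by (simp add: algebra_simps inner_commute)
    moreover have "P v \<bullet> v + P' v \<bullet> v > 0" using pos[OF v(1)] by simp
    ultimately show "c = 0" by simp
  qed
  then show ?thesis by auto
qed

section \<open>Unitary matrices and uniqueness of the polar decomposition\<close>

lemma unitary_matrix_alt: "unitary_matrix U \<longleftrightarrow> (\<forall>i j. (\<Sum>k\<in>UNIV. cnj (U $ k $ i) * U $ k $ j) = (if i = j then 1 else 0))"
  by (simp add: unitary_matrix_def matrix_matrix_mult_def mat_def vec_eq_iff)

lemma unitary_matrix_mult:
  assumes "unitary_matrix U" "unitary_matrix V"
  shows "unitary_matrix (U ** V)"
proof -
  have "(\<chi> i j. cnj ((U ** V) $ j $ i)) = (\<chi> i j. cnj (V $ j $ i)) ** (\<chi> i j. cnj (U $ j $ i))"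
    by (simp add: matrix_matrix_mult_def vec_eq_iff mult.commute)
  then have "(\<chi> i j. cnj ((U ** V) $ j $ i)) ** (U ** V) =
      (\<chi> i j. cnj (V $ j $ i)) ** (((\<chi> i j. cnj (U $ j $ i)) ** U) ** V)"
    by (simp only: matrix_mul_assoc)
  also have "\<dots> = mat 1"
    using assms by (simp only: unitary_matrix_def matrix_mul_lid)
  finally show ?thesis by (simp only: unitary_matrix_def)
qed

lemma unitary_matrix_adjoint:
  assumes "unitary_matrix U"
  shows "unitary_matrix (\<chi> i j. cnj (U $ j $ i))" "U ** (\<chi> i j. cnj (U $ j $ i)) = mat 1"
proof -
  show *: "U ** (\<chi> i j. cnj (U $ j $ i)) = mat 1"
    using assms matrix_left_right_inverse by (auto simp: unitary_matrix_def)
  have "(\<chi> i j. cnj ((\<chi> i j. cnj (U $ j $ i)) $ j $ i)) = U" by (simp add: vec_eq_iff)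
  then show "unitary_matrix (\<chi> i j. cnj (U $ j $ i))" unfolding unitary_matrix_def using * by simp
qed

lemma unitary_matrix_adjoint_inner:
  fixes U :: "complex ^ 'n ^ 'n"
  shows "(U *v v) \<bullet> w = v \<bullet> ((\<chi> i j. cnj (U $ j $ i)) *v w)"
proof -
  have c: "x \<bullet> y = Re (cnj x * y)" for x y :: complex by (simp add: inner_complex_def)
  have "(U *v v) \<bullet> w = Re (\<Sum>i\<in>UNIV. \<Sum>j\<in>UNIV. cnj (U $ i $ j) * cnj (v $ j) * w $ i)"
    by (simp add: inner_vec_def c matrix_vector_mult_def sum_distrib_right flip: Re_sum)
  also have "\<dots> = Re (\<Sum>j\<in>UNIV. \<Sum>i\<in>UNIV. cnj (U $ i $ j) * cnj (v $ j) * w $ i)"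
    by (subst sum.swap) simp
  also have "\<dots> = v \<bullet> ((\<chi> i j. cnj (U $ j $ i)) *v w)"
    by (simp add: inner_vec_def c matrix_vector_mult_def sum_distrib_left mult_ac flip: Re_sum)
  finally show ?thesis .
qed

lemma unitary_matrix_inner:
  assumes "unitary_matrix U"
  shows "(U *v v) \<bullet> (U *v w) = v \<bullet> w"
  using assms by (simp add: unitary_matrix_adjoint_inner matrix_vector_mul_assoc unitary_matrix_def)

text \<open>Unitary factors preserve inner products, so \<open>A\<close> determines the square of
  the positive factor and thereby the factor itself; this factor is bijective, so the unitary one is
  determined as well.\<close>

lemma unitary_part_eqI:
  fixes U :: "complex ^ 'n ^ 'n"
  assumes U: "unitary_matrix U" and P: "sym_pos_def P" and A: "\<And>v. A v = U *v P v"
  shows "unitary_part A = U"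
  unfolding unitary_part_def
proof (rule the_equality)
  show "unitary_matrix U \<and> (\<exists>P. sym_pos_def P \<and> A = (\<lambda>v. U *v P v))" using assms by auto
  fix V assume "unitary_matrix V \<and> (\<exists>P. sym_pos_def P \<and> A = (\<lambda>v. V *v P v))"
  then obtain P' where V: "unitary_matrix V" and P': "sym_pos_def P'" and A': "\<And>v. A v = V *v P' v" by metis
  have "P v \<bullet> P w = P' v \<bullet> P' w" for v w
    using unitary_matrix_inner[OF U] unitary_matrix_inner[OF V] A A' by metis
  then have PP: "P = P'" using sym_pos_def_square_unique P P' by blast
  have lin: "linear P" using P by (simp add: sym_pos_def_def)
  have "inj P"
    unfolding linear_injective_0[OF lin] using P by (force simp: sym_pos_def_def)
  then have "surj P" using lin linear_inj_imp_surj by blast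
  have "V *v w = U *v w" for w
  proof -
    obtain v where "w = P v" using \<open>surj P\<close> by (auto simp: surj_def)
    then show ?thesis using A[of v] A'[of v] PP by simp
  qed
  then show "V = U" by (simp add: matrix_eq)
qed

section \<open>Toric Hamiltonian flows\<close>

text \<open>The positive factor of the shear \<open>y \<mapsto> y + i s Re y\<close>, whose rotation angle is
  \<open>arctan (s / 2)\<close>.\<close>
definition shear_pos :: "real \<Rightarrow> complex \<Rightarrow> complex" where
  "shear_pos s y = cos (arctan (s/2)) *\<^sub>R
     Complex ((1 + 2 * (s/2)\<^sup>2) * Re y + s/2 * Im y) (s/2 * Re y + Im y)"

lemma cis_shear_pos: "exp (\<i> * of_real (arctan (s/2))) * shear_pos s y = y + \<i> * of_real (s * Re y)"
proof -
  define x where "x = s / 2"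
  have s: "s = 2 * x" by (simp add: x_def)
  have E: "exp (\<i> * of_real (arctan x)) = cos (arctan x) *\<^sub>R Complex 1 x"
    by (simp add: complex_eq_iff Re_exp Im_exp cos_arctan sin_arctan)
  have c: "cos (arctan x) * cos (arctan x) = 1 / (1 + x\<^sup>2)"
    by (simp add: cos_arctan add_nonneg_nonneg)
  have nz: "1 + x\<^sup>2 \<noteq> 0" by (metis add_pos_nonneg less_irrefl zero_le_power2 zero_less_one)
  have "exp (\<i> * of_real (arctan x)) * shear_pos s y = (cos (arctan x) * cos (arctan x)) *\<^sub>R
      (Complex 1 x * Complex ((1 + 2 * x\<^sup>2) * Re y + x * Im y) (x * Re y + Im y))"
    unfolding E by (simp add: shear_pos_def x_def)
  also have "Complex 1 x * Complex ((1 + 2 * x\<^sup>2) * Re y + x * Im y) (x * Re y + Im y) =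
      (1 + x\<^sup>2) *\<^sub>R (y + \<i> * of_real (s * Re y))"
    by (simp add: complex_eq_iff s algebra_simps power2_eq_square)
  finally show ?thesis using nz unfolding c by (simp add: x_def)
qed

lemma shear_pos_linear:
  "shear_pos s (a + b) = shear_pos s a + shear_pos s b" "shear_pos s (r *\<^sub>R a) = r *\<^sub>R shear_pos s a"
  by (simp_all add: shear_pos_def complex_eq_iff algebra_simps)

lemma shear_pos_sym: "shear_pos s a \<bullet> b = a \<bullet> shear_pos s b"
  by (simp add: shear_pos_def inner_complex_def algebra_simps)

lemma shear_pos_pos:
  assumes "y \<noteq> 0"
  shows "shear_pos s y \<bullet> y > 0"
proof -
  define x where "x = s / 2"
  have "shear_pos s y \<bullet> y = cos (arctan x) * ((1 + x\<^sup>2) * (Re y)\<^sup>2 + (x * Re y + Im y)\<^sup>2)"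
    by (simp add: shear_pos_def inner_complex_def x_def algebra_simps power2_eq_square)
  moreover have "(1 + x\<^sup>2) * (Re y)\<^sup>2 + (x * Re y + Im y)\<^sup>2 > 0"
  proof (cases "Re y = 0")
    case True
    then show ?thesis using assms by (simp add: complex_eq_iff)
  next
    case False
    have "(1 + x\<^sup>2) * (Re y)\<^sup>2 > 0" using False by (simp add: add_pos_nonneg)
    then show ?thesis by (simp add: add_pos_nonneg)
  qed
  moreover have "cos (arctan x) > 0" by (simp add: cos_arctan add_pos_nonneg)
  ultimately show ?thesis by simp
qed

text \<open>Splitting each shear into a rotation and \<open>shear_pos\<close> and conjugating by
  \<open>W\<close> exhibits both polar factors. In the determinant \<open>W\<close> cancels against
  its adjoint, so only \<open>D\<close> and the rotation angles remain.\<close>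

lemma unitary_part_shear:
  fixes D W :: "complex ^ 'n ^ 'n" and s :: "'n \<Rightarrow> real"
  defines "Wa \<equiv> \<chi> i j. cnj (W $ j $ i)"
  defines "R \<equiv> \<chi> i j. if i = j then exp (\<i> * of_real (arctan (s i / 2))) else 0"
  assumes D: "unitary_matrix D" and W: "unitary_matrix W"
    and A: "\<And>v. A v = D *v (W *v (\<chi> k. (Wa *v v) $ k + \<i> * of_real (s k * Re ((Wa *v v) $ k))))"
  shows "det (unitary_part A) = det D * exp (\<i> * of_real (\<Sum>k\<in>UNIV. arctan (s k / 2)))"
proof -
  define P where "P v = W *v (\<chi> k. shear_pos (s k) ((Wa *v v) $ k))" for v
  have Wa: "unitary_matrix Wa" "W ** Wa = mat 1" "Wa ** W = mat 1"
    using unitary_matrix_adjoint[OF W] W by (simp_all add: Wa_def unitary_matrix_def)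
  have R: "unitary_matrix R"
    unfolding unitary_matrix_alt
  proof (intro allI)
    fix i j
    have "(\<Sum>k\<in>UNIV. cnj (R $ k $ i) * R $ k $ j) = (\<Sum>k\<in>UNIV. if k = i then cnj (R $ i $ i) * R $ i $ j else 0)"
      by (intro sum.cong) (auto simp: R_def)
    also have "\<dots> = cnj (R $ i $ i) * R $ i $ j" by simp
    also have "\<dots> = (if i = j then 1 else 0)"
      by (simp add: R_def exp_cnj flip: exp_add)
    finally show "(\<Sum>k\<in>UNIV. cnj (R $ k $ i) * R $ k $ j) = (if i = j then 1 else 0)" .
  qed
  have Rv: "(R *v y) $ k = exp (\<i> * of_real (arctan (s k / 2))) * y $ k" for y k
  proof -
    have "(R *v y) $ k = (\<Sum>j\<in>UNIV. if j = k then exp (\<i> * of_real (arctan (s k / 2))) * y $ k else 0)"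
      unfolding matrix_vector_mult_def vec_lambda_beta by (intro sum.cong refl) (auto simp: R_def)
    then show ?thesis by simp
  qed
  let ?U = "D ** (W ** (R ** Wa))"
  have "unitary_matrix ?U" by (intro unitary_matrix_mult D W R Wa)
  moreover have "sym_pos_def P"
    unfolding sym_pos_def_def
  proof (intro conjI allI impI)
    have 1: "(\<chi> k. shear_pos (s k) ((Wa *v (u + v)) $ k)) =
        (\<chi> k. shear_pos (s k) ((Wa *v u) $ k)) + (\<chi> k. shear_pos (s k) ((Wa *v v) $ k))" for u v
      by (simp add: vec_eq_iff matrix_vector_right_distrib shear_pos_linear)
    have sc: "M *v (r *\<^sub>R x) = r *\<^sub>R (M *v x)" for M :: "complex ^ 'n ^ 'n" and r x
      by (simp add: vec_eq_iff matrix_vector_mult_def scaleR_sum_right)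
    have 2: "(\<chi> k. shear_pos (s k) ((Wa *v (r *\<^sub>R v)) $ k)) = r *\<^sub>R (\<chi> k. shear_pos (s k) ((Wa *v v) $ k))" for r v
      by (simp add: vec_eq_iff sc shear_pos_linear)
    show "linear P"
    proof (rule linearI)
      show "P (u + v) = P u + P v" for u v
        by (simp only: P_def 1) (rule matrix_vector_right_distrib)
      show "P (r *\<^sub>R v) = r *\<^sub>R P v" for r v
        by (simp only: P_def 2) (rule sc)
    qed
    have in1: "P u \<bullet> v = (\<Sum>k\<in>UNIV. shear_pos (s k) ((Wa *v u) $ k) \<bullet> (Wa *v v) $ k)" for u v
      by (simp add: P_def unitary_matrix_adjoint_inner flip: Wa_def) (simp add: inner_vec_def)
    show "P u \<bullet> v = u \<bullet> P v" for u v
    proof -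
      have "P u \<bullet> v = P v \<bullet> u" unfolding in1
        by (intro sum.cong refl) (metis shear_pos_sym inner_commute)
      then show ?thesis by (simp add: inner_commute)
    qed
    fix v :: "complex ^ 'n" assume "v \<noteq> 0"
    have "Wa *v v \<noteq> 0"
    proof
      assume "Wa *v v = 0"
      then have "W *v (Wa *v v) = 0" by simp
      then have "v = 0" by (simp only: matrix_vector_mul_assoc Wa(2) matrix_vector_mul_lid)
      then show False using \<open>v \<noteq> 0\<close> by simp
    qed
    then obtain k where k: "(Wa *v v) $ k \<noteq> 0" by (auto simp: vec_eq_iff)
    have "shear_pos (s k) y \<bullet> y \<ge> 0" for k y
      using shear_pos_pos[of y "s k"] by (cases "y = 0") auto
    then show "P v \<bullet> v > 0" unfolding in1
      by (intro sum_pos2[of _ k]) (use shear_pos_pos[OF k] in auto)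
  qed
  moreover have "A v = ?U *v P v" for v
  proof -
    let ?q = "\<chi> k. shear_pos (s k) ((Wa *v v) $ k)"
    have "?U *v P v = D *v (W *v (R *v ((Wa ** W) *v ?q)))"
      by (simp add: P_def matrix_vector_mul_assoc matrix_mul_assoc)
    also have "\<dots> = D *v (W *v (R *v ?q))" by (simp add: Wa)
    also have "R *v ?q = (\<chi> k. (Wa *v v) $ k + \<i> * of_real (s k * Re ((Wa *v v) $ k)))"
      by (simp add: vec_eq_iff Rv cis_shear_pos)
    finally show ?thesis using A by simp
  qed
  ultimately have "unitary_part A = ?U" by (rule unitary_part_eqI)
  then have "det (unitary_part A) = det D * det R * (det W * det Wa)" by (simp add: det_mul)
  also have "det W * det Wa = 1" using Wa(2) by (metis det_I det_mul)
  also have "det R = (\<Prod>k\<in>UNIV. exp (\<i> * of_real (arctan (s k / 2))))"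
    by (subst det_diagonal) (auto simp: R_def)
  finally show ?thesis by (simp add: exp_sum sum_distrib_left)
qed

text \<open>\<open>G\<close> is the gradient and \<open>L\<close> the Hessian of \<open>g\<close>.
  The derivatives are two-sided also on the faces of the orthant, so the chain rule applies where
  coordinates of \<open>z\<close> vanish. Symmetry of \<open>L\<close> is what permits an orthogonal
  diagonalization.\<close>

locale toric_hamiltonian =
  fixes X :: "(complex ^ 'n) set" and g :: "real ^ 'n \<Rightarrow> real"
    and G :: "real ^ 'n \<Rightarrow> real ^ 'n" and L :: "real ^ 'n \<Rightarrow> real ^ 'n \<Rightarrow> real ^ 'n"
  assumes hamiltonian: "z \<noteq> 0 \<Longrightarrow> canonical_hamiltonian X z = g (moment_map z)"
    and g_deriv: "z \<noteq> 0 \<Longrightarrow> (g has_derivative (\<lambda>h. G (moment_map z) \<bullet> h)) (at (moment_map z))"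
    and G_deriv: "z \<noteq> 0 \<Longrightarrow> (G has_derivative L (moment_map z)) (at (moment_map z))"
    and L_sym: "z \<noteq> 0 \<Longrightarrow> L (moment_map z) u \<bullet> v = u \<bullet> L (moment_map z) v"
begin

lemma moment_map_deriv:
  "(moment_map has_derivative (\<lambda>h. \<chi> j. 2 * pi * (z $ j \<bullet> h $ j))) (at (z :: complex ^ 'n))"
proof -
  have m: "moment_map = (\<lambda>z :: complex ^ 'n. \<chi> j. pi * (z $ j \<bullet> z $ j))"
    by (simp add: moment_map_def power2_norm_eq_inner fun_eq_iff)
  have d: "((\<lambda>z :: complex ^ 'n. z $ j) has_derivative (\<lambda>h. h $ j)) (at z)" for j
    by (rule bounded_linear_imp_has_derivative[OF bounded_linear_vec_nth])
  show ?thesis unfolding m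
  proof (rule has_derivative_vec_lambda)
    fix j
    from has_derivative_mult_right[OF has_derivative_inner[OF d[of j] d[of j]], of pi]
    show "((\<lambda>z. pi * (z $ j \<bullet> z $ j)) has_derivative (\<lambda>h. 2 * pi * (z $ j \<bullet> h $ j))) (at z)"
      by (simp add: inner_commute algebra_simps)
  qed
qed

lemma gradient_hamiltonian:
  assumes "z \<noteq> 0"
  shows "gradient (canonical_hamiltonian X) z = (\<chi> j. (2 * pi * G (moment_map z) $ j) *\<^sub>R z $ j)"
    (is "_ = ?D")
proof -
  have "((\<lambda>w. g (moment_map w)) has_derivative
      (\<lambda>h. G (moment_map z) \<bullet> (\<chi> j. 2 * pi * (z $ j \<bullet> h $ j)))) (at z)"
    by (rule has_derivative_compose[OF moment_map_deriv g_deriv[OF assms]])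
  moreover have "(\<lambda>h. G (moment_map z) \<bullet> (\<chi> j. 2 * pi * (z $ j \<bullet> h $ j))) = (\<lambda>h. h \<bullet> ?D)"
    by (simp add: inner_vec_def fun_eq_iff algebra_simps inner_commute)
  ultimately have "((\<lambda>w. g (moment_map w)) has_derivative (\<lambda>h. h \<bullet> ?D)) (at z)" by simp
  then have "(canonical_hamiltonian X has_derivative (\<lambda>h. h \<bullet> ?D)) (at z)"
    by (rule has_derivative_transform_within_open[of _ _ _ _ "- {0}"]) (use assms hamiltonian in auto)
  then have *: "GDERIV (canonical_hamiltonian X) z :> ?D" by (simp add: gderiv_def)
  show ?thesis unfolding gradient_def
  proof (rule the_equality, rule *)
    fix D assume "GDERIV (canonical_hamiltonian X) z :> D"
    from has_derivative_unique[OF this[unfolded gderiv_def] *[unfolded gderiv_def]]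
    have "(\<lambda>h. h \<bullet> D) = (\<lambda>h. h \<bullet> ?D)" .
    then have "(D - ?D) \<bullet> D = (D - ?D) \<bullet> ?D" by (rule fun_cong)
    then have "(D - ?D) \<bullet> (D - ?D) = 0" by (simp add: inner_diff_right)
    then show "D = ?D" by simp
  qed
qed

text \<open>The gradient multiplies each coordinate by a real function of the moduli, so
  \<open>torus_invariant_ode\<close> shows that the explicit rotation is the only solution.\<close>

lemma hamiltonian_flow_eq:
  assumes "z \<noteq> 0"
  shows "hamiltonian_flow X t z = (\<chi> j. exp (\<i> * of_real (2 * pi * G (moment_map z) $ j * t)) * z $ j)"
proof -
  define \<gamma> where "\<gamma> t = (\<chi> j. exp (\<i> * of_real (2 * pi * G (moment_map z) $ j * t)) * z $ j)" for t
  let ?V = "\<lambda>w. \<i> *s gradient (canonical_hamiltonian X) w"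
  have V: "?V w $ j = \<i> * of_real (2 * pi * G (moment_map w) $ j) * w $ j" if "w \<noteq> 0" for w j
    using gradient_hamiltonian[OF that] by (simp add: scaleR_conv_of_real)
  have n\<gamma>: "cmod (\<gamma> t $ j) = cmod (z $ j)" for t j by (simp add: \<gamma>_def norm_mult)
  have \<gamma>0: "\<gamma> t \<noteq> 0" for t
  proof
    assume "\<gamma> t = 0"
    then have "cmod (z $ j) = 0" for j using n\<gamma>[of t j] by simp
    then show False using assms by (auto simp: vec_eq_iff)
  qed
  have m\<gamma>: "moment_map (\<gamma> t) = moment_map z" for t by (simp add: moment_map_def n\<gamma>)
  have "(\<gamma> has_vector_derivative ?V (\<gamma> t)) (at t)" for t
  proof -
    have "?V (\<gamma> t) = (\<chi> j. \<i> * of_real (2 * pi * G (moment_map z) $ j) *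
        (exp (\<i> * of_real (2 * pi * G (moment_map z) $ j * t)) * z $ j))"
      by (simp only: vec_eq_iff V[OF \<gamma>0] m\<gamma>) (simp add: \<gamma>_def)
    then show ?thesis
      using has_vector_derivative_rotation[of "\<lambda>j. 2 * pi * G (moment_map z) $ j" z t]
      by (simp only: \<gamma>_def[abs_def])
  qed
  then have ic: "integral_curve ?V (- {0}) \<gamma>" using \<gamma>0 by (simp add: integral_curve_def)
  have "(THE \<gamma>. integral_curve ?V (- {0}) \<gamma> \<and> \<gamma> 0 = z) = \<gamma>"
  proof (rule the_equality)
    show "integral_curve ?V (- {0}) \<gamma> \<and> \<gamma> 0 = z" using ic by (simp add: \<gamma>_def vec_eq_iff)
    fix \<eta> assume "integral_curve ?V (- {0}) \<eta> \<and> \<eta> 0 = z"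
    then have \<eta>: "\<And>t. \<eta> t \<noteq> 0" "\<And>t. (\<eta> has_vector_derivative ?V (\<eta> t)) (at t)" and \<eta>0: "\<eta> 0 = z"
      by (auto simp: integral_curve_def)
    have "\<eta> t $ j = exp (\<i> * of_real (2 * pi * G (moment_map (\<eta> 0)) $ j * t)) * \<eta> 0 $ j" for t j
      by (rule torus_invariant_ode[OF \<eta>(2) V[OF \<eta>(1)]]) (simp add: moment_map_def)
    then show "\<eta> = \<gamma>" by (simp add: fun_eq_iff vec_eq_iff \<gamma>_def \<eta>0)
  qed
  then show ?thesis by (simp add: hamiltonian_flow_def \<gamma>_def)
qed

text \<open>The term with \<open>L\<close> records how the angular velocities vary with the moduli.
  The rotation is factored out on the left so that what remains is the identity plus a
  shear.\<close>

lemma hamiltonian_flow_deriv: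
  assumes z: "z \<noteq> 0"
  shows "(hamiltonian_flow X t has_derivative
     (\<lambda>h. \<chi> j. exp (\<i> * of_real (2 * pi * G (moment_map z) $ j * t)) *
        (h $ j + \<i> * of_real (2 * pi * t * L (moment_map z) (\<chi> k. 2 * pi * (z $ k \<bullet> h $ k)) $ j) * z $ j))) (at z)"
proof -
  let ?E = "\<lambda>j. exp (\<i> * of_real (2 * pi * G (moment_map z) $ j * t))"
  let ?l = "\<lambda>j h. L (moment_map z) (\<chi> k. 2 * pi * (z $ k \<bullet> h $ k)) $ j"
  have "((\<lambda>w. \<chi> j. exp (\<i> * of_real (2 * pi * G (moment_map w) $ j * t)) * w $ j) has_derivative
     (\<lambda>h. \<chi> j. ?E j * h $ j + ((2 * pi * ?l j h * t) *\<^sub>R (\<i> * ?E j)) * z $ j)) (at z)"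
  proof (rule has_derivative_vec_lambda, rule has_derivative_mult)
    fix j
    show "((\<lambda>w. w $ j) has_derivative (\<lambda>h. h $ j)) (at z)"
      by (rule bounded_linear_imp_has_derivative[OF bounded_linear_vec_nth])
    have "((\<lambda>w. G (moment_map w)) has_derivative (\<lambda>h. L (moment_map z) (\<chi> k. 2 * pi * (z $ k \<bullet> h $ k)))) (at z)"
      by (rule has_derivative_compose[OF moment_map_deriv G_deriv[OF z]])
    from has_derivative_compose[OF this bounded_linear_imp_has_derivative[OF bounded_linear_vec_nth[of j]]]
    have "((\<lambda>w. G (moment_map w) $ j) has_derivative ?l j) (at z)" .
    from has_derivative_mult_left[OF has_derivative_mult_right[OF this, of "2 * pi"], of t]
    have 1: "((\<lambda>w. 2 * pi * G (moment_map w) $ j * t) has_derivative (\<lambda>h. 2 * pi * ?l j h * t)) (at z)" .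
    have "((\<lambda>s. exp (\<i> * of_real s)) has_vector_derivative \<i> * exp (\<i> * of_real s)) (at s)" for s
      by (rule has_vector_derivative_real_field[of "\<lambda>w. exp (\<i> * w)"]) (auto intro!: derivative_eq_intros)
    then have 2: "((\<lambda>s. exp (\<i> * of_real s)) has_derivative (\<lambda>h. h *\<^sub>R (\<i> * exp (\<i> * of_real s)))) (at s)" for s
      by (simp only: has_vector_derivative_def)
    from has_derivative_compose[OF 1 2]
    show "((\<lambda>w. exp (\<i> * of_real (2 * pi * G (moment_map w) $ j * t))) has_derivative
        (\<lambda>h. (2 * pi * ?l j h * t) *\<^sub>R (\<i> * ?E j))) (at z)" .
  qed
  then have "(hamiltonian_flow X t has_derivative
     (\<lambda>h. \<chi> j. ?E j * h $ j + ((2 * pi * ?l j h * t) *\<^sub>R (\<i> * ?E j)) * z $ j)) (at z)"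
    by (rule has_derivative_transform_within_open[of _ _ _ _ "- {0}"])
      (use z hamiltonian_flow_eq in auto)
  moreover have "?E j * h $ j + ((2 * pi * ?l j h * t) *\<^sub>R (\<i> * ?E j)) * z $ j =
      ?E j * (h $ j + \<i> * of_real (2 * pi * t * ?l j h) * z $ j)" for j h
    by (simp add: scaleR_conv_of_real algebra_simps)
  ultimately show ?thesis by simp
qed

text \<open>With the phases of \<open>z\<close> removed, the linearized flow is a rotation times y
  -> y + i t B(Re y) for a symmetric real \<open>B\<close>. An orthogonal eigenbasis of
  \<open>B\<close> decouples it into planar shears. \<open>\<Lambda>\<close> does not depend on
  \<open>t\<close>, which enters the shears only as a factor.\<close>

lemma det_unitary_part_flow:
  assumes z: "z \<noteq> 0"
  obtains \<Lambda> :: "'n \<Rightarrow> real" where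
    "\<And>t. det (unitary_part (frechet_derivative (hamiltonian_flow X t) (at z))) =
       exp (\<i> * of_real (2 * pi * t * (\<Sum>j\<in>UNIV. G (moment_map z) $ j) + (\<Sum>k\<in>UNIV. arctan (t * \<Lambda> k / 2))))"
proof -
  obtain \<phi> :: "complex ^ 'n" where \<phi>: "\<And>j. cmod (\<phi> $ j) = 1" "moment_lift \<phi> (moment_map z) = z"
    using moment_lift_moment_map by blast
  define r where "r j = cmod (z $ j)" for j
  have "sqrt (moment_map z $ j / pi) = r j" for j by (simp add: moment_map_def r_def)
  then have zr: "z $ j = of_real (r j) * \<phi> $ j" for j
    using arg_cong[OF \<phi>(2), of "\<lambda>w. w $ j"] by (simp add: moment_lift_def)
  have \<phi>c: "cnj (\<phi> $ j) * \<phi> $ j = 1" for j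
    using \<phi>(1)[of j] by (simp add: complex_norm_square[symmetric] mult.commute)
  let ?L = "L (moment_map z)"
  have linL: "linear ?L" using G_deriv[OF z] has_derivative_linear by blast
  define B where "B w = (\<chi> j. 4 * pi\<^sup>2 * r j * ?L (\<chi> k. r k * w $ k) $ j)" for w :: "real ^ 'n"
  have e1: "(\<chi> k. r k * (u + v) $ k) = (\<chi> k. r k * u $ k) + (\<chi> k. r k * v $ k)"
    and e2: "(\<chi> k. r k * (c *\<^sub>R u) $ k) = c *\<^sub>R (\<chi> k. r k * u $ k)" for u v :: "real ^ 'n" and c
    by (simp_all add: vec_eq_iff algebra_simps)
  have linB: "linear B"
  proof (rule linearI)
    show "B (u + v) = B u + B v" for u v
      by (simp only: B_def e1 linear_add[OF linL]) (simp add: vec_eq_iff algebra_simps)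
    show "B (c *\<^sub>R u) = c *\<^sub>R B u" for c u
      by (simp only: B_def e2 linear_cmul[OF linL]) (simp add: vec_eq_iff algebra_simps)
  qed
  have symB: "B u \<bullet> v = u \<bullet> B v" for u v
  proof -
    have "B u \<bullet> v = 4 * pi\<^sup>2 * (?L (\<chi> k. r k * u $ k) \<bullet> (\<chi> k. r k * v $ k))"
      by (simp add: B_def inner_vec_def sum_distrib_left algebra_simps)
    also have "\<dots> = 4 * pi\<^sup>2 * ((\<chi> k. r k * u $ k) \<bullet> ?L (\<chi> k. r k * v $ k))"
      by (simp add: L_sym[OF z])
    also have "\<dots> = u \<bullet> B v"
      by (simp add: B_def inner_vec_def sum_distrib_left algebra_simps)
    finally show ?thesis .
  qed
  obtain Q \<Lambda> where Q: "orthogonal_matrix Q" "\<And>k. B (column k Q) = \<Lambda> k *\<^sub>R column k Q"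
    using symmetric_diagonalization[OF linB symB] by blast
  have QQ: "(\<Sum>k\<in>UNIV. Q $ k $ i * Q $ k $ j) = (if i = j then 1 else 0)"
    "(\<Sum>k\<in>UNIV. Q $ i $ k * Q $ j $ k) = (if i = j then 1 else 0)" for i j
    using Q(1) by (simp_all add: orthogonal_matrix_def matrix_matrix_mult_def transpose_def mat_def vec_eq_iff)
  define W :: "complex ^ 'n ^ 'n" where "W = (\<chi> i j. \<phi> $ i * of_real (Q $ i $ j))"
  define Wa where "Wa = (\<chi> i j. cnj (W $ j $ i))"
  have W: "unitary_matrix W"
    unfolding unitary_matrix_alt
  proof (intro allI)
    fix i j
    have "cnj (W $ k $ i) * W $ k $ j = of_real (Q $ k $ i * Q $ k $ j)" for k
      using \<phi>c[of k] by (simp add: W_def mult_ac)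
    then have "(\<Sum>k\<in>UNIV. cnj (W $ k $ i) * W $ k $ j) = of_real (\<Sum>k\<in>UNIV. Q $ k $ i * Q $ k $ j)" by simp
    then show "(\<Sum>k\<in>UNIV. cnj (W $ k $ i) * W $ k $ j) = (if i = j then 1 else 0)"
      unfolding QQ by simp
  qed
  have "det (unitary_part (frechet_derivative (hamiltonian_flow X t) (at z))) =
       exp (\<i> * of_real (2 * pi * t * (\<Sum>j\<in>UNIV. G (moment_map z) $ j) + (\<Sum>k\<in>UNIV. arctan (t * \<Lambda> k / 2))))" for t
  proof -
    define E where "E j = exp (\<i> * of_real (2 * pi * G (moment_map z) $ j * t))" for j
    define D :: "complex ^ 'n ^ 'n" where "D = (\<chi> i j. if i = j then E i else 0)"
    have Dv: "(D *v y) $ k = E k * y $ k" for y k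
    proof -
      have "(D *v y) $ k = (\<Sum>j\<in>UNIV. if j = k then E k * y $ k else 0)"
        unfolding matrix_vector_mult_def vec_lambda_beta by (intro sum.cong refl) (auto simp: D_def)
      then show ?thesis by simp
    qed
    have D: "unitary_matrix D"
      unfolding unitary_matrix_alt
    proof (intro allI)
      fix i j
      have "(\<Sum>k\<in>UNIV. cnj (D $ k $ i) * D $ k $ j) = (\<Sum>k\<in>UNIV. if k = i then cnj (D $ i $ i) * D $ i $ j else 0)"
        by (intro sum.cong) (auto simp: D_def)
      also have "\<dots> = cnj (D $ i $ i) * D $ i $ j" by simp
      also have "\<dots> = (if i = j then 1 else 0)"
        by (simp add: D_def E_def exp_cnj flip: exp_add)
      finally show "(\<Sum>k\<in>UNIV. cnj (D $ k $ i) * D $ k $ j) = (if i = j then 1 else 0)" .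
    qed
    let ?A = "frechet_derivative (hamiltonian_flow X t) (at z)"
    have A: "?A v = D *v (W *v (\<chi> k. (Wa *v v) $ k + \<i> * of_real (t * \<Lambda> k * Re ((Wa *v v) $ k))))" for v
    proof -
      let ?y = "\<lambda>k. Re ((Wa *v v) $ k)"
      define w where "w = (\<chi> j. Re (cnj (\<phi> $ j) * v $ j))"
      have y: "?y k = (\<Sum>j\<in>UNIV. Q $ j $ k * w $ j)" for k
        by (simp add: Wa_def W_def w_def matrix_vector_mult_def algebra_simps)
      have wQ: "w = (\<Sum>k\<in>UNIV. ?y k *\<^sub>R column k Q)"
        unfolding vec_eq_iff
      proof
        fix i
        have "(\<Sum>k\<in>UNIV. ?y k *\<^sub>R column k Q) $ i = (\<Sum>k\<in>UNIV. \<Sum>j\<in>UNIV. Q $ i $ k * Q $ j $ k * w $ j)"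
          unfolding y by (simp add: column_def sum_distrib_left sum_distrib_right mult_ac)
        also have "\<dots> = (\<Sum>j\<in>UNIV. (\<Sum>k\<in>UNIV. Q $ i $ k * Q $ j $ k) * w $ j)"
          by (subst sum.swap) (simp add: sum_distrib_right)
        also have "\<dots> = (\<Sum>j\<in>UNIV. if i = j then w $ j else 0)"
          unfolding QQ by (intro sum.cong refl) simp
        also have "\<dots> = w $ i" by simp
        finally show "w $ i = (\<Sum>k\<in>UNIV. ?y k *\<^sub>R column k Q) $ i" by simp
      qed
      have BL: "B w = (\<Sum>k\<in>UNIV. (\<Lambda> k * ?y k) *\<^sub>R column k Q)"
        by (subst wQ) (simp add: linear_sum[OF linB] linear_cmul[OF linB] Q(2) mult.commute)
      have zv: "z $ k \<bullet> v $ k = r k * w $ k" for k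
        by (simp add: zr w_def inner_complex_def algebra_simps)
      have Lz: "?L (\<chi> k. 2 * pi * (z $ k \<bullet> v $ k)) $ j = 2 * pi * ?L (\<chi> k. r k * w $ k) $ j" for j
      proof -
        have "(\<chi> k. 2 * pi * (z $ k \<bullet> v $ k)) = (2 * pi) *\<^sub>R (\<chi> k. r k * w $ k)"
          by (simp add: vec_eq_iff zv)
        then show ?thesis by (simp only: linear_cmul[OF linL] vector_scaleR_component) simp
      qed
      have WWa: "W *v (Wa *v v) = v"
        using unitary_matrix_adjoint(2)[OF W] by (simp add: Wa_def matrix_vector_mul_assoc)
      have Wy: "(W *v (\<chi> k. \<i> * of_real (t * \<Lambda> k * ?y k))) $ j = \<i> * of_real t * (\<phi> $ j * of_real (B w $ j))" for j
        unfolding BL by (simp add: matrix_vector_mult_def W_def column_def sum_distrib_left mult_ac)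
      have "(W *v (\<chi> k. (Wa *v v) $ k + \<i> * of_real (t * \<Lambda> k * ?y k))) $ j =
          v $ j + \<i> * of_real (2 * pi * t * ?L (\<chi> k. 2 * pi * (z $ k \<bullet> v $ k)) $ j) * z $ j" for j
      proof -
        have "(\<chi> k. (Wa *v v) $ k + \<i> * of_real (t * \<Lambda> k * ?y k)) = Wa *v v + (\<chi> k. \<i> * of_real (t * \<Lambda> k * ?y k))"
          by (simp add: vec_eq_iff)
        then have "(W *v (\<chi> k. (Wa *v v) $ k + \<i> * of_real (t * \<Lambda> k * ?y k))) $ j =
            v $ j + \<i> * of_real t * (\<phi> $ j * of_real (B w $ j))"
          by (simp only: matrix_vector_right_distrib WWa vector_add_component Wy)
        also have "\<i> * of_real t * (\<phi> $ j * of_real (B w $ j)) =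
            \<i> * of_real (2 * pi * t * ?L (\<chi> k. 2 * pi * (z $ k \<bullet> v $ k)) $ j) * z $ j"
          unfolding Lz by (simp add: B_def zr power2_eq_square)
        finally show ?thesis .
      qed
      then show ?thesis
        unfolding frechet_derivative_eqI[OF hamiltonian_flow_deriv[OF z]]
        by (simp only: vec_eq_iff Dv) (simp add: E_def)
    qed
    have "det (unitary_part ?A) = det D * exp (\<i> * of_real (\<Sum>k\<in>UNIV. arctan (t * \<Lambda> k / 2)))"
      by (rule unitary_part_shear[OF D W A[unfolded Wa_def]])
    also have "det D = (\<Prod>j\<in>UNIV. E j)" by (subst det_diagonal) (auto simp: D_def)
    also have "\<dots> = exp (\<i> * of_real (2 * pi * t * (\<Sum>j\<in>UNIV. G (moment_map z) $ j)))"
      unfolding E_def by (simp add: sum_distrib_left mult_ac flip: exp_sum)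
    finally show ?thesis by (simp add: algebra_simps flip: exp_add)
  qed
  then show ?thesis using that by blast
qed

lemma ruelle_density_eq:
  assumes z: "z \<noteq> 0"
  shows "ruelle_density X z = (\<Sum>j\<in>UNIV. G (moment_map z) $ j)"
proof -
  let ?S = "\<Sum>j\<in>UNIV. G (moment_map z) $ j"
  obtain \<Lambda> :: "'n \<Rightarrow> real" where det:
    "\<And>t. det (unitary_part (frechet_derivative (hamiltonian_flow X t) (at z))) =
       exp (\<i> * of_real (2 * pi * t * ?S + (\<Sum>k\<in>UNIV. arctan (t * \<Lambda> k / 2))))"
    using det_unitary_part_flow[OF z] by blast
  \<comment> \<open>Angles are counted in full turns; arctan is already continuous and 0 at 0, so no
    branch has to be chosen.\<close>
  define u where "u t = t * ?S + (\<Sum>k\<in>UNIV. arctan (t * \<Lambda> k / 2)) / (2 * pi)" for t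
  have eu: "exp (2 * of_real pi * \<i> * of_real (u t)) =
      det (unitary_part (frechet_derivative (hamiltonian_flow X t) (at z)))" for t
  proof -
    have "2 * pi * u t = 2 * pi * t * ?S + (\<Sum>k\<in>UNIV. arctan (t * \<Lambda> k / 2))"
      by (simp add: u_def algebra_simps)
    then show ?thesis unfolding det by (metis mult.assoc mult.commute of_real_mult of_real_numeral)
  qed
  have cu: "continuous_on UNIV u" unfolding u_def by (intro continuous_intros) simp_all
  have "rotation_lift X z = u"
    unfolding rotation_lift_def
  proof (rule the_equality)
    show "continuous_on UNIV u \<and> u 0 = 0 \<and> (\<forall>t. exp (2 * of_real pi * \<i> * of_real (u t)) =
        det (unitary_part (frechet_derivative (hamiltonian_flow X t) (at z))))"
      using cu eu by (simp add: u_def)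
    fix v assume v: "continuous_on UNIV v \<and> v 0 = 0 \<and> (\<forall>t. exp (2 * of_real pi * \<i> * of_real (v t)) =
        det (unitary_part (frechet_derivative (hamiltonian_flow X t) (at z))))"
    \<comment> \<open>Two lifts differ by a continuous integer-valued function, which is constant
      and vanishes at time 0.\<close>
    have int: "v t - u t \<in> \<int>" for t
    proof -
      have "exp (2 * of_real pi * \<i> * of_real (v t)) = exp (2 * of_real pi * \<i> * of_real (u t))"
        using v eu by simp
      then obtain n :: int where "2 * of_real pi * \<i> * of_real (v t) = 2 * of_real pi * \<i> * of_real (u t) + (of_int (2 * n) * pi) * \<i>"
        unfolding exp_eq by blast
      then have "2 * pi * v t = 2 * pi * u t + 2 * of_int n * pi"
        by (simp add: complex_eq_iff)
      then have "pi * (v t - u t) = pi * of_int n" by (simp add: algebra_simps)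
      then have "v t - u t = of_int n" by simp
      then show ?thesis by simp
    qed
    have "(\<lambda>t. v t - u t) constant_on (UNIV :: real set)"
    proof (rule continuous_discrete_range_constant)
      show "connected (UNIV :: real set)" by simp
      show "continuous_on UNIV (\<lambda>t. v t - u t)" using v cu by (intro continuous_intros) auto
      fix x :: real
      show "\<exists>e>0. \<forall>y. y \<in> UNIV \<and> v y - u y \<noteq> v x - u x \<longrightarrow> e \<le> norm ((v y - u y) - (v x - u x))"
      proof (intro exI[of _ 1] conjI allI impI)
        fix y assume "y \<in> UNIV \<and> v y - u y \<noteq> v x - u x"
        then show "1 \<le> norm ((v y - u y) - (v x - u x))"
          using int[of x] int[of y] Ints_nonzero_abs_ge1[of "(v y - u y) - (v x - u x)"] by simp
      qed simp
    qed
    then have "v t - u t = v 0 - u 0" for t by (auto simp: constant_on_def)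
    then show "v = u" using v by (auto simp: u_def fun_eq_iff)
  qed
  moreover have "((\<lambda>T. u T / T) \<longlongrightarrow> ?S) at_top"
  proof -
    have "((\<lambda>T. arctan (T * \<Lambda> k / 2) / (2 * pi) * inverse T) \<longlongrightarrow> 0) at_top" for k
    proof (rule Lim_null_comparison)
      show "\<forall>\<^sub>F T in at_top. norm (arctan (T * \<Lambda> k / 2) / (2 * pi) * inverse T) \<le> inverse T"
        using eventually_gt_at_top[of 0]
      proof eventually_elim
        case (elim T)
        have "\<bar>arctan (T * \<Lambda> k / 2)\<bar> \<le> pi / 2"
          using arctan_bounded[of "T * \<Lambda> k / 2"] by linarith
        then have "\<bar>arctan (T * \<Lambda> k / 2)\<bar> / (2 * pi) \<le> 1"
          using pi_gt_zero by (simp add: divide_le_eq)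
        then have "\<bar>arctan (T * \<Lambda> k / 2)\<bar> / (2 * pi) * inverse T \<le> 1 * inverse T"
          using elim by (intro mult_right_mono) auto
        then show ?case using elim by (simp add: abs_mult)
      qed
      show "(inverse \<longlongrightarrow> (0::real)) at_top" by (rule tendsto_inverse_0_at_top[OF filterlim_ident])
    qed
    then have "((\<lambda>T. ?S + (\<Sum>k\<in>UNIV. arctan (T * \<Lambda> k / 2) / (2 * pi) * inverse T)) \<longlongrightarrow> ?S + (\<Sum>k\<in>(UNIV::'n set). 0)) at_top"
      by (intro tendsto_add tendsto_sum tendsto_const)
    then have "((\<lambda>T. ?S + (\<Sum>k\<in>UNIV. arctan (T * \<Lambda> k / 2) / (2 * pi) * inverse T)) \<longlongrightarrow> ?S) at_top"
      by simp
    then show ?thesis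
    proof (rule Lim_transform_eventually)
      show "\<forall>\<^sub>F T in at_top. ?S + (\<Sum>k\<in>UNIV. arctan (T * \<Lambda> k / 2) / (2 * pi) * inverse T) = u T / T"
        using eventually_gt_at_top[of 0]
      proof eventually_elim
        case (elim T)
        have "(\<Sum>k\<in>UNIV. arctan (T * \<Lambda> k / 2)) / (2 * pi) / T =
            (\<Sum>k\<in>UNIV. arctan (T * \<Lambda> k / 2) / (2 * pi) * inverse T)"
          by (simp only: sum_divide_distrib divide_inverse sum_distrib_right)
        then show ?case using elim unfolding u_def add_divide_distrib by simp
      qed
    qed
  qed
  ultimately show ?thesis by (simp add: ruelle_density_def tendsto_Lim)
qed

end

section \<open>Concave regions bounded by a generalized mean of linear forms\<close>

lemma moment_map_0 [simp]: "moment_map 0 = 0"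
  by (simp add: moment_map_def vec_eq_iff)

lemma moment_map_eq_0 [simp]: "moment_map z = 0 \<longleftrightarrow> z = 0"
  by (simp add: moment_map_def vec_eq_iff)

lemma moment_map_scaleR: "moment_map (r *\<^sub>R z) = r\<^sup>2 *\<^sub>R moment_map z"
  by (simp add: moment_map_def vec_eq_iff norm_mult power_mult_distrib)

text \<open>Strict positivity of all coefficients makes every form positive on the closed orthant
  minus the origin, and so near each such point; all derivatives below are therefore full
  ones.\<close>

locale linear_form_mean =
  fixes C :: "(real ^ 'n) set" and p :: real
  assumes fin: "finite C" and ne: "C \<noteq> {}" and C_pos: "\<And>c j. c \<in> C \<Longrightarrow> c $ j > 0" and p_pos: "p > 0"
begin

definition q :: "real ^ 'n \<Rightarrow> real" where
  "q x = (\<Sum>c\<in>C. (c \<bullet> x) powr (- p))"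

text \<open>Since \<open>0 powr _ = 0\<close>, the value at the origin is \<open>0\<close>.\<close>
definition g :: "real ^ 'n \<Rightarrow> real" where
  "g x = q x powr (- 1 / p)"

text \<open>Up to the factor \<open>- p\<close>, the gradient of \<open>q\<close>.\<close>

definition s :: "real ^ 'n \<Rightarrow> real ^ 'n" where
  "s x = (\<Sum>c\<in>C. ((c \<bullet> x) powr (- p - 1)) *\<^sub>R c)"

definition G :: "real ^ 'n \<Rightarrow> real ^ 'n" where
  "G x = (q x powr (- 1 / p - 1)) *\<^sub>R s x"

text \<open>The Hessian of \<open>g\<close>, as the product rule for \<open>G\<close> yields it;
  every summand is a rank-one form and so symmetric.\<close>

definition L :: "real ^ 'n \<Rightarrow> real ^ 'n \<Rightarrow> real ^ 'n" where
  "L x h = (q x powr (- 1 / p - 1)) *\<^sub>R (\<Sum>c\<in>C. ((- p - 1) * (c \<bullet> x) powr (- p - 1 - 1) * (c \<bullet> h)) *\<^sub>R c)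
     + ((- 1 / p - 1) * q x powr (- 1 / p - 1 - 1) * (- p * (s x \<bullet> h))) *\<^sub>R s x"

definition region :: "(real ^ 'n) set" where
  "region = {x \<in> orthant. g x \<le> 1}"

abbreviation H :: "complex ^ 'n \<Rightarrow> real" where
  "H z \<equiv> g (moment_map z)"

lemma inner_pos:
  assumes "c \<in> C" "x \<in> orthant" "x \<noteq> 0"
  shows "c \<bullet> x > 0"
proof -
  obtain k where "x $ k \<noteq> 0" using assms(3) by (auto simp: vec_eq_iff)
  then have "x $ k > 0" using assms(2) by (simp add: orthant_def order_less_le)
  then have "0 < c $ k * x $ k" using C_pos assms(1) by simp
  moreover have "0 \<le> c $ j * x $ j" for j
    using C_pos[OF assms(1), of j] assms(2) by (simp add: orthant_def)
  ultimately show ?thesis unfolding inner_vec_def by (intro sum_pos2[of UNIV k]) auto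
qed

lemma q_pos:
  assumes "\<And>c. c \<in> C \<Longrightarrow> c \<bullet> x > 0"
  shows "q x > 0"
  unfolding q_def
proof (intro sum_pos fin ne)
  fix c assume "c \<in> C"
  from assms[OF this] show "(c \<bullet> x) powr (- p) > 0" by simp
qed

lemma powr_inner_deriv:
  assumes "c \<bullet> x > 0"
  shows "((\<lambda>x. (c \<bullet> x) powr a) has_derivative (\<lambda>h. a * (c \<bullet> x) powr (a - 1) * (c \<bullet> h))) (at x)"
proof -
  have "((\<lambda>y. y powr a) has_derivative (\<lambda>h. (a * (c \<bullet> x) powr (a - 1)) * h)) (at (c \<bullet> x))"
    using has_real_derivative_powr[OF assms, of a] by (simp add: has_field_derivative_def)
  from has_derivative_compose[OF bounded_linear_imp_has_derivative[OF bounded_linear_inner_right[of c]] this]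
  show ?thesis .
qed

lemma q_deriv:
  assumes "\<And>c. c \<in> C \<Longrightarrow> c \<bullet> x > 0"
  shows "(q has_derivative (\<lambda>h. - p * (s x \<bullet> h))) (at x)"
proof -
  have "(q has_derivative (\<lambda>h. \<Sum>c\<in>C. - p * (c \<bullet> x) powr (- p - 1) * (c \<bullet> h))) (at x)"
    unfolding q_def by (intro has_derivative_sum powr_inner_deriv assms)
  moreover have "(\<Sum>c\<in>C. - p * (c \<bullet> x) powr (- p - 1) * (c \<bullet> h)) = - p * (s x \<bullet> h)" for h
    by (simp add: s_def inner_sum_left sum_distrib_left mult.assoc)
  ultimately show ?thesis by simp
qed

lemma q_powr_deriv:
  assumes "\<And>c. c \<in> C \<Longrightarrow> c \<bullet> x > 0"
  shows "((\<lambda>x. q x powr a) has_derivative (\<lambda>h. a * q x powr (a - 1) * (- p * (s x \<bullet> h)))) (at x)"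
proof -
  have "((\<lambda>y. y powr a) has_derivative (\<lambda>h. (a * q x powr (a - 1)) * h)) (at (q x))"
    using has_real_derivative_powr[OF q_pos[OF assms], of a] by (simp add: has_field_derivative_def)
  from has_derivative_compose[OF q_deriv[OF assms] this] show ?thesis .
qed

lemma g_deriv:
  assumes "\<And>c. c \<in> C \<Longrightarrow> c \<bullet> x > 0"
  shows "(g has_derivative (\<lambda>h. G x \<bullet> h)) (at x)"
proof -
  have "(g has_derivative (\<lambda>h. (- 1 / p) * q x powr (- 1 / p - 1) * (- p * (s x \<bullet> h)))) (at x)"
    unfolding g_def by (rule q_powr_deriv[OF assms])
  moreover have "(- 1 / p) * q x powr (- 1 / p - 1) * (- p * (s x \<bullet> h)) = G x \<bullet> h" for h
    using p_pos by (simp add: G_def)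
  ultimately show ?thesis by simp
qed

lemma G_deriv:
  assumes "\<And>c. c \<in> C \<Longrightarrow> c \<bullet> x > 0"
  shows "(G has_derivative L x) (at x)"
proof -
  have "(s has_derivative (\<lambda>h. \<Sum>c\<in>C. ((- p - 1) * (c \<bullet> x) powr (- p - 1 - 1) * (c \<bullet> h)) *\<^sub>R c)) (at x)"
    unfolding s_def by (intro has_derivative_sum has_derivative_scaleR_left powr_inner_deriv assms)
  from has_derivative_scaleR[OF q_powr_deriv[OF assms] this]
  show ?thesis unfolding G_def L_def[abs_def] .
qed

lemma L_sym: "L x u \<bullet> v = u \<bullet> L x v"
proof -
  have "L x u \<bullet> v = q x powr (- 1 / p - 1) * (\<Sum>c\<in>C. (- p - 1) * (c \<bullet> x) powr (- p - 1 - 1) * ((c \<bullet> u) * (c \<bullet> v)))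
     + (- 1 / p - 1) * q x powr (- 1 / p - 1 - 1) * (- p * ((s x \<bullet> u) * (s x \<bullet> v)))" for u v
    by (simp only: L_def inner_add_left inner_sum_left inner_scaleR_left mult.assoc)
  then show ?thesis by (metis (no_types, lifting) inner_commute mult.commute sum.cong)
qed

lemma g_0 [simp]: "g 0 = 0"
  by (simp add: g_def q_def)

lemma g_pos:
  assumes "x \<in> orthant" "x \<noteq> 0"
  shows "g x > 0"
proof -
  have "q x > 0" by (rule q_pos) (rule inner_pos[OF _ assms])
  then show ?thesis unfolding g_def by simp
qed

text \<open>The outer exponent in \<open>g\<close> is chosen for this degree of homogeneity, which
  becomes \<open>Z H = H\<close> because the moment map is quadratic.\<close>

lemma g_scale:
  assumes "r > 0" "x \<in> orthant"
  shows "g (r *\<^sub>R x) = r * g x"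
proof (cases "x = 0")
  case False
  have "(c \<bullet> (r *\<^sub>R x)) powr (- p) = r powr (- p) * (c \<bullet> x) powr (- p)" if "c \<in> C" for c
    using inner_pos[OF that assms(2) False] assms(1) by (simp add: powr_mult)
  then have "q (r *\<^sub>R x) = r powr (- p) * q x" by (simp add: q_def sum_distrib_left)
  then have "g (r *\<^sub>R x) = (r powr (- p)) powr (- 1 / p) * g x"
    using q_pos[of x] inner_pos[OF _ assms(2) False] by (simp add: g_def powr_mult)
  also have "(r powr (- p)) powr (- 1 / p) = r" using p_pos assms(1) by (simp add: powr_powr)
  finally show ?thesis .
qed simp

lemma g_le_inner:
  assumes "x \<in> orthant" "c \<in> C"
  shows "g x \<le> c \<bullet> x"
proof (cases "x = 0")
  case False
  note pos = inner_pos[OF _ assms(1) False]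
  have "(c \<bullet> x) powr (- p) \<le> q x"
    unfolding q_def by (rule member_le_sum[OF assms(2)]) (simp_all add: fin)
  moreover have "(c \<bullet> x) powr (- p) > 0" using pos[OF assms(2)] by simp
  ultimately have "g x \<le> ((c \<bullet> x) powr (- p)) powr (- 1 / p)"
    unfolding g_def using p_pos by (intro powr_mono2') auto
  also have "\<dots> = c \<bullet> x" using pos[OF assms(2)] p_pos by (simp add: powr_powr)
  finally show ?thesis .
qed simp

text \<open>Replaces the root by the sum \<open>q\<close>, with the order reversed by the negative
  exponent. The origin must be excluded: there \<open>q\<close> is 0 by the convention for
  \<open>powr\<close>, yet \<open>g\<close> is 0 too.\<close>

lemma one_less_g_iff:
  assumes "x \<in> orthant" "x \<noteq> 0"
  shows "g x > 1 \<longleftrightarrow> q x < 1"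
proof -
  have q: "q x > 0" using q_pos inner_pos[OF _ assms] by blast
  show ?thesis
  proof
    assume "q x < 1"
    then have "1 powr (- 1 / p) < q x powr (- 1 / p)"
      using q p_pos by (intro powr_less_mono2_neg) auto
    then show "g x > 1" by (simp add: g_def)
  next
    assume g: "g x > 1"
    show "q x < 1"
    proof (rule ccontr)
      assume "\<not> q x < 1"
      then have "q x powr (- 1 / p) \<le> 1 powr (- 1 / p)" using p_pos by (intro powr_mono2') auto
      then show False using g by (simp add: g_def)
    qed
  qed
qed

section \<open>The Hamiltonian on complex space and its unit sublevel set\<close>

lemma inner_moment_pos: "z \<noteq> 0 \<Longrightarrow> c \<in> C \<Longrightarrow> c \<bullet> moment_map z > 0"
  by (intro inner_pos moment_map_in_orthant) simp_all

lemma H_pos: "z \<noteq> 0 \<Longrightarrow> H z > 0"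
  by (simp add: g_pos moment_map_in_orthant)

lemma H_scale: "r > 0 \<Longrightarrow> H (r *\<^sub>R z) = r\<^sup>2 * H z"
  by (simp add: moment_map_scaleR g_scale moment_map_in_orthant)

lemma toric_region: "toric_domain region = {z. H z \<le> 1}"
  by (auto simp: toric_domain_def region_def moment_map_in_orthant)

lemma Ck_on_moment_inner:
  fixes c :: "real ^ 'n"
  assumes "open S"
  shows "Ck_on k (\<lambda>z. c \<bullet> moment_map z) S"
proof -
  have R: "bounded_linear (\<lambda>z :: complex ^ 'n. Re (z $ j))" and I: "bounded_linear (\<lambda>z :: complex ^ 'n. Im (z $ j))" for j
    by (rule bounded_linear_compose[OF bounded_linear_Re bounded_linear_vec_nth],
        rule bounded_linear_compose[OF bounded_linear_Im bounded_linear_vec_nth])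
  have "Ck_on k (\<lambda>z. \<Sum>j\<in>UNIV. (c $ j * pi) * (Re (z $ j) * Re (z $ j) + Im (z $ j) * Im (z $ j))) S"
    by (intro Ck_on_sum Ck_on_mult Ck_on_add Ck_on_const Ck_on_bounded_linear assms R I)
  moreover have "(\<lambda>z. c \<bullet> moment_map z) =
      (\<lambda>z. \<Sum>j\<in>UNIV. (c $ j * pi) * (Re (z $ j) * Re (z $ j) + Im (z $ j) * Im (z $ j)))"
    by (simp only: fun_eq_iff inner_vec_def moment_map_def vec_lambda_beta cmod_power2 inner_real_def)
      (simp add: power2_eq_square mult.assoc)
  ultimately show ?thesis by simp
qed

text \<open>Each form composed with the moment map is a quadratic polynomial in real and imaginary
  parts, positive off the origin, so the powers cause no trouble at the coordinate
  hyperplanes.\<close>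

lemma smooth_on_H: "smooth_on H (- {0})"
  unfolding smooth_on_def g_def q_def
proof
  fix k
  have o: "open (- {0 :: complex ^ 'n})" by auto
  have pos: "c \<bullet> moment_map z > 0" if "z \<in> - {0}" "c \<in> C" for c and z :: "complex ^ 'n"
    using inner_moment_pos that by simp
  have "q (moment_map z) > 0" if "z \<in> - {0}" for z :: "complex ^ 'n"
    by (rule q_pos) (use pos[OF that] in auto)
  then show "Ck_on k (\<lambda>z. (\<Sum>c\<in>C. (c \<bullet> moment_map z) powr - p) powr (- 1 / p)) (- {0})"
    by (intro Ck_on_powr Ck_on_sum o Ck_on_moment_inner pos) (auto simp: q_def)
qed

text \<open>Euler's relation, from differentiating \<open>H_scale\<close> at r = 1. It later yields
  regularity of the boundary, transversality and \<open>Z H = H\<close>.\<close>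

lemma H_frechet:
  assumes "z \<noteq> 0"
  shows "(H has_derivative frechet_derivative H (at z)) (at z)"
    and "frechet_derivative H (at z) z = 2 * H z"
proof -
  have "Ck_on 1 H (- {0})" using smooth_on_H by (simp add: smooth_on_def)
  then show d: "(H has_derivative frechet_derivative H (at z)) (at z)"
    using assms by (simp add: frechet_derivative_works)
  have "((\<lambda>r. H (r *\<^sub>R z)) has_derivative (\<lambda>h. frechet_derivative H (at z) (h *\<^sub>R z))) (at 1)"
    by (rule has_derivative_compose[of "\<lambda>r. r *\<^sub>R z" _ 1 UNIV H])
      (auto intro!: derivative_eq_intros simp: d)
  moreover have "((\<lambda>r. r\<^sup>2 * H z) has_derivative (\<lambda>h. h * (2 * H z))) (at 1)"
    by (auto intro!: derivative_eq_intros)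
  then have "((\<lambda>r. H (r *\<^sub>R z)) has_derivative (\<lambda>h. h * (2 * H z))) (at 1)"
    by (rule has_derivative_transform_within_open[of _ _ _ _ "{0<..}"]) (auto simp: H_scale)
  ultimately have "(\<lambda>h. frechet_derivative H (at z) (h *\<^sub>R z)) = (\<lambda>h. h * (2 * H z))"
    by (rule has_derivative_unique)
  from fun_cong[OF this, of 1] show "frechet_derivative H (at z) z = 2 * H z" by simp
qed

lemma continuous_on_H: "continuous_on (- {0}) H"
proof -
  have "Ck_on 0 H (- {0})" using smooth_on_H unfolding smooth_on_def by (rule spec)
  then show ?thesis by simp
qed

text \<open>Continuity of \<open>H\<close> is available only off the origin; a neighborhood of 0
  comes from a single form, which dominates \<open>g\<close>.\<close>

lemma zero_in_interior: "0 \<in> interior {z. H z \<le> 1}"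
proof -
  obtain c where c: "c \<in> C" using ne by blast
  let ?S = "{z :: complex ^ 'n. c \<bullet> moment_map z < 1}"
  have "open ?S"
    by (intro open_Collect_less continuous_intros continuous_on_moment_map)
  moreover have "?S \<subseteq> {z. H z \<le> 1}"
  proof
    fix z assume "z \<in> ?S"
    then show "z \<in> {z. H z \<le> 1}" using g_le_inner[OF moment_map_in_orthant c, of z] by simp
  qed
  moreover have "(0 :: complex ^ 'n) \<in> ?S" by simp
  ultimately show ?thesis by (intro interiorI[of ?S])
qed

lemma closed_sublevel: "closed {z. H z \<le> 1}"
proof -
  have "open (- {0} \<inter> H -` {1<..})"
    by (rule continuous_open_preimage[OF continuous_on_H]) auto
  moreover have "- {0} \<inter> H -` {1<..} = - {z. H z \<le> 1}"
    by (auto simp: not_le)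
  ultimately show ?thesis by (simp add: closed_def)
qed

lemma frontier_sublevel: "frontier {z. H z \<le> 1} = {z. z \<noteq> 0 \<and> H z = 1}"
proof -
  have lt: "z \<in> interior {z. H z \<le> 1}" if "z = 0 \<or> H z < 1" for z
  proof (cases "z = 0")
    case False
    have "open (- {0} \<inter> H -` {..<1})"
      by (rule continuous_open_preimage[OF continuous_on_H]) auto
    moreover have "- {0} \<inter> H -` {..<1} \<subseteq> {z. H z \<le> 1}" by auto
    moreover have "z \<in> - {0} \<inter> H -` {..<1}" using that False by simp
    ultimately show ?thesis using interiorI by blast
  qed (use zero_in_interior in simp)
  have eq: "z \<notin> interior {z. H z \<le> 1}" if "z \<noteq> 0" "H z = 1" for z
  proof
    assume "z \<in> interior {z. H z \<le> 1}"
    then obtain e where e: "e > 0" "ball z e \<subseteq> {z. H z \<le> 1}" by (auto simp: mem_interior)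
    define r where "r = 1 + e / (2 * norm z)"
    have r: "r > 1" using e that by (simp add: r_def)
    have "dist z (r *\<^sub>R z) = norm ((1 - r) *\<^sub>R z)" by (simp add: dist_norm algebra_simps)
    also have "\<dots> = e / 2" using that e by (simp add: r_def)
    finally have "r *\<^sub>R z \<in> ball z e" using e by simp
    then have "H (r *\<^sub>R z) \<le> 1" using e(2) by blast
    then have "r\<^sup>2 \<le> 1" using r H_scale[of r z] that by simp
    then show False using r by (simp add: power_le_one_iff abs_square_le_1)
  qed
  show ?thesis
    unfolding frontier_def closure_closed[OF closed_sublevel]
    using lt eq interior_subset by (auto simp: order_le_less)
qed

text \<open>With \<open>d\<close> the smallest coefficient, every form is at least d pi |z|^2, so
  \<open>q\<close> is at most \<open>card C\<close> times a negative power of it; but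
  \<open>q\<close> is at least 1 on the sublevel set.\<close>

lemma compact_sublevel: "compact {z. H z \<le> 1}"
proof -
  define d where "d = Min ((\<lambda>(c, j). c $ j) ` (C \<times> UNIV))"
  have fi: "finite ((\<lambda>(c, j). c $ j) ` (C \<times> (UNIV :: 'n set)))" using fin by simp
  have d: "d > 0" unfolding d_def using fi ne C_pos by (subst Min_gr_iff) auto
  have dle: "d \<le> c $ j" if "c \<in> C" for c j
    unfolding d_def by (rule Min_le[OF fi]) (use that in force)
  have "norm z \<le> sqrt (real (card C) powr (1 / p) / (d * pi))" if "H z \<le> 1" "z \<noteq> 0" for z
  proof -
    let ?S = "pi * (norm z)\<^sup>2"
    have S: "?S > 0" using that by simp
    have ge: "c \<bullet> moment_map z \<ge> d * ?S" if "c \<in> C" for c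
      unfolding norm_eq_moment_map inner_vec_def sum_distrib_left
      by (intro sum_mono) (simp add: dle that mult_right_mono moment_map_def)
    have "q (moment_map z) \<le> (\<Sum>c\<in>C. (d * ?S) powr (- p))"
      unfolding q_def using ge d S p_pos by (intro sum_mono powr_mono2') auto
    then have "q (moment_map z) \<le> card C * (d * ?S) powr (- p)" by simp
    moreover have "1 \<le> q (moment_map z)"
      using one_less_g_iff[OF moment_map_in_orthant, of z] that by fastforce
    ultimately have "1 \<le> card C * (d * ?S) powr (- p)" by linarith
    then have "1 * (d * ?S) powr p \<le> card C * (d * ?S) powr (- p) * (d * ?S) powr p"
      by (intro mult_right_mono) auto
    also have "\<dots> = card C * ((d * ?S) powr (- p) * (d * ?S) powr p)" by simp
    also have "(d * ?S) powr (- p) * (d * ?S) powr p = 1"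
      unfolding powr_add[symmetric] using d S that by simp
    finally have "(d * ?S) powr p \<le> card C" by simp
    then have "((d * ?S) powr p) powr (1 / p) \<le> card C powr (1 / p)"
      using p_pos d S by (intro powr_mono2) auto
    then have "d * ?S \<le> card C powr (1 / p)" using p_pos d S by (simp add: powr_powr)
    then have "(norm z)\<^sup>2 \<le> card C powr (1 / p) / (d * pi)" using d by (simp add: field_simps)
    then show ?thesis using real_le_rsqrt by blast
  qed
  moreover have "norm (0 :: complex ^ 'n) \<le> sqrt (real (card C) powr (1 / p) / (d * pi))"
    using d by simp
  ultimately have "bounded {z. H z \<le> 1}"
    unfolding bounded_iff by (metis mem_Collect_eq)
  then show ?thesis using closed_sublevel by (simp add: compact_eq_bounded_closed)
qed

lemma star_shaped: "star_shaped_domain (toric_domain region)"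
  unfolding star_shaped_domain_def toric_region
proof (intro conjI ballI)
  show "compact {z. H z \<le> 1}" by (rule compact_sublevel)
  show "0 \<in> interior {z. H z \<le> 1}" by (rule zero_in_interior)
  have "starlike {z. H z \<le> 1}"
    unfolding starlike_def
  proof (intro bexI ballI subsetI)
    show "0 \<in> {z. H z \<le> 1}" by simp
    fix z w assume z: "z \<in> {z. H z \<le> 1}" and "w \<in> closed_segment 0 z"
    then obtain u where u: "w = u *\<^sub>R z" "0 \<le> u" "u \<le> 1" by (auto simp: in_segment)
    show "w \<in> {z. H z \<le> 1}"
    proof (cases "u = 0 \<or> z = 0")
      case True
      then have "moment_map w = 0" using u by auto
      then show ?thesis by simp
    next
      case False
      have "u\<^sup>2 * H z \<le> 1 * 1"
        using z u H_pos[of z] False by (intro mult_mono) (auto simp: power_le_one less_imp_le)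
      then show ?thesis using False u H_scale[of u z] by simp
    qed
  qed
  then show "connected {z. H z \<le> 1}" by (rule starlike_imp_connected)
  show "smooth_boundary {z. H z \<le> 1}"
    unfolding smooth_boundary_def
  proof (intro ballI exI conjI)
    fix z assume "z \<in> frontier {z. H z \<le> 1}"
    then show "z \<in> - {0}" by (simp add: frontier_sublevel)
    show "open (- {0 :: complex ^ 'n})" by auto
    show "smooth_on (\<lambda>z. H z + (- 1)) (- {0})"
      unfolding smooth_on_def
      by (intro allI Ck_on_add Ck_on_const open_Compl closed_singleton)
        (use smooth_on_H in \<open>simp add: smooth_on_def\<close>)
    show "{z. H z \<le> 1} \<inter> - {0} = {x \<in> - {0}. H x + - 1 \<le> 0}" by auto
  next
    fix w :: "complex ^ 'n" assume "w \<in> - {0}"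
    then have w: "w \<noteq> 0" by simp
    have "((\<lambda>z. H z + (- 1)) has_derivative (\<lambda>h. frechet_derivative H (at w) h + 0)) (at w)"
      by (intro has_derivative_add has_derivative_const H_frechet(1) w)
    then have "frechet_derivative (\<lambda>z. H z + (- 1)) (at w) = (\<lambda>h. frechet_derivative H (at w) h + 0)"
      by (rule frechet_derivative_eqI)
    then show "frechet_derivative (\<lambda>z. H z + - 1) (at w) w \<noteq> 0"
      using H_frechet(2)[OF w] H_pos[OF w] by simp
  qed
  fix z assume z: "z \<in> frontier {z. H z \<le> 1}"
  then have z1: "z \<noteq> 0" "H z = 1" by (auto simp: frontier_sublevel)
  show "z \<notin> tangent_space (frontier {z. H z \<le> 1}) z"
  proof
    assume "z \<in> tangent_space (frontier {z. H z \<le> 1}) z"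
    then obtain \<gamma> :: "real \<Rightarrow> complex ^ 'n" where \<gamma>: "\<gamma> 0 = z"
      "\<forall>\<^sub>F t in nhds 0. \<gamma> t \<in> frontier {z. H z \<le> 1}" "(\<gamma> has_vector_derivative z) (at 0)"
      by (auto simp: tangent_space_def)
    then have ev: "\<forall>\<^sub>F t in nhds 0. H (\<gamma> t) = 1" by (simp add: frontier_sublevel eventually_mono)
    then obtain S where S: "open S" "0 \<in> S" "\<And>t. t \<in> S \<Longrightarrow> H (\<gamma> t) = 1"
      unfolding eventually_nhds by blast
    have "((\<lambda>t. H (\<gamma> t)) has_derivative (\<lambda>h. frechet_derivative H (at z) (h *\<^sub>R z))) (at 0)"
      using has_derivative_compose[of \<gamma> "\<lambda>h. h *\<^sub>R z" 0 UNIV H] \<gamma>(1,3) H_frechet(1)[OF z1(1)]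
      by (simp add: has_vector_derivative_def)
    moreover have "((\<lambda>t. H (\<gamma> t)) has_derivative (\<lambda>h. 0)) (at 0)"
      by (rule has_derivative_transform_within_open[of "\<lambda>_. 1", OF _ S(1,2)]) (simp_all add: S(3))
    ultimately have "(\<lambda>h. frechet_derivative H (at z) (h *\<^sub>R z)) = (\<lambda>h::real. 0)"
      by (rule has_derivative_unique)
    from fun_cong[OF this, of 1] show False using H_frechet(2)[OF z1(1)] z1 by simp
  qed
qed

lemma region_smooth: "smooth_star_shaped_region region"
  using star_shaped by (auto simp: smooth_star_shaped_region_def region_def)

lemma powr_neg_convex:
  assumes "0 < x" "0 < y" "0 \<le> u" "0 \<le> v" "u + v = 1"
  shows "(u * x + v * y) powr (- p) \<le> u * x powr (- p) + v * y powr (- p)"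
proof -
  have "convex_on {0<..} (\<lambda>t::real. t powr (- p))"
  proof (rule f''_ge0_imp_convex[where f' = "\<lambda>t. - p * t powr (- p - 1)" and f'' = "\<lambda>t. - p * ((- p - 1) * t powr (- p - 1 - 1))"])
    fix t :: real assume t: "t \<in> {0<..}"
    then show "((\<lambda>t. t powr (- p)) has_real_derivative - p * t powr (- p - 1)) (at t)"
      by (intro has_real_derivative_powr) simp
    show "((\<lambda>t. - p * t powr (- p - 1)) has_real_derivative - p * ((- p - 1) * t powr (- p - 1 - 1))) (at t)"
      using t by (intro DERIV_cmult has_real_derivative_powr) simp
    have "0 \<le> (p * (p + 1)) * t powr (- p - 1 - 1)" using p_pos by simp
    then show "0 \<le> - p * ((- p - 1) * t powr (- p - 1 - 1))" by (simp add: algebra_simps)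
  qed simp
  from convex_onD[OF this, of v x y] assms
  have "((1 - v) * x + v * y) powr (- p) \<le> (1 - v) * x powr (- p) + v * y powr (- p)" by simp
  moreover have "1 - v = u" using assms by simp
  ultimately show ?thesis by (simp only:)
qed

text \<open>By \<open>one_less_g_iff\<close> the complement is where the convex function
  \<open>q\<close> is below 1.\<close>

lemma region_concave: "concave_region region"
  unfolding concave_region_def
proof (rule convexI)
  fix x y u v assume xy: "x \<in> orthant - region" "y \<in> orthant - region" and uv: "0 \<le> u" "0 \<le> v" "u + v = (1::real)"
  have x: "x \<in> orthant" "g x > 1" "x \<noteq> 0" and y: "y \<in> orthant" "g y > 1" "y \<noteq> 0"
    using xy by (auto simp: region_def)
  let ?w = "u *\<^sub>R x + v *\<^sub>R y"
  have w: "?w \<in> orthant" using x y uv by (simp add: orthant_def)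
  have cw: "c \<bullet> ?w = u * (c \<bullet> x) + v * (c \<bullet> y)" for c by (simp add: inner_add_right)
  \<comment> \<open>A positive form at the combination shows that it is not the origin, which
    satisfies \<open>q x < 1\<close> but belongs to the region.\<close>
  obtain c where c: "c \<in> C" using ne by blast
  have "c \<bullet> ?w > 0"
  proof (cases "u = 0")
    case True
    then show ?thesis unfolding cw using uv inner_pos[OF c y(1,3)] by simp
  next
    case False
    then have "u * (c \<bullet> x) > 0" using uv inner_pos[OF c x(1,3)] by simp
    moreover have "v * (c \<bullet> y) \<ge> 0" using uv inner_pos[OF c y(1,3)] by simp
    ultimately show ?thesis unfolding cw by simp
  qed
  then have w0: "?w \<noteq> 0" by auto
  have "q ?w \<le> u * q x + v * q y"
    unfolding q_def sum_distrib_left sum.distrib[symmetric] cw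
    by (intro sum_mono powr_neg_convex uv inner_pos x y)
  also have "\<dots> < 1"
  proof -
    have qx: "q x < 1" and qy: "q y < 1" using one_less_g_iff x y by blast+
    show ?thesis
    proof (cases "u = 0")
      case False
      then have "u * q x < u * 1" using qx uv by simp
      moreover have "v * q y \<le> v * 1" using qy uv by (intro mult_left_mono) auto
      ultimately show ?thesis using uv by simp
    qed (use qy uv in simp)
  qed
  finally have "g ?w > 1" using one_less_g_iff[OF w w0] by simp
  then show "?w \<in> orthant - region" using w by (simp add: region_def)
qed

text \<open>Any competitor is homogeneous of degree 2 by its differential equation, so it is
  determined by its unit level set, which every ray meets.\<close>

lemma canonical_hamiltonian_region: "canonical_hamiltonian (toric_domain region) = H"
  unfolding canonical_hamiltonian_def toric_region frontier_sublevel
proof (rule the_equality)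
  have "frechet_derivative H (at z) (Zfield z) = H z" if "z \<noteq> 0" for z
  proof -
    have "linear (frechet_derivative H (at z))" using H_frechet(1)[OF that] has_derivative_linear by blast
    then show ?thesis using H_frechet(2)[OF that] by (simp add: Zfield_def linear_cmul)
  qed
  moreover have "H 0 = 0" by simp
  ultimately show "H 0 = 0 \<and> smooth_on H (- {0}) \<and>
      (\<forall>z. z \<noteq> 0 \<longrightarrow> H z > 0 \<and> frechet_derivative H (at z) (Zfield z) = H z) \<and>
      {z. z \<noteq> 0 \<and> H z = 1} = {z. z \<noteq> 0 \<and> H z = 1}"
    using smooth_on_H H_pos by blast
  fix K :: "complex ^ 'n \<Rightarrow> real"
  assume K: "K 0 = 0 \<and> smooth_on K (- {0}) \<and>
      (\<forall>z. z \<noteq> 0 \<longrightarrow> K z > 0 \<and> frechet_derivative K (at z) (Zfield z) = K z) \<and>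
      {z. z \<noteq> 0 \<and> K z = 1} = {z. z \<noteq> 0 \<and> H z = 1}"
  then have "Ck_on 1 K (- {0})" by (simp add: smooth_on_def)
  then have dK: "(K has_derivative frechet_derivative K (at z)) (at z)" if "z \<noteq> 0" for z
    using that by (simp add: frechet_derivative_works)
  have hom: "K (r *\<^sub>R z) = r\<^sup>2 * K z" if z: "z \<noteq> 0" and r: "r > 0" for r z
  proof -
    \<comment> \<open>The equation for \<open>Zfield\<close> says that K(rz)/r^2 has zero derivative
      along each ray.\<close>
    have "((\<lambda>r. K (r *\<^sub>R z) / r\<^sup>2) has_real_derivative 0) (at r within {0<..})" if r: "r \<in> {0<..}" for r
    proof -
      have r0: "r > 0" using r by simp
      have nz: "r *\<^sub>R z \<noteq> 0" using r z by simp
      have lin: "linear (frechet_derivative K (at (r *\<^sub>R z)))" using dK[OF nz] has_derivative_linear by blast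
      have "frechet_derivative K (at (r *\<^sub>R z)) (Zfield (r *\<^sub>R z)) = K (r *\<^sub>R z)" using K nz by blast
      then have "frechet_derivative K (at (r *\<^sub>R z)) ((r / 2) *\<^sub>R z) = K (r *\<^sub>R z)"
        by (simp add: Zfield_def)
      then have e: "(r / 2) * frechet_derivative K (at (r *\<^sub>R z)) z = K (r *\<^sub>R z)"
        by (simp only: linear_cmul[OF lin] real_scaleR_def)
      have "((\<lambda>r. K (r *\<^sub>R z)) has_derivative (\<lambda>h. frechet_derivative K (at (r *\<^sub>R z)) (h *\<^sub>R z))) (at r)"
        by (rule has_derivative_compose[of "\<lambda>r. r *\<^sub>R z" _ r UNIV K])
          (auto intro!: derivative_eq_intros simp: dK[OF nz])
      moreover have "(\<lambda>h. frechet_derivative K (at (r *\<^sub>R z)) (h *\<^sub>R z)) = (*) (2 * K (r *\<^sub>R z) / r)"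
        using e r0 by (simp add: linear_cmul[OF lin] fun_eq_iff field_simps)
      ultimately have "((\<lambda>r. K (r *\<^sub>R z)) has_real_derivative 2 * K (r *\<^sub>R z) / r) (at r)"
        by (simp only: has_field_derivative_def)
      then have "((\<lambda>r. K (r *\<^sub>R z) / r\<^sup>2) has_real_derivative
          ((2 * K (r *\<^sub>R z) / r) * r\<^sup>2 - K (r *\<^sub>R z) * (2 * r)) / (r\<^sup>2 * r\<^sup>2)) (at r)"
        using r0 by (auto intro!: derivative_eq_intros simp: power2_eq_square)
      moreover have "(2 * K (r *\<^sub>R z) / r) * r\<^sup>2 - K (r *\<^sub>R z) * (2 * r) = 0"
        using r0 by (simp add: power2_eq_square)
      ultimately have "((\<lambda>r. K (r *\<^sub>R z) / r\<^sup>2) has_real_derivative 0) (at r)" by simp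
      then show ?thesis by (rule has_field_derivative_at_within)
    qed
    then obtain a where "\<And>r. r \<in> {0<..} \<Longrightarrow> K (r *\<^sub>R z) / r\<^sup>2 = a"
      using has_field_derivative_zero_constant[of "{0<..}" "\<lambda>r. K (r *\<^sub>R z) / r\<^sup>2"] by auto
    from this[of r] this[of 1] r show ?thesis by (simp add: field_simps)
  qed
  show "K = H"
  proof
    fix z :: "complex ^ 'n"
    show "K z = H z"
    proof (cases "z = 0")
      case True
      then show ?thesis using K by simp
    next
      case False
      have Hz: "H z > 0" by (rule H_pos[OF False])
      define r where "r = 1 / sqrt (H z)"
      have r: "r > 0" "r\<^sup>2 * H z = 1" using Hz by (simp_all add: r_def power_divide)
      have "r *\<^sub>R z \<in> {z. z \<noteq> 0 \<and> H z = 1}" using False r H_scale[OF r(1), of z] by simp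
      moreover have "{z. z \<noteq> 0 \<and> K z = 1} = {z. z \<noteq> 0 \<and> H z = 1}" using K by blast
      ultimately have "r *\<^sub>R z \<in> {z. z \<noteq> 0 \<and> K z = 1}" by (simp only:)
      then have "r\<^sup>2 * K z = r\<^sup>2 * H z" using hom[OF False r(1)] r(2) by simp
      then show ?thesis using r(1) by simp
    qed
  qed
qed

end

section \<open>Bounds for the Ruelle density and the Ruelle invariant\<close>

context linear_form_mean
begin

lemma q_powr_eq: "q x powr (- 1 / p - 1) = g x powr (1 + p)"
proof -
  have "- 1 / p * (1 + p) = - 1 / p - 1" using p_pos by (simp add: field_simps)
  then show ?thesis by (simp add: g_def powr_powr)
qed

lemma G_nth: "G x $ j = (\<Sum>c\<in>C. q x powr (- 1 / p - 1) * (c \<bullet> x) powr (- p - 1) * c $ j)"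
  by (simp add: G_def s_def sum_distrib_left mult.assoc)

lemma G_nonneg: "G x $ j \<ge> 0"
  unfolding G_nth by (intro sum_nonneg mult_nonneg_nonneg) (auto intro: less_imp_le C_pos)

text \<open>As \<open>g\<close> is at most each form, the weight of each form in \<open>G\<close> is
  at most 1. This bounds the density and so dominates the limit in the Ruelle invariant.\<close>

lemma G_le:
  assumes "x \<in> orthant" "x \<noteq> 0"
  shows "G x $ j \<le> (\<Sum>c\<in>C. c $ j)"
  unfolding G_nth
proof (rule sum_mono)
  fix c assume c: "c \<in> C"
  have cx: "c \<bullet> x > 0" by (rule inner_pos[OF c assms])
  have "q x powr (- 1 / p - 1) \<le> (c \<bullet> x) powr (1 + p)"
    unfolding q_powr_eq
    using g_le_inner[OF assms(1) c] g_pos[OF assms] p_pos by (intro powr_mono2) auto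
  then have "q x powr (- 1 / p - 1) * (c \<bullet> x) powr (- p - 1) \<le> (c \<bullet> x) powr (1 + p) * (c \<bullet> x) powr (- p - 1)"
    by (intro mult_right_mono) auto
  also have "\<dots> = 1" unfolding powr_add[symmetric] using cx by simp
  finally have "q x powr (- 1 / p - 1) * (c \<bullet> x) powr (- p - 1) * c $ j \<le> 1 * c $ j"
    using C_pos[OF c, of j] by (intro mult_right_mono) auto
  then show "q x powr (- 1 / p - 1) * (c \<bullet> x) powr (- p - 1) * c $ j \<le> c $ j" by simp
qed

text \<open>If one form supplies at least half of \<open>q\<close>, its weight in \<open>G\<close>
  is at least 2^(-1/p - 1), which is at least 1/4 for p at least 1.\<close>

lemma G_ge:
  assumes x: "x \<in> orthant" "x \<noteq> 0" and c: "c \<in> C" and q: "q x \<le> 2 * (c \<bullet> x) powr (- p)" and p1: "p \<ge> 1"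
  shows "G x $ j \<ge> c $ j / 4"
proof -
  have cx: "c \<bullet> x > 0" by (rule inner_pos[OF c x])
  have qp: "q x > 0" by (rule q_pos) (rule inner_pos[OF _ x])
  have e: "- p * (- 1 / p - 1) + (- p - 1) = 0" using p_pos by (simp add: field_simps)
  have "(2 :: real) powr (- 2) \<le> 2 powr (- 1 / p - 1)"
    using p1 p_pos by (intro powr_mono) (auto simp: field_simps)
  then have "1 / 4 \<le> (2 :: real) powr (- 1 / p - 1)" by (simp add: powr_minus powr_numeral)
  also have "\<dots> = 2 powr (- 1 / p - 1) * ((c \<bullet> x) powr (- p * (- 1 / p - 1)) * (c \<bullet> x) powr (- p - 1))"
    unfolding powr_add[symmetric] e using cx by simp
  also have "\<dots> = (2 * (c \<bullet> x) powr (- p)) powr (- 1 / p - 1) * (c \<bullet> x) powr (- p - 1)"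
    by (simp add: powr_mult powr_powr)
  also have "\<dots> \<le> q x powr (- 1 / p - 1) * (c \<bullet> x) powr (- p - 1)"
    using q qp p_pos by (intro mult_right_mono powr_mono2') (auto simp: field_simps)
  finally have "1 / 4 * c $ j \<le> q x powr (- 1 / p - 1) * (c \<bullet> x) powr (- p - 1) * c $ j"
    using C_pos[OF c, of j] by (intro mult_right_mono) auto
  also have "\<dots> \<le> G x $ j"
    unfolding G_nth
    by (rule member_le_sum[OF c _ fin]) (auto intro!: mult_nonneg_nonneg intro: less_imp_le C_pos)
  finally show ?thesis by simp
qed

lemma ruelle_density_region:
  assumes "z \<noteq> 0"
  shows "ruelle_density (toric_domain region) z = (\<Sum>j\<in>UNIV. G (moment_map z) $ j)"
proof -
  interpret toric: toric_hamiltonian "toric_domain region" g G L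
  proof
    fix z :: "complex ^ 'n" assume z: "z \<noteq> 0"
    show "canonical_hamiltonian (toric_domain region) z = g (moment_map z)"
      by (simp add: canonical_hamiltonian_region)
    show "(g has_derivative (\<lambda>h. G (moment_map z) \<bullet> h)) (at (moment_map z))"
      by (rule g_deriv) (rule inner_moment_pos[OF z])
    show "(G has_derivative L (moment_map z)) (at (moment_map z))"
      by (rule G_deriv) (rule inner_moment_pos[OF z])
    show "L (moment_map z) u \<bullet> v = u \<bullet> L (moment_map z) v" for u v by (rule L_sym)
  qed
  show ?thesis by (rule toric.ruelle_density_eq[OF assms])
qed

text \<open>Dominated convergence identifies the limit with the integral over the punctured domain;
  the density is nonnegative, so the part over \<open>B\<close> bounds it from below.\<close>

lemma Ruelle_invariant_ge:
  assumes B: "B \<in> sets lebesgue" "B \<subseteq> {z. z \<noteq> 0 \<and> H z \<le> 1}"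
    and a: "\<And>z. z \<in> B \<Longrightarrow> a \<le> (\<Sum>j\<in>UNIV. G (moment_map z) $ j)"
  shows "Ruelle_invariant (toric_domain region) \<ge> fact CARD('n) * (a * measure lebesgue B)"
proof -
  define \<rho> where "\<rho> z = (\<Sum>j\<in>UNIV. G (moment_map z) $ j)" for z
  \<comment> \<open>The density formula holds off the origin; the value 0 there gives a function
    that is bounded and Borel everywhere.\<close>
  define \<rho>0 where "\<rho>0 z = indicator (- {0}) z *\<^sub>R \<rho> z" for z
  define M where "M = (\<Sum>j\<in>UNIV. \<Sum>c\<in>C. c $ j)"
  define S where "S E = {z. z \<noteq> 0 \<and> E \<le> H z \<and> H z \<le> 1}" for E
  define S0 where "S0 = {z. z \<noteq> 0 \<and> H z \<le> 1}"
  define f where "f E z = indicator (S E) z * \<rho>0 z" for E z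
  define f0 where "f0 z = indicator S0 z * \<rho>0 z" for z
  have \<rho>0: "0 \<le> \<rho>0 z \<and> \<rho>0 z \<le> M" for z
  proof (cases "z = 0")
    case True
    have "0 \<le> M" unfolding M_def by (intro sum_nonneg) (auto intro: less_imp_le C_pos)
    then show ?thesis using True by (simp add: \<rho>0_def)
  next
    case False
    then show ?thesis unfolding \<rho>0_def \<rho>_def M_def
      by (auto intro!: sum_nonneg sum_mono G_nonneg G_le moment_map_in_orthant)
  qed
  have Hb: "H \<in> borel_measurable borel"
  proof -
    have "(\<lambda>z. indicator (- {0}) z *\<^sub>R H z) \<in> borel_measurable borel"
      by (rule borel_measurable_continuous_on_indicator[OF _ continuous_on_H]) simp
    moreover have "(\<lambda>z. indicator (- {0}) z *\<^sub>R H z) = H" by (auto simp: indicator_def fun_eq_iff)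
    ultimately show ?thesis by simp
  qed
  have \<rho>b: "\<rho>0 \<in> borel_measurable borel"
    unfolding \<rho>0_def
  proof (rule borel_measurable_continuous_on_indicator)
    show "- {0} \<in> sets (borel :: (complex ^ 'n) measure)" by simp
    have "isCont G x" if "x \<in> moment_map ` (- {0})" for x
      using that G_deriv inner_moment_pos by (force intro: has_derivative_continuous)
    then have "continuous_on (moment_map ` (- {0})) G"
      by (simp add: continuous_at_imp_continuous_on)
    then have "continuous_on (- {0}) (\<lambda>z. G (moment_map z))"
      by (rule continuous_on_compose2[OF _ continuous_on_moment_map]) auto
    then show "continuous_on (- {0}) \<rho>"
      unfolding \<rho>_def by (intro continuous_intros)
  qed
  have Sb: "S E \<in> sets borel" "S0 \<in> sets borel" for E
  proof -
    note [measurable] = Hb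
    show "S E \<in> sets borel" "S0 \<in> sets borel" unfolding S_def S0_def by measurable
  qed
  have fb: "f E \<in> borel_measurable lebesgue" "f0 \<in> borel_measurable lebesgue" for E
  proof -
    note [measurable] = \<rho>b Sb
    have "f E \<in> borel_measurable lborel" "f0 \<in> borel_measurable lborel"
      unfolding f_def f0_def by measurable
    then show "f E \<in> borel_measurable lebesgue" "f0 \<in> borel_measurable lebesgue"
      by (simp_all add: measurable_completion)
  qed
  define w where "w z = indicator {z. H z \<le> 1} z * M" for z
  have wi: "integrable lebesgue w"
  proof -
    note m = lmeasurable_compact[OF compact_sublevel]
    have "integrable lebesgue (indicat_real {z. H z \<le> 1})"
      by (rule integrable_real_indicator[OF fmeasurableD[OF m]])
        (use fmeasurableD2[OF m] in \<open>simp only: infinity_ennreal_def less_top not_False_eq_True\<close>)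
    then show ?thesis unfolding w_def by (rule integrable_mult_left)
  qed
  have fw: "norm (f E z) \<le> w z" "norm (f0 z) \<le> w z" for E z
    using \<rho>0[of z] by (auto simp: f_def f0_def w_def S_def S0_def indicator_def)
  have f0i: "integrable lebesgue f0"
    by (rule Bochner_Integration.integrable_bound[OF wi fb(2)]) (rule AE_I2, rule order_trans[OF fw(2)], simp)
  have lim: "((\<lambda>E. fact CARD('n) * (LINT z|lebesgue. f E z)) \<longlongrightarrow> fact CARD('n) * (LINT z|lebesgue. f0 z)) (at_right 0)"
  proof (intro tendsto_mult tendsto_const tendsto_at_right_sequentially[of 0 1])
    fix e :: "nat \<Rightarrow> real" assume e: "\<And>n. 0 < e n" "e \<longlonglongrightarrow> 0"
    show "(\<lambda>n. LINT z|lebesgue. f (e n) z) \<longlonglongrightarrow> (LINT z|lebesgue. f0 z)"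
    proof (rule integral_dominated_convergence[OF fb(2) fb(1) wi])
      show "AE z in lebesgue. (\<lambda>n. f (e n) z) \<longlonglongrightarrow> f0 z"
      proof (rule AE_I2)
        fix z :: "complex ^ 'n"
        show "(\<lambda>n. f (e n) z) \<longlonglongrightarrow> f0 z"
        proof (cases "z = 0")
          case False
          \<comment> \<open>At a fixed nonzero point the lower cutoff eventually drops below
            \<open>H z\<close>, so the sequence is eventually constant.\<close>
          have "\<forall>\<^sub>F n in sequentially. e n < H z"
            using order_tendstoD(2)[OF e(2) H_pos[OF False]] .
          then have "\<forall>\<^sub>F n in sequentially. f (e n) z = f0 z"
            by eventually_elim (simp add: f_def f0_def S_def S0_def indicator_def)
          then show ?thesis by (rule tendsto_eventually)
        qed (simp add: f_def f0_def S_def S0_def)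
      qed
      show "AE z in lebesgue. norm (f (e n) z) \<le> w z" for n using fw(1) by simp
    qed
  qed simp
  have "(LINT z : S E | lebesgue. ruelle_density (toric_domain region) z) = (LINT z|lebesgue. f E z)" for E
    unfolding set_lebesgue_integral_def f_def
    by (intro Bochner_Integration.integral_cong refl)
      (auto simp: indicator_def S_def \<rho>0_def \<rho>_def ruelle_density_region)
  then have "Ruelle_invariant (toric_domain region) =
      Lim (at_right 0) (\<lambda>E. fact CARD('n) * (LINT z|lebesgue. f E z))"
    unfolding Ruelle_invariant_def canonical_hamiltonian_region S_def by simp
  also have "\<dots> = fact CARD('n) * (LINT z|lebesgue. f0 z)"
    by (rule tendsto_Lim[OF _ lim]) simp
  finally have R: "Ruelle_invariant (toric_domain region) = fact CARD('n) * (LINT z|lebesgue. f0 z)" .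
  have "(LINT z|lebesgue. indicator B z * a) \<le> (LINT z|lebesgue. f0 z)"
  proof (rule integral_mono'[OF f0i])
    show "indicator B z * a \<le> f0 z" for z
    proof (cases "z \<in> B")
      case True
      then have "z \<noteq> 0" "z \<in> S0" using B(2) by (auto simp: S0_def)
      then show ?thesis using a[OF True] True by (simp add: f0_def \<rho>0_def \<rho>_def)
    qed (use \<rho>0[of z] in \<open>simp add: f0_def\<close>)
    show "0 \<le> f0 z" for z using \<rho>0[of z] by (simp add: f0_def)
  qed
  also have "(LINT z|lebesgue. indicator B z * a) = a * measure lebesgue B"
    using B(1) by simp
  finally show ?thesis unfolding R by (intro mult_left_mono) simp_all
qed

end

section \<open>Approximation from outside by linear forms\<close>

text \<open>In direction \<open>p\<close> the defining function has derivative
  \<open>\<kappa>\<close> n . p = 2 \<open>\<kappa>\<close> > 0, so every ray crosses the frontier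
  outward.\<close>

lemma radial_frontier:
  assumes X: "star_shaped_domain (toric_domain \<Omega>)" and K: "convex (orthant - \<Omega>)"
    and p: "p \<in> frontier (toric_domain \<Omega>)"
  obtains d where "d > 0" "\<And>h. 0 < h \<Longrightarrow> h < d \<Longrightarrow> (1 + h) *\<^sub>R p \<notin> toric_domain \<Omega>"
    "\<And>h. 0 < h \<Longrightarrow> h < d \<Longrightarrow> (1 - h) *\<^sub>R p \<in> toric_domain \<Omega>"
proof (rule reeb_field_concave_toric[OF X K p])
  fix n U f \<kappa>
  assume np: "n \<bullet> p = 2" and U: "open U" "p \<in> U" and fp: "f p = (0::real)" and \<kappa>: "\<kappa> > 0"
    and df: "(f has_derivative (\<lambda>h. \<kappa> * (n \<bullet> h))) (at p)" and XU: "toric_domain \<Omega> \<inter> U = {x \<in> U. f x \<le> 0}"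
  have XU': "x \<in> toric_domain \<Omega> \<longleftrightarrow> f x \<le> 0" if "x \<in> U" for x
  proof -
    have "x \<in> toric_domain \<Omega> \<inter> U \<longleftrightarrow> x \<in> {x \<in> U. f x \<le> 0}" by (simp only: XU)
    then show ?thesis using that by simp
  qed
  have "((\<lambda>r. f (r *\<^sub>R p)) has_derivative (\<lambda>h. \<kappa> * (n \<bullet> (h *\<^sub>R p)))) (at 1)"
    by (rule has_derivative_compose[of "\<lambda>r. r *\<^sub>R p" _ 1 UNIV f])
      (auto intro!: derivative_eq_intros simp: df)
  moreover have "(\<lambda>h. \<kappa> * (n \<bullet> (h *\<^sub>R p))) = (*) (2 * \<kappa>)"
    by (simp add: np fun_eq_iff)
  ultimately have d: "((\<lambda>r. f (r *\<^sub>R p)) has_real_derivative 2 * \<kappa>) (at 1)"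
    by (simp only: has_field_derivative_def)
  obtain d1 where d1: "d1 > 0" "\<And>h. h > 0 \<Longrightarrow> h < d1 \<Longrightarrow> f (1 *\<^sub>R p) < f ((1 + h) *\<^sub>R p)"
    using has_real_derivative_pos_inc_right[OF d] \<kappa> by auto
  obtain d2 where d2: "d2 > 0" "\<And>h. h > 0 \<Longrightarrow> h < d2 \<Longrightarrow> f ((1 - h) *\<^sub>R p) < f (1 *\<^sub>R p)"
    using has_real_derivative_pos_inc_left[OF d] \<kappa> by auto
  have "open ((\<lambda>r::real. r *\<^sub>R p) -` U)"
    by (intro open_vimage U continuous_intros)
  then obtain d3 where d3: "d3 > 0" "\<And>r. \<bar>r - 1\<bar> < d3 \<Longrightarrow> r *\<^sub>R p \<in> U"
    using U(2) unfolding open_dist by (auto simp: dist_real_def dest!: bspec[of _ _ 1])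
  show ?thesis
  proof (rule that[of "min d1 (min d2 d3)"])
    show "min d1 (min d2 d3) > 0" using d1 d2 d3 by simp
    fix h :: real assume h: "0 < h" "h < min d1 (min d2 d3)"
    show "(1 + h) *\<^sub>R p \<notin> toric_domain \<Omega>"
      using XU'[OF d3(2)[of "1 + h"]] d1(2)[of h] h fp by simp
    show "(1 - h) *\<^sub>R p \<in> toric_domain \<Omega>"
      using XU'[OF d3(2)[of "1 - h"]] d2(2)[of h] h fp by simp
  qed
qed

text \<open>Otherwise take the last non-interior parameter \<open>u\<close> before \<open>e\<close>.
  By closedness it gives a frontier point, beyond which the ray would have to be outside, although
  by maximality it is interior there.\<close>

lemma radial_interior_aux:
  assumes X: "star_shaped_domain (toric_domain \<Omega>)" and K: "convex (orthant - \<Omega>)"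
    and e: "e *\<^sub>R z \<in> interior (toric_domain \<Omega>)" and t0: "0 \<le> t" and t: "t \<le> e"
  shows "t *\<^sub>R z \<in> interior (toric_domain \<Omega>)"
proof (rule ccontr)
  let ?X = "toric_domain \<Omega>"
  assume out: "t *\<^sub>R z \<notin> interior ?X"
  let ?B = "{t..e} \<inter> (\<lambda>u. u *\<^sub>R z) -` (- interior ?X)"
  have "closed ((\<lambda>u. u *\<^sub>R z) -` (- interior ?X))"
    by (intro closed_vimage continuous_intros) auto
  then have "compact ?B" by (intro compact_Int_closed) auto
  moreover have "t \<in> ?B" using out t by simp
  ultimately obtain u where u: "u \<in> ?B" "\<And>v. v \<in> ?B \<Longrightarrow> v \<le> u"
    using compact_attains_sup[of ?B] by blast
  then have "u \<noteq> e" using e by auto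
  then have ue: "u < e" "t \<le> u" using u(1) by auto
  have inside: "v *\<^sub>R z \<in> interior ?X" if "u < v" "v \<le> e" for v
    using u(2)[of v] that ue by auto
  have clX: "closed ?X" using X by (simp add: star_shaped_domain_def compact_imp_closed)
  have lim: "(\<lambda>n. (u + (e - u) / real (Suc n)) *\<^sub>R z) \<longlonglongrightarrow> (u + 0) *\<^sub>R z"
    by (intro tendsto_intros LIMSEQ_Suc lim_const_over_n)
  have "u *\<^sub>R z \<in> ?X"
  proof -
    have "(u + (e - u) / real (Suc n)) *\<^sub>R z \<in> ?X" for n
    proof -
      have "(e - u) / real (Suc n) \<le> e - u" "(e - u) / real (Suc n) > 0"
        using ue by (simp_all add: divide_le_eq)
      then have "(u + (e - u) / real (Suc n)) *\<^sub>R z \<in> interior ?X" by (intro inside) auto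
      then show ?thesis using interior_subset by blast
    qed
    from closed_sequentially[OF clX this lim] show ?thesis by simp
  qed
  then have fr: "u *\<^sub>R z \<in> frontier ?X"
    using u(1) closure_subset by (auto simp: frontier_def)
  have "u \<noteq> 0"
  proof
    assume "u = 0"
    then have "0 \<in> frontier ?X" using fr by simp
    then show False using X by (simp add: star_shaped_domain_def frontier_def)
  qed
  show False
  proof (rule radial_frontier[OF X K fr])
    fix d :: real assume d: "d > 0"
      and outw: "\<And>h. 0 < h \<Longrightarrow> h < d \<Longrightarrow> (1 + h) *\<^sub>R (u *\<^sub>R z) \<notin> ?X"
      and inw: "\<And>h. 0 < h \<Longrightarrow> h < d \<Longrightarrow> (1 - h) *\<^sub>R (u *\<^sub>R z) \<in> ?X"
    show False
    proof -
      have u0: "u > 0" using \<open>u \<noteq> 0\<close> ue t0 by simp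
      define h where "h = min (d/2) ((e - u) / u)"
      have "h > 0" "h < d" "h \<le> (e - u) / u" using d u0 ue by (auto simp: h_def)
      moreover from this have "h * u \<le> e - u" using u0 by (simp add: pos_le_divide_eq)
      ultimately have "(u + h * u) *\<^sub>R z \<in> interior ?X" using u0 by (intro inside) auto
      moreover have "(u + h * u) *\<^sub>R z = (1 + h) *\<^sub>R (u *\<^sub>R z)" by (simp add: algebra_simps)
      ultimately have "(1 + h) *\<^sub>R (u *\<^sub>R z) \<in> interior ?X" by simp
      then show False using outw[OF \<open>h > 0\<close> \<open>h < d\<close>] interior_subset[of ?X] by blast
    qed
  qed
qed

text \<open>A frontier point is moved inward a little, where it must be interior, and
  \<open>radial_interior_aux\<close> covers the rest of the segment.\<close>

lemma radial_interior:
  assumes X: "star_shaped_domain (toric_domain \<Omega>)" and K: "convex (orthant - \<Omega>)"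
    and z: "z \<in> toric_domain \<Omega>" and t: "0 \<le> t" "t < 1"
  shows "t *\<^sub>R z \<in> interior (toric_domain \<Omega>)"
proof (cases "z \<in> interior (toric_domain \<Omega>)")
  case True
  then show ?thesis using radial_interior_aux[OF X K, of 1 z t] t by simp
next
  case False
  let ?X = "toric_domain \<Omega>"
  have fr: "w \<in> frontier ?X" if "w \<in> ?X" "w \<notin> interior ?X" for w
    using that closure_subset by (auto simp: frontier_def)
  show ?thesis
  proof (rule radial_frontier[OF X K fr[OF z False]])
    fix d :: real assume d: "d > 0" and inw: "\<And>h. 0 < h \<Longrightarrow> h < d \<Longrightarrow> (1 - h) *\<^sub>R z \<in> ?X"
    define h0 where "h0 = min (d/2) (1 - t)"
    have h0: "h0 > 0" "h0 < d" "t \<le> 1 - h0" using d t by (auto simp: h0_def)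
    \<comment> \<open>A frontier point here would have points slightly further out on the same ray
      outside the domain, but those are still of the form covered by \<open>inw\<close>.\<close>
    have "(1 - h0) *\<^sub>R z \<in> interior ?X"
    proof (rule ccontr)
      assume "(1 - h0) *\<^sub>R z \<notin> interior ?X"
      from fr[OF inw[OF h0(1,2)] this] show False
      proof (rule radial_frontier[OF X K])
        fix d' :: real assume d': "d' > 0"
          and outw: "\<And>h. 0 < h \<Longrightarrow> h < d' \<Longrightarrow> (1 + h) *\<^sub>R ((1 - h0) *\<^sub>R z) \<notin> ?X"
        define h where "h = min (d'/2) (h0/2)"
        have h: "h > 0" "h < d'" "h \<le> h0 / 2" using d' h0 by (auto simp: h_def)
        have "h * (1 - h0) \<le> h" "0 \<le> h * (1 - h0)" using h h0 t by (simp_all add: mult_left_le)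
        then have "0 < h0 - h * (1 - h0)" "h0 - h * (1 - h0) < d" using h h0 by linarith+
        from inw[OF this] have "(1 - (h0 - h * (1 - h0))) *\<^sub>R z \<in> ?X" .
        moreover have "(1 - (h0 - h * (1 - h0))) *\<^sub>R z = (1 + h) *\<^sub>R ((1 - h0) *\<^sub>R z)"
          by (simp add: algebra_simps)
        ultimately show False using outw[OF h(1,2)] by simp
      qed
    qed
    then show ?thesis by (rule radial_interior_aux[OF X K _ t(1) h0(3)])
  qed
qed

lemma moment_map_image_toric_domain:
  assumes "\<Omega> \<subseteq> orthant"
  shows "moment_map ` toric_domain \<Omega> = \<Omega>"
proof
  show "moment_map ` toric_domain \<Omega> \<subseteq> \<Omega>" by (auto simp: toric_domain_def)
  show "\<Omega> \<subseteq> moment_map ` toric_domain \<Omega>"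
  proof
    fix x assume x: "x \<in> \<Omega>"
    have "moment_map (moment_lift (\<chi> j. 1) x) = x"
      by (rule moment_map_moment_lift) (use x assms in auto)
    then show "x \<in> moment_map ` toric_domain \<Omega>"
      using x by (intro image_eqI[of _ _ "moment_lift (\<chi> j. 1) x"]) (auto simp: toric_domain_def)
  qed
qed

text \<open>By \<open>radial_interior\<close> a point of \<open>\<Omega>\<close> avoids the dilated
  closed complement, and a hyperplane separates the two. Far axis points in the complement make its
  coefficients nonnegative; a small multiple of the sum of the coordinates makes them
  positive.\<close>

lemma separating_linear_form:
  fixes \<Omega> :: "(real ^ 'n) set"
  assumes \<Omega>: "smooth_star_shaped_region \<Omega>" "concave_region \<Omega>" and x: "x \<in> \<Omega>" and s: "s > (1::real)"
  obtains c where "\<And>j. c $ j > 0" "c \<bullet> x < 1" "\<And>y. y \<in> orthant - \<Omega> \<Longrightarrow> c \<bullet> (s *\<^sub>R y) > 1"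
proof -
  let ?X = "toric_domain \<Omega>" and ?K = "orthant - \<Omega>"
  have X: "star_shaped_domain ?X" and K: "convex ?K" and sub: "\<Omega> \<subseteq> orthant"
    using \<Omega> by (auto simp: smooth_star_shaped_region_def concave_region_def)
  have bd: "bounded ?X" using X by (simp add: star_shaped_domain_def compact_imp_bounded)
  have xo: "x \<in> orthant" using x sub by blast
  have "x \<in> moment_map ` ?X" using moment_map_image_toric_domain[OF sub] x by simp
  then obtain z where z: "z \<in> ?X" "moment_map z = x" by (elim imageE) simp
  define D where "D = (\<lambda>y. s *\<^sub>R y) ` closure ?K"
  have "x \<notin> D"
  proof
    assume "x \<in> D"
    then obtain y where y: "y \<in> closure ?K" "x = s *\<^sub>R y" by (auto simp: D_def)
    \<comment> \<open>The square root appears because the moment map is quadratic: this point lies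
      over \<open>x / s\<close>.\<close>
    have "(1 / sqrt s) *\<^sub>R z \<in> interior ?X"
      using s by (intro radial_interior[OF X K z(1)]) auto
    then have "moment_map ((1 / sqrt s) *\<^sub>R z) \<notin> closure ?K" by (simp add: interior_toric_domain_iff)
    moreover have "moment_map ((1 / sqrt s) *\<^sub>R z) = y"
      using s by (simp add: moment_map_scaleR z(2) y(2) power_divide)
    ultimately show False using y(1) by simp
  qed
  moreover have "closed D" unfolding D_def by (intro closed_scaling) auto
  moreover have "convex D" unfolding D_def by (intro convex_scaling convex_closure K)
  ultimately obtain a b where ab: "a \<bullet> x < b" "\<And>y. y \<in> D \<Longrightarrow> a \<bullet> y > b"
    using separating_hyperplane_closed_point[of D x] by blast
  have KD: "s *\<^sub>R y \<in> D" if "y \<in> ?K" for y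
    using that closure_subset[of ?K] by (auto simp: D_def)
  obtain M0 where M0: "M0 > 0" "\<And>M j. M \<ge> M0 \<Longrightarrow> axis j M \<in> ?K"
    using axis_notin_region[OF bd] by metis
  have a: "a $ j \<ge> 0" for j
  proof (rule ccontr)
    assume "\<not> a $ j \<ge> 0"
    then have neg: "a $ j < 0" by simp
    define M where "M = max M0 ((\<bar>b\<bar> + 1) / (s * (- a $ j)))"
    have "M \<ge> (\<bar>b\<bar> + 1) / (s * (- a $ j))" by (simp add: M_def)
    moreover have "s * (- a $ j) > 0" using neg s by (intro mult_pos_pos) auto
    ultimately have "\<bar>b\<bar> + 1 \<le> M * (s * (- a $ j))" by (simp only: pos_divide_le_eq)
    moreover have "a \<bullet> (s *\<^sub>R axis j M) > b"
      by (rule ab(2)[OF KD[OF M0(2)]]) (simp add: M_def)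
    then have "b < M * (s * (a $ j))" by (simp add: inner_axis mult_ac)
    ultimately show False by simp
  qed
  have ax: "a \<bullet> y \<ge> 0" if "y \<in> orthant" for y
    using that a unfolding inner_vec_def by (intro sum_nonneg) (simp add: orthant_def)
  have b: "b > 0" using ab(1) ax[OF xo] by linarith
  define S where "S = (\<Sum>j\<in>UNIV. x $ j)"
  have S: "S \<ge> 0" unfolding S_def using xo by (intro sum_nonneg) (simp add: orthant_def)
  \<comment> \<open>At most half of the slack at \<open>x\<close> is spent on the perturbation;
    \<open>1 + S\<close> avoids dividing by zero at the origin.\<close>
  define \<eta> where "\<eta> = (1 - a \<bullet> x / b) / (2 * (1 + S))"
  have r: "1 - a \<bullet> x / b > 0" using ab(1) b by simp
  then have \<eta>: "\<eta> > 0" using S by (simp add: \<eta>_def)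
  define c where "c = (\<chi> j. a $ j / b + \<eta>)"
  have cy: "c \<bullet> y = a \<bullet> y / b + \<eta> * (\<Sum>j\<in>UNIV. y $ j)" for y
    by (simp add: c_def inner_vec_def algebra_simps sum.distrib sum_distrib_left sum_divide_distrib)
  show ?thesis
  proof
    show "c $ j > 0" for j using a[of j] b \<eta> by (simp add: c_def add_nonneg_pos)
    have "\<eta> * S \<le> \<eta> * (1 + S)" using \<eta> by simp
    also have "\<dots> = (1 - a \<bullet> x / b) / 2" using S by (simp add: \<eta>_def field_simps)
    finally have "\<eta> * S \<le> (1 - a \<bullet> x / b) / 2" .
    moreover have "t + e < 1" if "e \<le> (1 - t) / 2" "1 - t > 0" for t e :: real
      using that by (simp add: field_simps)
    ultimately show "c \<bullet> x < 1" unfolding cy S_def[symmetric] using r by blast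
    fix y assume y: "y \<in> ?K"
    have "a \<bullet> (s *\<^sub>R y) / b > 1" using ab(2)[OF KD[OF y]] b by simp
    moreover have "(\<Sum>j\<in>UNIV. (s *\<^sub>R y) $ j) \<ge> 0"
      using y s by (intro sum_nonneg) (simp add: orthant_def)
    ultimately show "c \<bullet> (s *\<^sub>R y) > 1" unfolding cy using \<eta> by (simp add: add_pos_nonneg add_strict_increasing2 less_le_trans)
  qed
qed

text \<open>The open half-spaces from \<open>separating_linear_form\<close> cover the compact
  region.\<close>

lemma finite_linear_forms:
  fixes \<Omega> :: "(real ^ 'n) set"
  assumes \<Omega>: "smooth_star_shaped_region \<Omega>" "concave_region \<Omega>" and s: "s > (1::real)"
  obtains C where "finite C" "\<And>c j. c \<in> C \<Longrightarrow> c $ j > 0" "\<And>x. x \<in> \<Omega> \<Longrightarrow> \<exists>c\<in>C. c \<bullet> x < 1"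
    "\<And>c y. c \<in> C \<Longrightarrow> y \<in> orthant - \<Omega> \<Longrightarrow> c \<bullet> (s *\<^sub>R y) > 1"
proof -
  have sub: "\<Omega> \<subseteq> orthant" and cpt: "compact (toric_domain \<Omega>)"
    using \<Omega> by (auto simp: smooth_star_shaped_region_def star_shaped_domain_def)
  have "compact \<Omega>"
    using compact_continuous_image[OF continuous_on_moment_map cpt] moment_map_image_toric_domain[OF sub] by simp
  have "\<forall>x\<in>\<Omega>. \<exists>c. (\<forall>j. c $ j > 0) \<and> c \<bullet> x < 1 \<and> (\<forall>y\<in>orthant - \<Omega>. c \<bullet> (s *\<^sub>R y) > 1)"
  proof
    fix x assume "x \<in> \<Omega>"
    from separating_linear_form[OF \<Omega> this s]
    show "\<exists>c. (\<forall>j. c $ j > 0) \<and> c \<bullet> x < 1 \<and> (\<forall>y\<in>orthant - \<Omega>. c \<bullet> (s *\<^sub>R y) > 1)" by metis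
  qed
  then obtain c where c: "\<And>x. x \<in> \<Omega> \<Longrightarrow> (\<forall>j. c x $ j > 0) \<and> c x \<bullet> x < 1 \<and> (\<forall>y\<in>orthant - \<Omega>. c x \<bullet> (s *\<^sub>R y) > 1)"
    by metis
  obtain F where F: "F \<subseteq> \<Omega>" "finite F" "\<Omega> \<subseteq> (\<Union>x\<in>F. {y. c x \<bullet> y < 1})"
  proof (rule compactE_image[OF \<open>compact \<Omega>\<close>, of \<Omega> "\<lambda>x. {y. c x \<bullet> y < 1}"])
    show "open {y. c x \<bullet> y < 1}" for x by (rule open_halfspace_lt)
    show "\<Omega> \<subseteq> (\<Union>x\<in>\<Omega>. {y. c x \<bullet> y < 1})" using c by blast
  qed
  show ?thesis
    by (rule that[of "c ` F"]) (use F c in blast)+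
qed

text \<open>Each complex coordinate contributes two real sides of equal length, hence the
  square.\<close>

lemma measure_cube_box:
  fixes l u :: "'n::finite \<Rightarrow> real"
  assumes "\<And>j. l j \<le> u j"
  shows "measure lebesgue (cbox (\<chi> j. Complex (l j) (l j)) (\<chi> j. Complex (u j) (u j))) = (\<Prod>j\<in>UNIV. (u j - l j)\<^sup>2)"
    (is "measure lebesgue (cbox ?a ?b) = _")
proof -
  have B: "(Basis :: (complex ^ 'n) set) = (\<lambda>(j, v). axis j v) ` (UNIV \<times> Basis)"
    by (auto simp: Basis_vec_def)
  have inj: "inj_on (\<lambda>(j, v). axis j v :: complex ^ 'n) (UNIV \<times> Basis)"
    by (rule inj_onI) (auto simp: axis_eq_axis)
  have comp: "?b \<bullet> axis j v - ?a \<bullet> axis j v = u j - l j" if "v \<in> Basis" for j and v :: complex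
    using that by (auto simp: inner_axis Basis_complex_def inner_complex_def)
  have "measure lebesgue (cbox ?a ?b) = (\<Prod>i\<in>Basis. ?b \<bullet> i - ?a \<bullet> i)"
  proof -
    have "\<forall>i\<in>Basis. ?a \<bullet> i \<le> ?b \<bullet> i"
    proof
      fix i :: "complex ^ 'n" assume "i \<in> Basis"
      then obtain j v where i: "i = axis j v" "v \<in> Basis" by (auto simp: Basis_vec_def)
      show "?a \<bullet> i \<le> ?b \<bullet> i" unfolding i(1) using comp[OF i(2), of j] assms[of j] by linarith
    qed
    from content_cbox[OF this] show ?thesis by simp
  qed
  also have "\<dots> = (\<Prod>(j, v)\<in>UNIV \<times> Basis. ?b \<bullet> axis j v - ?a \<bullet> axis j v)"
    unfolding B by (subst prod.reindex[OF inj]) (simp add: case_prod_beta comp_def)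
  also have "\<dots> = (\<Prod>j\<in>UNIV. \<Prod>v\<in>Basis. ?b \<bullet> axis j v - ?a \<bullet> axis j v)"
    by (simp add: prod.cartesian_product)
  also have "\<dots> = (\<Prod>j\<in>UNIV. \<Prod>v\<in>(Basis :: complex set). u j - l j)"
    by (intro prod.cong refl comp)
  finally show ?thesis by simp
qed

lemma mem_cube_box:
  "z \<in> cbox (\<chi> j. Complex (l j) (l j)) (\<chi> j. Complex (u j) (u j)) \<longleftrightarrow>
     (\<forall>j. l j \<le> Re (z $ j) \<and> Re (z $ j) \<le> u j \<and> l j \<le> Im (z $ j) \<and> Im (z $ j) \<le> u j)"
  by (simp add: mem_box Basis_vec_def inner_axis Basis_complex_def inner_complex_def) blast

text \<open>The constants form a chain: the dilation \<open>s\<close> fixes the forms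
  \<open>C0\<close>, these fix \<open>p\<close>; the length \<open>l\<close> depends on
  \<open>s\<close> and \<open>C\<close>, \<open>\<eta>\<close> on \<open>l\<close>, and the
  thickness \<open>\<delta>\<close> comes last, when the volume of the spike is known up to the
  factor \<open>\<delta>\<close>.\<close>

theorem proposition1p18:
  fixes \<Omega> :: "(real ^ 'n) set" and C \<epsilon> :: real
  assumes "CARD('n) \<ge> 2"
    and "smooth_star_shaped_region \<Omega>"
    and "concave_region \<Omega>"
    and "C > 0" and "\<epsilon> > 0"
  shows "\<exists>\<Omega>'. smooth_star_shaped_region \<Omega>' \<and> concave_region \<Omega>' \<and> \<Omega> \<subseteq> \<Omega>' \<and>
           measure lebesgue (toric_domain \<Omega>) \<le> measure lebesgue (toric_domain \<Omega>') \<and>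
           measure lebesgue (toric_domain \<Omega>') \<le> measure lebesgue (toric_domain \<Omega>) + \<epsilon> \<and>
           Ruelle_invariant (toric_domain \<Omega>') \<ge> C \<and>
           min_period (toric_domain \<Omega>) \<le> min_period (toric_domain \<Omega>')"
proof -
  let ?X = "toric_domain \<Omega>" and ?N = "CARD('n)"
  define V where "V = measure lebesgue ?X"
  have N2: "?N \<ge> 2" and \<Omega>: "smooth_star_shaped_region \<Omega>" "concave_region \<Omega>" and C: "C > 0" and \<epsilon>: "\<epsilon> > 0"
    using assms by auto
  have X: "star_shaped_domain ?X" and sub: "\<Omega> \<subseteq> orthant" and K: "convex (orthant - \<Omega>)"
    using \<Omega> by (auto simp: smooth_star_shaped_region_def concave_region_def)
  have cpt: "compact ?X" using X by (simp add: star_shaped_domain_def)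
  \<comment> \<open>Half of the volume allowance goes to the dilation by \<open>s\<close>, the other
    half to the spike.\<close>
  have "((\<lambda>s. s ^ (2 * ?N) * V) \<longlongrightarrow> 1 ^ (2 * ?N) * V) (at_right 1)" by (intro tendsto_intros)
  then have "\<forall>\<^sub>F s in at_right 1. s ^ (2 * ?N) * V < V + \<epsilon> / 2"
    using \<epsilon> by (intro order_tendstoD(2)) auto
  moreover have "\<forall>\<^sub>F s in at_right 1. (1::real) < s" by (simp add: eventually_at_right_less)
  ultimately have "\<forall>\<^sub>F s in at_right 1. (1::real) < s \<and> s ^ (2 * ?N) * V < V + \<epsilon> / 2"
    by eventually_elim simp
  then obtain s :: real where s: "s > 1" "s ^ (2 * ?N) * V < V + \<epsilon> / 2"
    using eventually_happens trivial_limit_at_right_real by blast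
  obtain C0 where C0: "finite C0" "\<And>c j. c \<in> C0 \<Longrightarrow> c $ j > 0" "\<And>x. x \<in> \<Omega> \<Longrightarrow> \<exists>c\<in>C0. c \<bullet> x < 1"
    "\<And>c y. c \<in> C0 \<Longrightarrow> y \<in> orthant - \<Omega> \<Longrightarrow> c \<bullet> (s *\<^sub>R y) > 1"
    using finite_linear_forms[OF \<Omega> s(1)] by blast
  \<comment> \<open>Makes the forms of \<open>C0\<close> contribute at most 1/2 to \<open>q\<close>
    wherever they exceed \<open>s\<close>. Taking \<open>Suc k\<close> ensures that \<open>p\<close>
    is at least 1.\<close>
  obtain k where k: "2 * real (card C0) < s ^ k" using real_arch_pow[OF s(1)] by blast
  define p where "p = real (Suc k)"
  have p1: "p \<ge> 1" by (simp add: p_def)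
  have "s ^ k \<le> s ^ Suc k" using s(1) by (intro power_increasing) auto
  moreover have "s powr p = s ^ Suc k" unfolding p_def using s(1) by (intro powr_realpow) simp
  ultimately have sp: "2 * real (card C0) < s powr p" using k by linarith
  obtain R where R: "R > 0" "\<And>z. z \<in> ?X \<Longrightarrow> norm z \<le> R"
    using compact_imp_bounded[OF cpt] bounded_pos by metis
  \<comment> \<open>Beyond \<open>s * R\<close> the dilated domain is left behind;
    \<open>32 * pi\<close> is the product of the 4 from \<open>G_ge\<close> and the
    \<open>8 * pi\<close> in \<open>t\<close>; being at least 1 lets \<open>l\<close> be bounded by
    its powers.\<close>
  define l where "l = Max {1, s * R + 1, 32 * pi * C}"
  have l: "l \<ge> 1" "l > s * R" "l \<ge> 32 * pi * C" by (auto simp: l_def)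
  \<comment> \<open>On the box \<open>B\<close> below all moment coordinates are at most 8 pi l^2,
    so the \<open>\<eta>\<close> part of the spike form is at most 1/2 there.\<close>
  define \<eta> where "\<eta> = 1 / (2 * (8 * pi * l\<^sup>2 * ?N + 1))"
  have \<eta>: "\<eta> > 0" by (simp add: \<eta>_def add_nonneg_pos)
  define A where "A = (8 / (\<eta> * pi)) ^ (?N - 1)"
  have A: "A > 0" using \<eta> by (simp add: A_def)
  \<comment> \<open>The box \<open>E\<close> below has volume 8 \<open>\<delta>\<close>
    \<open>A\<close> / pi, which the second bound makes at most
    \<open>\<epsilon> / 2\<close>.\<close>
  define \<delta> where "\<delta> = min 1 (\<epsilon> * pi / (16 * A))"
  have \<delta>: "\<delta> > 0" "\<delta> \<le> 1" "\<delta> \<le> \<epsilon> * pi / (16 * A)" using \<epsilon> A by (auto simp: \<delta>_def)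
  obtain i0 :: 'n where True by blast
  define c where "c = (\<chi> j. (if j = i0 then 1 / \<delta> else 0) + \<eta>)"
  have cx: "c \<bullet> x = x $ i0 / \<delta> + \<eta> * (\<Sum>j\<in>UNIV. x $ j)" for x
  proof -
    have "c \<bullet> x = (\<Sum>j\<in>UNIV. (if j = i0 then x $ i0 / \<delta> else 0) + \<eta> * x $ j)"
      unfolding inner_vec_def c_def by (intro sum.cong) (auto simp: algebra_simps)
    then show ?thesis by (simp add: sum.distrib sum_distrib_left)
  qed
  have c_pos: "c $ j > 0" for j using \<delta>(1) \<eta> by (simp add: c_def add_pos_pos)
  interpret linear_form_mean "insert c C0" p
    by unfold_locales (use C0 c_pos p1 in auto)
  have CC: "c \<in> insert c C0" by simp
  have sub': "\<Omega> \<subseteq> region"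
  proof
    fix x assume x: "x \<in> \<Omega>"
    obtain d where d: "d \<in> C0" "d \<bullet> x < 1" using C0(3)[OF x] by blast
    have "x \<in> orthant" using x sub by blast
    then show "x \<in> region" using g_le_inner[of x d] d by (simp add: region_def)
  qed
  \<comment> \<open>Scaling by 1/s in the domain divides moments by s^2, while the forms of
    \<open>C0\<close> exceed 1 on the complement dilated only by \<open>s\<close>. The spare factor
    gives values above \<open>s\<close>.\<close>
  have q_le: "q (moment_map z) \<le> (c \<bullet> moment_map z) powr (- p) + 1 / 2" if "(1 / s) *\<^sub>R z \<notin> ?X" for z
  proof -
    let ?x = "moment_map z"
    have "d \<bullet> ?x > s" if d: "d \<in> C0" for d
    proof -
      have "moment_map ((1 / s) *\<^sub>R z) \<in> orthant - \<Omega>"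
        using \<open>(1 / s) *\<^sub>R z \<notin> ?X\<close> by (simp add: toric_domain_def moment_map_in_orthant)
      from C0(4)[OF d this] show ?thesis
        using s(1) by (simp add: moment_map_scaleR power2_eq_square field_simps)
    qed
    then have "(\<Sum>d\<in>C0. (d \<bullet> ?x) powr (- p)) \<le> (\<Sum>d\<in>C0. s powr (- p))"
      using s(1) p1 by (intro sum_mono powr_mono2') (auto intro: less_imp_le)
    also have "\<dots> \<le> 1 / 2" using sp s(1) by (simp add: powr_minus field_simps)
    finally have "(\<Sum>d\<in>C0. (d \<bullet> ?x) powr (- p)) \<le> 1 / 2" .
    moreover have "0 \<le> (c \<bullet> ?x) powr (- p)" by (rule powr_ge_zero)
    moreover have "q ?x \<le> (c \<bullet> ?x) powr (- p) + (\<Sum>d\<in>C0. (d \<bullet> ?x) powr (- p))"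
      unfolding q_def sum.insert_if[OF C0(1)] by simp
    ultimately show ?thesis by linarith
  qed
  \<comment> \<open>Half-sides enclosing \<open>c \<bullet> x \<le> 2\<close>, which forces moments
    at most 2 \<open>\<delta>\<close> in coordinate \<open>i0\<close> and 2 / \<open>\<eta>\<close>
    in the others.\<close>
  define r where "r j = (if j = i0 then sqrt (2 * \<delta> / pi) else sqrt (2 / (\<eta> * pi)))" for j
  define E where "E = cbox (\<chi> j. Complex (- r j) (- r j)) (\<chi> j. Complex (r j) (r j))"
  have cover: "toric_domain region \<subseteq> (\<lambda>z. s *\<^sub>R z) ` ?X \<union> E"
  proof
    fix z assume "z \<in> toric_domain region"
    then have Hz: "H z \<le> 1" by (simp add: toric_region)
    show "z \<in> (\<lambda>z. s *\<^sub>R z) ` ?X \<union> E"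
    proof (cases "(1 / s) *\<^sub>R z \<in> ?X")
      case True
      then have "z \<in> (\<lambda>z. s *\<^sub>R z) ` ?X" using s(1) by (intro image_eqI[of _ _ "(1 / s) *\<^sub>R z"]) auto
      then show ?thesis by blast
    next
      case False
      let ?x = "moment_map z"
      have z0: "z \<noteq> 0"
      proof
        assume "z = 0"
        moreover have "0 \<in> ?X" using X interior_subset by (auto simp: star_shaped_domain_def)
        ultimately show False using False by simp
      qed
      have xpos: "0 \<le> ?x $ j" for j by (simp add: moment_map_def)
      have cpos: "c \<bullet> ?x > 0" by (rule inner_moment_pos[OF z0 CC])
      have "1 \<le> q ?x" using one_less_g_iff[OF moment_map_in_orthant, of z] z0 Hz by fastforce
      then have ge: "(c \<bullet> ?x) powr (- p) \<ge> 1 / 2" using q_le[OF False] by linarith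
      \<comment> \<open>Outside the dilated domain the spike form must supply at least half of
        \<open>q\<close>, since \<open>q\<close> is at least 1; as \<open>p\<close> is at least 1,
        its value is then at most 2.\<close>
      have c2: "c \<bullet> ?x \<le> 2"
      proof (rule ccontr)
        assume "\<not> c \<bullet> ?x \<le> 2"
        then have "(c \<bullet> ?x) powr (- p) < 2 powr (- p)" using p1 by (intro powr_less_mono2_neg) auto
        also have "\<dots> \<le> 2 powr (- 1)" using p1 by (intro powr_mono) auto
        finally show False using ge by (simp add: powr_minus)
      qed
      have sumpos: "(\<Sum>j\<in>UNIV. ?x $ j) \<ge> 0" by (intro sum_nonneg xpos)
      have "?x $ i0 / \<delta> \<le> 2"
        using c2 \<eta> sumpos unfolding cx by (smt (verit) mult_nonneg_nonneg)
      then have x0: "?x $ i0 \<le> 2 * \<delta>" using \<delta>(1) by (simp add: pos_divide_le_eq)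
      have xj: "?x $ j \<le> 2 / \<eta>" for j
      proof -
        have "?x $ j \<le> (\<Sum>j\<in>UNIV. ?x $ j)" by (rule member_le_sum) (simp_all add: xpos)
        then have "\<eta> * ?x $ j \<le> \<eta> * (\<Sum>j\<in>UNIV. ?x $ j)" using \<eta> by simp
        also have "\<dots> \<le> 2"
        proof -
          have "?x $ i0 / \<delta> \<ge> 0" using xpos \<delta>(1) by simp
          then show ?thesis using c2 unfolding cx by linarith
        qed
        finally show ?thesis using \<eta> by (simp add: pos_le_divide_eq mult.commute)
      qed
      have rj: "cmod (z $ j) \<le> r j" for j
      proof (cases "j = i0")
        case True
        have "(cmod (z $ j))\<^sup>2 \<le> 2 * \<delta> / pi" using x0 True by (simp add: moment_map_def field_simps)
        then show ?thesis unfolding r_def using True by (simp add: real_le_rsqrt)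
      next
        case False
        have "pi * (cmod (z $ j))\<^sup>2 \<le> 2 / \<eta>" using xj[of j] by (simp add: moment_map_def)
        then have "(cmod (z $ j))\<^sup>2 \<le> 2 / (\<eta> * pi)" using \<eta> by (simp add: field_simps)
        then show ?thesis unfolding r_def using False by (simp add: real_le_rsqrt)
      qed
      have "z \<in> E" unfolding E_def mem_cube_box
      proof
        fix j
        show "- r j \<le> Re (z $ j) \<and> Re (z $ j) \<le> r j \<and> - r j \<le> Im (z $ j) \<and> Im (z $ j) \<le> r j"
          using rj[of j] abs_Re_le_cmod[of "z $ j"] abs_Im_le_cmod[of "z $ j"] by linarith
      qed
      then show ?thesis by blast
    qed
  qed
  have split_prod: "(\<Prod>j\<in>UNIV. if j = i0 then a else b) = a * b ^ (?N - 1)" for a b :: real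
  proof -
    have "(\<Prod>j\<in>UNIV. if j = i0 then a else b) = a * (\<Prod>j\<in>UNIV - {i0}. if j = i0 then a else b)"
      by (subst prod.remove[of _ i0]) auto
    also have "(\<Prod>j\<in>UNIV - {i0}. if j = i0 then a else b) = (\<Prod>j\<in>UNIV - {i0}. b)"
      by (intro prod.cong) auto
    finally show ?thesis by simp
  qed
  have volE: "measure lebesgue E \<le> \<epsilon> / 2"
  proof -
    have r0: "- r j \<le> r j" for j using \<delta>(1) \<eta> by (simp add: r_def)
    have "measure lebesgue E = (\<Prod>j\<in>UNIV. (r j - - r j)\<^sup>2)" unfolding E_def by (rule measure_cube_box[OF r0])
    also have "\<dots> = (\<Prod>j\<in>UNIV. if j = i0 then 8 * \<delta> / pi else 8 / (\<eta> * pi))"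
      using \<delta>(1) \<eta> by (intro prod.cong) (auto simp: r_def power_mult_distrib)
    also have "\<dots> = 8 * \<delta> / pi * A" by (simp only: split_prod A_def)
    also have "\<dots> \<le> \<epsilon> / 2" using \<delta>(3) A by (simp add: field_simps)
    finally show ?thesis .
  qed
  have cpt': "compact (toric_domain region)" using star_shaped by (simp add: star_shaped_domain_def)
  have vol_le: "measure lebesgue ?X \<le> measure lebesgue (toric_domain region)"
    using sub' lmeasurable_compact[OF cpt] lmeasurable_compact[OF cpt']
    by (intro measure_mono_fmeasurable) (auto simp: toric_domain_def fmeasurableD)
  have cptS: "compact ((\<lambda>z. s *\<^sub>R z) ` ?X)" by (rule compact_scaling[OF cpt])
  have volS: "measure lebesgue ((\<lambda>z. s *\<^sub>R z) ` ?X) = s ^ (2 * ?N) * V"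
    using measure_lebesgue_affine[of s "0 :: complex ^ 'n" ?X] s(1) by (simp add: V_def mult.commute)
  have vol_ge: "measure lebesgue (toric_domain region) \<le> measure lebesgue ?X + \<epsilon>"
  proof -
    have mS: "(\<lambda>z. s *\<^sub>R z) ` ?X \<in> lmeasurable" and mE: "E \<in> lmeasurable"
      using lmeasurable_compact[OF cptS] by (auto simp: E_def)
    have "measure lebesgue (toric_domain region) \<le> measure lebesgue ((\<lambda>z. s *\<^sub>R z) ` ?X \<union> E)"
      by (rule measure_mono_fmeasurable[OF cover])
        (use lmeasurable_compact[OF cpt'] mS mE in \<open>auto simp: fmeasurableD\<close>)
    also have "\<dots> \<le> measure lebesgue ((\<lambda>z. s *\<^sub>R z) ` ?X) + measure lebesgue E"
      by (rule measure_Un_le) (use mS mE in \<open>auto simp: fmeasurableD\<close>)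
    finally show ?thesis using volS volE s(2) by (simp add: V_def)
  qed
  \<comment> \<open>Then 2 pi t^2 = \<open>\<delta>\<close> / 4, so on \<open>B\<close> the thin
    coordinate adds at most 1/4 to the spike form.\<close>
  define t where "t = sqrt (\<delta> / (8 * pi))"
  have t: "t \<ge> 0" "t\<^sup>2 = \<delta> / (8 * pi)" using \<delta>(1) by (simp_all add: t_def)
  define lo where "lo j = (if j = i0 then 0 else l)" for j
  define hi where "hi j = (if j = i0 then t else 2 * l)" for j
  define B where "B = cbox (\<chi> j. Complex (lo j) (lo j)) (\<chi> j. Complex (hi j) (hi j))"
  \<comment> \<open>A long direction exists because n is at least 2; it places \<open>B\<close>
    outside the dilated domain.\<close>
  obtain j1 where j1: "j1 \<noteq> i0"
  proof -
    have "UNIV \<noteq> {i0}" using N2 by (metis One_nat_def card.empty card.insert empty_iff finite.emptyI not_less_eq_eq numeral_2_eq_2 order_refl)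
    then show ?thesis using that by blast
  qed
  \<comment> \<open>On \<open>B\<close> the spike form is at most 3/4, so its term in
    \<open>q\<close> is at least 1 and outweighs the 1/2 of the other forms; \<open>G_ge\<close>
    then applies to it.\<close>
  have inB: "z \<noteq> 0 \<and> H z \<le> 1 \<and> 1 / (4 * \<delta>) \<le> (\<Sum>j\<in>UNIV. G (moment_map z) $ j)" if z: "z \<in> B" for z
  proof -
    let ?x = "moment_map z"
    have zj: "lo j \<le> Re (z $ j)" "Re (z $ j) \<le> hi j" "lo j \<le> Im (z $ j)" "Im (z $ j) \<le> hi j" for j
      using z unfolding B_def mem_cube_box by blast+
    have lo0: "lo j \<ge> 0" for j using l by (simp add: lo_def)
    have xle: "?x $ j \<le> 2 * pi * (hi j)\<^sup>2" for j
    proof -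
      have "(Re (z $ j))\<^sup>2 \<le> (hi j)\<^sup>2" "(Im (z $ j))\<^sup>2 \<le> (hi j)\<^sup>2"
        using zj[of j] lo0[of j] by (auto intro!: power_mono)
      then have "(cmod (z $ j))\<^sup>2 \<le> 2 * (hi j)\<^sup>2" unfolding cmod_power2 by simp
      then have "pi * (cmod (z $ j))\<^sup>2 \<le> pi * (2 * (hi j)\<^sup>2)" by (intro mult_left_mono) auto
      then show ?thesis by (simp add: moment_map_def)
    qed
    have big: "norm z > s * R"
    proof -
      have "s * R < l" by (rule l(2))
      also have "l \<le> Re (z $ j1)" using zj(1)[of j1] j1 by (simp add: lo_def)
      also have "\<dots> \<le> cmod (z $ j1)" by (rule complex_Re_le_cmod)
      also have "\<dots> \<le> norm z" by (rule Finite_Cartesian_Product.norm_nth_le)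
      finally show ?thesis .
    qed
    have "s * R > 0" using R(1) s(1) by simp
    then have z0: "z \<noteq> 0" using big by auto
    have out: "(1 / s) *\<^sub>R z \<notin> ?X"
    proof
      assume "(1 / s) *\<^sub>R z \<in> ?X"
      from R(2)[OF this] show False using big s(1) by (simp add: field_simps)
    qed
    have x0: "?x $ i0 \<le> \<delta> / 4" using xle[of i0] t by (simp add: hi_def)
    have xj: "?x $ j \<le> 8 * pi * l\<^sup>2" for j
    proof (cases "j = i0")
      case True
      have "\<delta> / 4 \<le> 8 * pi * l\<^sup>2"
      proof -
        have "1 * 1 \<le> (8 * pi) * l\<^sup>2" using l(1) pi_ge_two by (intro mult_mono) (auto simp: one_le_power)
        then show ?thesis using \<delta>(2) by simp
      qed
      then show ?thesis using x0 True by simp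
    qed (use xle[of j] in \<open>simp add: hi_def power_mult_distrib\<close>)
    have "(\<Sum>j\<in>UNIV. ?x $ j) \<le> (\<Sum>j\<in>(UNIV::'n set). 8 * pi * l\<^sup>2)" by (intro sum_mono xj)
    then have "\<eta> * (\<Sum>j\<in>UNIV. ?x $ j) \<le> \<eta> * (8 * pi * l\<^sup>2 * ?N + 1)" using \<eta> by (simp add: mult_ac)
    also have "\<dots> = 1 / 2"
    proof -
      have "8 * pi * l\<^sup>2 * ?N + 1 > 0" by (simp add: add_nonneg_pos)
      then show ?thesis by (simp add: \<eta>_def)
    qed
    finally have c1: "c \<bullet> ?x \<le> 1"
    proof -
      assume le: "\<eta> * (\<Sum>j\<in>UNIV. ?x $ j) \<le> 1 / 2"
      have "?x $ i0 / \<delta> \<le> 1 / 4" using x0 \<delta>(1) by (simp add: pos_divide_le_eq)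
      then show ?thesis using le unfolding cx by linarith
    qed
    have cpos: "c \<bullet> ?x > 0" by (rule inner_moment_pos[OF z0 CC])
    have "1 powr (- p) \<le> (c \<bullet> ?x) powr (- p)" using c1 cpos p1 by (intro powr_mono2') auto
    then have "q ?x \<le> 2 * (c \<bullet> ?x) powr (- p)" using q_le[OF out] by simp
    from G_ge[OF moment_map_in_orthant _ CC this p1] z0
    have "c $ i0 / 4 \<le> G ?x $ i0" by simp
    also have "G ?x $ i0 \<le> (\<Sum>j\<in>UNIV. G ?x $ j)" by (rule member_le_sum) (simp_all add: G_nonneg)
    finally have "c $ i0 / 4 \<le> (\<Sum>j\<in>UNIV. G ?x $ j)" .
    moreover have "1 / \<delta> / 4 \<le> c $ i0 / 4" using \<eta> by (intro divide_right_mono) (simp_all add: c_def)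
    ultimately have "1 / \<delta> / 4 \<le> (\<Sum>j\<in>UNIV. G ?x $ j)" by (rule order.trans[rotated])
    moreover have "H z \<le> 1" using g_le_inner[OF moment_map_in_orthant CC, of z] c1 by linarith
    ultimately show ?thesis using z0 by (simp add: mult.commute)
  qed
  have volB: "measure lebesgue B = \<delta> / (8 * pi) * (l\<^sup>2) ^ (?N - 1)"
  proof -
    have "lo j \<le> hi j" for j using t l by (simp add: lo_def hi_def)
    then have "measure lebesgue B = (\<Prod>j\<in>UNIV. (hi j - lo j)\<^sup>2)" unfolding B_def by (rule measure_cube_box)
    also have "\<dots> = (\<Prod>j\<in>UNIV. if j = i0 then \<delta> / (8 * pi) else l\<^sup>2)"
      using t by (intro prod.cong) (auto simp: lo_def hi_def)
    finally show ?thesis by (simp only: split_prod)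
  qed
  have "C \<le> Ruelle_invariant (toric_domain region)"
  proof -
    \<comment> \<open>The thickness cancels between density and volume, leaving l^(2(n-1)) / (32
      pi), which is at least l / (32 pi) since n is at least 2.\<close>
    have "C \<le> l / (32 * pi)" using l(3) by (simp add: field_simps)
    also have "\<dots> \<le> (l\<^sup>2) ^ (?N - 1) / (32 * pi)"
    proof -
      have "l ^ 1 \<le> l ^ (2 * (?N - 1))" using l(1) N2 by (intro power_increasing) auto
      then show ?thesis by (simp add: power_mult divide_right_mono)
    qed
    also have "\<dots> = 1 / (4 * \<delta>) * measure lebesgue B" using \<delta>(1) by (simp add: volB)
    also have "\<dots> \<le> fact ?N * (1 / (4 * \<delta>) * measure lebesgue B)"
    proof -
      have "1 \<le> (fact ?N :: real)" by (rule fact_ge_1)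
      moreover have "0 \<le> 1 / (4 * \<delta>) * measure lebesgue B" using \<delta>(1) by simp
      ultimately show ?thesis by (metis mult_1 mult_right_mono)
    qed
    also have "\<dots> \<le> Ruelle_invariant (toric_domain region)"
      by (rule Ruelle_invariant_ge) (use inB in \<open>auto simp: B_def\<close>)
    finally show ?thesis .
  qed
  moreover have "min_period ?X \<le> min_period (toric_domain region)"
    using min_period_mono[OF X K star_shaped _ sub'] region_concave by (simp add: concave_region_def)
  ultimately show ?thesis using region_smooth region_concave sub' vol_le vol_ge by blast
qed

end
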